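(* Let $p(\cdot)\in\mathcal P_0$ and suppose $0<p_-\le p_+<1$ and $p(\cdot)\in LH$. Then there is a constant $C$ such that for all sequences of cubes $\{Q_k\}$ and all sequences of non-negative functions $\{g_k\}$ with $\operatorname{supp}(g_k)\subset Q_k$, $$\left\|\sum_k g_k\right\|_{L^{p(\cdot)}}\le C\left\|\sum_k\left(\frac1{|Q_k|}\int_{Q_k}g_k\,dy\right)\chi_{Q_k}\right\|_{L^{p(\cdot)}}.$$ If, in place of $p_+<1$, one only assumes that $p_+<\infty$ (still with $p_->0$ and $p(\cdot)\in LH$), then for any $q$ such that $p_+<q<\infty$ there is a constant $C$ such that for all such sequences $\{Q_k\}$ and $\{g_k\}$, $$\left\|\sum_k g_k\right\|_{L^{p(\cdot)}}\le C\left\|\sum_k\left(\frac1{|Q_k|}\int_{Q_k}g_k^q\,dy\right)^{\frac1q}\chi_{Q_k}\right\|_{L^{p(\cdot)}}.$$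
   Context: Cubes in $\mathbb{R}^n$ have sides parallel to the coordinate axes; $|Q|$ is the Lebesgue measure of $Q$ and $\chi_Q$ its characteristic function. $\mathcal P_0$ is the set of measurable functions $p(\cdot):\mathbb{R}^n\to(0,\infty)$; $p_-=\operatorname{ess\,inf}_{x}p(x)$, $p_+=\operatorname{ess\,sup}_{x}p(x)$. $p(\cdot)\in LH$ (log-Hölder continuity) means there are constants $C_0,C_\infty,p_\infty$ with $|p(x)-p(y)|\le\frac{C_0}{-\log(|x-y|)}$ for $|x-y|<\frac12$ and $|p(x)-p_\infty|\le\frac{C_\infty}{\log(e+|x|)}$ for all $x$. $\|f\|_{L^{p(\cdot)}}=\inf\left\{\lambda>0:\int_{\mathbb{R}^n}\left(\frac{|f(x)|}{\lambda}\right)^{p(x)}dx\le1\right\}$. The constants $C$ do not depend on the sequences $\{Q_k\}$ and $\{g_k\}$.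
   Formalization: The second inequality is proved for q with q ≥ 1 and p_+ < q < ∞; for p_+ < q < 1 it is false (split a cube Q into N equal pieces E_k, Q_k = Q, g_k = χ_{E_k}: the right side tends to 0 as N → ∞). *)

theory Defs
  imports "HOL-Analysis.Analysis" "HOL-Probability.Essential_Supremum"
begin

text \<open>Closed, open and partially open cubes are all admitted: an order-convex set of this kind is a
  product of \<open>n\<close> intervals with end points \<open>a $ i\<close> and \<open>a $ i + l\<close>.\<close>

definition is_cube :: "(real ^ 'n) set \<Rightarrow> bool" where
  "is_cube Q \<longleftrightarrow> is_interval Q \<and>
     (\<exists>a l. 0 < l \<and> box a (a + vec l) \<subseteq> Q \<and> Q \<subseteq> cbox a (a + vec l))"

definition exponents :: "(real ^ 'n \<Rightarrow> real) set" where
  "exponents = {p. p \<in> borel_measurable lebesgue \<and> (\<forall>x. 0 < p x)}"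

definition p_minus :: "(real ^ 'n \<Rightarrow> real) \<Rightarrow> ereal" where
  "p_minus p = Sup {z. AE x in lebesgue. z \<le> ereal (p x)}"

definition p_plus :: "(real ^ 'n \<Rightarrow> real) \<Rightarrow> ereal" where
  "p_plus p = esssup lebesgue (\<lambda>x. ereal (p x))"

text \<open>For \<open>x = y\<close> the local condition reads \<open>0 \<le> C0 / 0 = 0\<close> and imposes nothing.\<close>

definition log_Hoelder :: "(real ^ 'n \<Rightarrow> real) \<Rightarrow> bool" where
  "log_Hoelder p \<longleftrightarrow> (\<exists>C0 Cinf pinf.
     (\<forall>x y. norm (x - y) < 1 / 2 \<longrightarrow> \<bar>p x - p y\<bar> \<le> C0 / (- ln (norm (x - y)))) \<and>
     (\<forall>x. \<bar>p x - pinf\<bar> \<le> Cinf / ln (exp 1 + norm x)))"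

text \<open>Real powers of extended non-negative numbers, for exponents \<open>a > 0\<close> only.\<close>

definition ennpow :: "ennreal \<Rightarrow> real \<Rightarrow> ennreal" where
  "ennpow t a = (if t = top then top else ennreal (enn2real t powr a))"

text \<open>Functions take values in \<open>[0, \<infinity>]\<close>, so no absolute value is needed; the
  quasi-norm is \<open>top\<close> when no \<open>lam\<close> is admissible.\<close>

definition Lp_var_norm :: "(real ^ 'n \<Rightarrow> real) \<Rightarrow> (real ^ 'n \<Rightarrow> ennreal) \<Rightarrow> ennreal" where
  "Lp_var_norm p f = Inf {ennreal lam | lam. 0 < lam \<and>
     (\<integral>\<^sup>+ x. ennpow (f x / ennreal lam) (p x) \<partial>lebesgue) \<le> 1}"

definition cube_avg :: "(real ^ 'n) set \<Rightarrow> (real ^ 'n \<Rightarrow> real) \<Rightarrow> ennreal" where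
  "cube_avg Q f = (\<integral>\<^sup>+ y \<in> Q. ennreal (f y) \<partial>lebesgue) / emeasure lebesgue Q"

definition admissible ::
  "(nat \<Rightarrow> (real ^ 'n) set) \<Rightarrow> (nat \<Rightarrow> real ^ 'n \<Rightarrow> real) \<Rightarrow> bool" where
  "admissible Q g \<longleftrightarrow> (\<forall>k. is_cube (Q k) \<and> g k \<in> borel_measurable lebesgue \<and>
     (\<forall>x. 0 \<le> g k x) \<and> {x. g k x \<noteq> 0} \<subseteq> Q k)"

end

theory Submission
  imports Defs
begin

text \<open>
  Write \<open>F\<close> for the sum of the averages and \<open>G\<close> for the sum of the functions \<open>g k\<close>. Scaling both sums
  reduces the norm inequality to a statement on modulars: if \<open>F\<close> has modular at most 1, the modular
  of \<open>G\<close> is bounded (\<open>Lp_var_norm_le_of_modular\<close>).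

  If all values of \<open>p\<close> are below 1, the power \<open>G powr p\<close> is at most \<open>G / V + V powr (p / (1 - p))\<close> for every
  weight \<open>V\<close>, and the first term is linear in \<open>G\<close>, so it can be integrated cube by cube. If \<open>1 / V\<close> on each
  cube is at most a constant times its mean there, then every \<open>g k\<close> may be replaced by its average, which gives
  \<open>F / V\<close> in place of \<open>G / V\<close>. This is at most \<open>F powr p\<close> as soon as \<open>V\<close> is a majorant
  of \<open>F powr (1 - p)\<close>. Such a majorant is a power \<open>1 / e\<close> of the maximal function of
  \<open>F powr ((1 - p) * e)\<close> with small \<open>e\<close>: its reciprocal has the required property because on half of each
  cube a maximal function is at most a constant times its value at a given point
  (\<open>inverse_maximal_power_le_mean\<close>), and its modular with exponent \<open>p / (1 - p)\<close> is bounded because the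
  maximal operator acts on spaces with log-Hoelder continuous exponents bounded away from 1
  (\<open>maximal_modular_bounded\<close>).

  For larger exponents only a power \<open>s\<close> below 1 of \<open>G\<close> can be linearised in this way, and the rest,
  \<open>G powr (p - s)\<close>, is treated as a test function \<open>\<phi>\<close> in the space dual to exponent \<open>p / s\<close>
  (\<open>modular_bound_by_duality\<close>). On a cube, Hoelder's inequality bounds the integral of \<open>g k * \<phi>\<close> by the
  \<open>q\<close>-mean of \<open>g k\<close> and the \<open>q'\<close>-mean of \<open>\<phi>\<close>, and the latter is at most a power of the maximal function
  of \<open>\<phi> powr q'\<close>. This maximal function is under control if \<open>p / s\<close> stays below \<open>q\<close>. Both
  conditions, \<open>s < 1\<close> and \<open>1 < p / s < q\<close>, hold uniformly when \<open>s\<close> is allowed to be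
  variable (\<open>modular_bound_power_means\<close>).
\<close>

section \<open>Real powers of extended non-negative numbers\<close>

lemma ennpow_ennreal [simp]: "0 \<le> x \<Longrightarrow> ennpow (ennreal x) a = ennreal (x powr a)"
  by (simp add: ennpow_def)

lemma ennpow_top [simp]: "ennpow top a = top"
  by (simp add: ennpow_def)

lemma ennpow_0 [simp]: "ennpow 0 a = 0"
  by (simp add: ennpow_def)

lemma ennpow_one [simp]: "ennpow t 1 = t"
  by (cases t) auto

lemma ennpow_mono: "x \<le> y \<Longrightarrow> 0 \<le> a \<Longrightarrow> ennpow x a \<le> ennpow y a"
  by (cases x; cases y) (auto intro!: ennreal_leI powr_mono2 simp: top_unique)

lemma ennpow_ennpow: "ennpow (ennpow t a) b = ennpow t (a * b)"
  by (cases t) (auto simp: powr_powr)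

lemma ennpow_inverse_cancel: "a \<noteq> 0 \<Longrightarrow> ennpow (ennpow t a) (1 / a) = t"
  by (simp add: ennpow_ennpow)

lemma ennpow_inverse_cancel': "a \<noteq> 0 \<Longrightarrow> ennpow (ennpow t (1 / a)) a = t"
  by (simp add: ennpow_ennpow)

lemma ennpow_add: "ennpow t (a + b) = ennpow t a * ennpow t b"
  by (cases t) (auto simp: powr_add ennreal_mult ennreal_top_mult)

lemma ennpow_eq_0_iff [simp]: "ennpow t a = 0 \<longleftrightarrow> t = 0"
  by (cases t) auto

lemma ennpow_eq_top_iff [simp]: "ennpow t a = top \<longleftrightarrow> t = top"
  by (cases t) auto

lemma ennpow_mult: "ennpow (x * y) a = ennpow x a * ennpow y a"
proof (cases "x = top \<or> y = top")
  case True
  then show ?thesis by (auto simp: ennreal_top_mult ennreal_mult_top)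
next
  case False
  then show ?thesis
    by (cases x; cases y) (auto simp: powr_mult simp flip: ennreal_mult)
qed

lemma ennreal_inverse_antimono:
  fixes x y :: ennreal
  assumes "x \<le> y" shows "inverse y \<le> inverse x"
proof (cases "x = 0 \<or> y = top")
  case False
  with assms show ?thesis
    by (cases x; cases y) (auto simp: inverse_ennreal less_le top_unique intro!: ennreal_leI le_imp_inverse_le)
qed auto

lemma ennpow_inverse_base: "0 < a \<Longrightarrow> inverse (ennpow t a) = ennpow (inverse t) a"
proof (cases t)
  case (real r)
  assume "0 < a"
  with real show ?thesis
    by (cases "r = 0") (auto simp: inverse_ennreal powr_minus inverse_powr)
qed auto

lemma ennpow_le_iff: "0 < a \<Longrightarrow> ennpow x a \<le> ennpow y a \<longleftrightarrow> x \<le> y"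
  by (metis ennpow_inverse_cancel ennpow_mono less_eq_real_def less_numeral_extra(3) zero_le_divide_1_iff)

lemma ennpow_le_swap: "0 < a \<Longrightarrow> ennpow x a \<le> y \<longleftrightarrow> x \<le> ennpow y (1 / a)"
  by (metis ennpow_inverse_cancel' ennpow_le_iff less_irrefl)

lemma ennpow_exponent_mono_ge1: "1 \<le> t \<Longrightarrow> a \<le> b \<Longrightarrow> ennpow t a \<le> ennpow t b"
  by (cases t) (auto intro!: ennreal_leI powr_mono)

lemma ennpow_exponent_mono_le1:
  "t \<le> 1 \<Longrightarrow> 0 \<le> a \<Longrightarrow> a \<le> b \<Longrightarrow> ennpow t b \<le> ennpow t a"
  by (cases t) (auto intro!: ennreal_leI powr_mono' simp: top_unique)

lemma ennpow_add_le:
  assumes "0 \<le> a"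
  shows "ennpow (x + y) a \<le> ennreal (2 powr a) * (ennpow x a + ennpow y a)"
proof -
  have "x + y \<le> ennreal 2 * max x y"
    by (simp add: mult_2 add_mono)
  then have "ennpow (x + y) a \<le> ennreal (2 powr a) * ennpow (max x y) a"
    using ennpow_mono[OF _ assms] by (metis ennpow_ennreal ennpow_mult zero_le_numeral)
  also have "ennpow (max x y) a \<le> ennpow x a + ennpow y a"
    by (auto simp: max_def)
  finally show ?thesis by (simp add: mult_left_mono)
qed

lemma borel_measurable_ennpow [measurable (raw)]:
  assumes [measurable]: "f \<in> borel_measurable M" "p \<in> borel_measurable M"
  shows "(\<lambda>x. ennpow (f x) (p x)) \<in> borel_measurable M"
  unfolding ennpow_def by measurable

text \<open>If \<open>y\<close> is at most \<open>x powr (a - 1)\<close>, the product is at most the first power, and otherwise at most the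
  second one.\<close>

lemma young_ennreal:
  assumes a: "1 < a" and ab: "1 / a + 1 / b = 1"
  shows "x * y \<le> ennpow x a + ennpow y b"
proof -
  have b: "b = a / (a - 1)"
    using assms by (cases "b = 0") (auto simp: field_simps)
  show ?thesis
  proof (cases "y \<le> ennpow x (a - 1)")
    case True
    then have "x * y \<le> ennpow x 1 * ennpow x (a - 1)" by (simp add: mult_left_mono)
    also have "\<dots> = ennpow x a" by (subst ennpow_add [symmetric]) simp
    finally show ?thesis by (simp add: add_increasing2)
  next
    case False
    then have "x \<le> ennpow y (1 / (a - 1))"
      using a by (simp flip: ennpow_le_swap)
    then have "x * y \<le> ennpow y (1 / (a - 1)) * ennpow y 1" by (simp add: mult_right_mono)
    also have "\<dots> = ennpow y b" unfolding b using a
      by (subst ennpow_add [symmetric]) (simp add: field_simps)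
    finally show ?thesis by (simp add: add_increasing)
  qed
qed

text \<open>This replaces Young's inequality for an exponent below 1: the term containing \<open>u\<close> is linear in \<open>u\<close>, which is what
  allows sums of functions to be integrated term by term. The threshold is \<open>u = v powr (1 / (1 - s))\<close>.\<close>

lemma young_concave_ennreal:
  assumes "0 < s" "s < 1"
  shows "ennpow u s \<le> u * inverse v + ennpow v (s / (1 - s))"
proof (cases "ennpow u (1 - s) \<le> v")
  case True
  then have "u \<le> ennpow v (1 / (1 - s))" using assms by (simp add: ennpow_le_swap)
  from ennpow_mono[OF this, of s] assms have "ennpow u s \<le> ennpow v (s / (1 - s))"
    by (simp add: ennpow_ennpow)
  then show ?thesis by (simp add: add_increasing)
next
  case False
  show ?thesis
  proof (cases "v = 0 \<or> u = top")
    case True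
    with False show ?thesis
      by (auto simp: ennreal_mult_top top_unique ennreal_top_mult not_le split: if_splits)
  next
    case nt: False
    then obtain a b where ab: "u = ennreal a" "v = ennreal b" "0 \<le> a" "0 < b"
      using False by (cases u; cases v) (auto simp: less_le top_unique)
    have "b < a powr (1 - s)" using False ab by (simp add: ennreal_le_iff)
    then have "0 < a" using ab by (cases "a = 0") auto
    have "a powr s = a / a powr (1 - s)" using \<open>0 < a\<close> by (simp add: powr_diff field_simps)
    also have "\<dots> \<le> a / b" using \<open>b < _\<close> ab \<open>0 < a\<close> by (intro divide_left_mono) auto
    finally show ?thesis using ab
      by (auto simp: inverse_ennreal divide_inverse simp flip: ennreal_mult intro!: add_increasing2 ennreal_leI)
  qed
qed

section \<open>The maximal operator and its weak type inequality\<close>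

lemma emeasure_lebesgue_ball:
  "0 \<le> r \<Longrightarrow> emeasure lebesgue (ball c r :: 'a::euclidean_space set) =
     ennreal (unit_ball_vol DIM('a) * r ^ DIM('a))"
  by (simp add: emeasure_ball)

lemma emeasure_lebesgue_ball_pos: "0 < r \<Longrightarrow> 0 < emeasure lebesgue (ball c r :: 'a::euclidean_space set)"
  by (simp add: emeasure_ball)

lemma emeasure_lebesgue_ball_finite: "emeasure lebesgue (ball c r :: 'a::euclidean_space set) < top"
  by (cases "0 \<le> r") (auto simp: emeasure_ball ball_empty)

lemma emeasure_lebesgue_ball_scale:
  assumes "0 \<le> k" "0 \<le> r"
  shows "emeasure lebesgue (ball c (k * r) :: 'a::euclidean_space set) =
           ennreal (k ^ DIM('a)) * emeasure lebesgue (ball d r :: 'a set)"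
  using assms by (simp add: emeasure_ball power_mult_distrib mult_ac flip: ennreal_mult)

definition set_mean :: "'a::euclidean_space set \<Rightarrow> ('a \<Rightarrow> ennreal) \<Rightarrow> ennreal" where
  "set_mean S f = (\<integral>\<^sup>+ y \<in> S. f y \<partial>lebesgue) / emeasure lebesgue S"

lemma set_mean_mult:
  assumes "0 < emeasure lebesgue S" "emeasure lebesgue S < top"
  shows "set_mean S f * emeasure lebesgue S = (\<integral>\<^sup>+ y \<in> S. f y \<partial>lebesgue)"
  unfolding set_mean_def ennreal_divide_times using assms by simp

lemma set_mean_le_iff:
  assumes "0 < emeasure lebesgue S" "emeasure lebesgue S < top"
  shows "set_mean S f \<le> t \<longleftrightarrow> (\<integral>\<^sup>+ y \<in> S. f y \<partial>lebesgue) \<le> t * emeasure lebesgue S"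
proof
  assume "set_mean S f \<le> t"
  then have "set_mean S f * emeasure lebesgue S \<le> t * emeasure lebesgue S" by (rule mult_right_mono) simp
  then show "(\<integral>\<^sup>+ y \<in> S. f y \<partial>lebesgue) \<le> t * emeasure lebesgue S" by (simp add: set_mean_mult assms)
next
  assume "(\<integral>\<^sup>+ y \<in> S. f y \<partial>lebesgue) \<le> t * emeasure lebesgue S"
  then show "set_mean S f \<le> t"
    unfolding set_mean_def using assms(1) by (intro divide_le_posI_ennreal) (auto simp: mult.commute)
qed

lemma set_mean_mono: "(\<And>y. y \<in> S \<Longrightarrow> f y \<le> g y) \<Longrightarrow> set_mean S f \<le> set_mean S g"
  unfolding set_mean_def
  by (intro divide_right_mono_ennreal nn_integral_mono) (auto split: split_indicator)

lemma set_mean_add: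
  assumes "f \<in> borel_measurable lebesgue" "g \<in> borel_measurable lebesgue" "S \<in> sets lebesgue"
  shows "set_mean S (\<lambda>y. f y + g y) = set_mean S f + set_mean S g"
  unfolding set_mean_def using assms by (simp add: nn_set_integral_add add_divide_distrib_ennreal)

lemma set_mean_cmult:
  assumes "f \<in> borel_measurable lebesgue" "S \<in> sets lebesgue"
  shows "set_mean S (\<lambda>y. c * f y) = c * set_mean S f"
  unfolding set_mean_def using assms
  by (simp add: mult.assoc nn_integral_cmult ennreal_times_divide)

lemma set_mean_const:
  assumes "S \<in> sets lebesgue" "0 < emeasure lebesgue S" "emeasure lebesgue S < top"
  shows "set_mean S (\<lambda>y. c) = c"
  unfolding set_mean_def using assms
  by (simp add: nn_integral_cmult_indicator mult_divide_eq_ennreal)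

text \<open>With the value \<open>f x\<close> included, \<open>f \<le> maximal f\<close> holds at every point by definition, and not just almost
  everywhere by the Lebesgue differentiation theorem. Chebyshev's inequality carries the additional
  term through the weak type inequality.\<close>

definition maximal :: "('a::euclidean_space \<Rightarrow> ennreal) \<Rightarrow> 'a \<Rightarrow> ennreal" where
  "maximal f x = max (f x) (SUP (c, r) \<in> {(c, r). x \<in> ball c r}. set_mean (ball c r) f)"

lemma le_maximal: "f x \<le> maximal f x"
  by (simp add: maximal_def)

lemma set_mean_le_maximal: "x \<in> ball c r \<Longrightarrow> set_mean (ball c r) f \<le> maximal f x"
  unfolding maximal_def by (rule max.coboundedI2) (rule SUP_upper2 [of "(c, r)"], auto)

lemma maximal_least:
  assumes "f x \<le> u" "\<And>c r. x \<in> ball c r \<Longrightarrow> set_mean (ball c r) f \<le> u"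
  shows "maximal f x \<le> u"
  unfolding maximal_def using assms by (auto intro!: SUP_least)

lemma maximal_superlevel:
  "{x. t < maximal f x} =
     {x. t < f x} \<union> \<Union> {ball c r | c r. t < set_mean (ball c r) f}" (is "?L = ?A \<union> ?B")
proof -
  have "t < maximal f x \<longleftrightarrow> t < f x \<or> (\<exists>c r. x \<in> ball c r \<and> t < set_mean (ball c r) f)" for x
    unfolding maximal_def by (auto simp: less_max_iff_disj less_SUP_iff)
  then show ?thesis by blast
qed

lemma borel_measurable_maximal [measurable]:
  assumes [measurable]: "f \<in> borel_measurable lebesgue"
  shows "maximal f \<in> borel_measurable lebesgue"
proof (rule borel_measurableI_greater)
  fix t
  have "open (\<Union> {ball c r | c r. t < set_mean (ball c r) f})" by auto
  moreover have "{x \<in> space lebesgue. t < f x} \<in> sets lebesgue" by measurable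
  ultimately show "{x \<in> space lebesgue. t < maximal f x} \<in> sets lebesgue"
    using maximal_superlevel[of t f] by (auto intro!: sets.Un)
qed

text \<open>A ball of mean larger than \<open>t\<close> has measure at most \<open>1 / t\<close> times the integral, so the radii of
  these balls are bounded and Vitali's lemma selects disjoint ones whose fivefold
  dilations still cover.\<close>

lemma weak_type_balls:
  fixes f :: "'a::euclidean_space \<Rightarrow> ennreal"
  assumes [measurable]: "f \<in> borel_measurable lebesgue" and t: "0 < t" "t < top"
  shows "t * emeasure lebesgue (\<Union> {ball c r | c r. t < set_mean (ball c r) f})
           \<le> ennreal (5 ^ DIM('a)) * (\<integral>\<^sup>+ x. f x \<partial>lebesgue)"
proof (cases "(\<integral>\<^sup>+ x. f x \<partial>lebesgue) = top")
  case True
  then show ?thesis by (simp add: ennreal_mult_top)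
next
  case False
  define K where "K = {(c, r). 0 < r \<and> t < set_mean (ball c r) f}"
  define U where "U = \<Union> {ball c r | c r. t < set_mean (ball c r) f}"
  obtain t' where t': "t = ennreal t'" "0 < t'" using t by (cases t) auto
  obtain I where I: "(\<integral>\<^sup>+ x. f x \<partial>lebesgue) = ennreal I" "0 \<le> I" using False
    by (cases "\<integral>\<^sup>+ x. f x \<partial>lebesgue") auto
  have ballI: "t * emeasure lebesgue (ball c r) \<le> (\<integral>\<^sup>+ y \<in> ball c r. f y \<partial>lebesgue)"
    if "(c, r) \<in> K" for c r
  proof -
    have r: "0 < r" using that by (simp add: K_def)
    have "t * emeasure lebesgue (ball c r) \<le> set_mean (ball c r) f * emeasure lebesgue (ball c r)"
      using that by (intro mult_right_mono) (auto simp: K_def)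
    also have "\<dots> = (\<integral>\<^sup>+ y \<in> ball c r. f y \<partial>lebesgue)"
      by (rule set_mean_mult [OF emeasure_lebesgue_ball_pos [OF r] emeasure_lebesgue_ball_finite])
    finally show ?thesis .
  qed
  have Ipos: "(\<integral>\<^sup>+ y \<in> S. f y \<partial>lebesgue) \<le> ennreal I" for S
    unfolding I(1)[symmetric] by (intro nn_integral_mono) (auto split: split_indicator)
  let ?w = "unit_ball_vol DIM('a)"
  have w: "0 < ?w" by simp
  have bd: "0 < snd i \<and> snd i \<le> max 1 (I / (t' * ?w))" if "i \<in> K" for i
  proof -
    obtain c r where icr: "i = (c, r)" by (cases i)
    with that have i: "i = (c, r)" "0 < r" by (auto simp: K_def)
    have "ennreal (t' * (?w * r ^ DIM('a))) \<le> ennreal I"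
      using order_trans[OF ballI Ipos, of c r] that i t' w
      by (simp add: emeasure_ball flip: ennreal_mult)
    then have "t' * (?w * r ^ DIM('a)) \<le> I" using I by (simp add: ennreal_le_iff)
    then have *: "r ^ DIM('a) \<le> I / (t' * ?w)" using t' w by (simp add: field_simps)
    have "r \<le> max 1 (I / (t' * ?w))"
    proof (cases "r \<le> 1")
      case False
      then have "r ^ 1 \<le> r ^ DIM('a)" by (intro power_increasing) (auto simp: Suc_leI)
      with * show ?thesis by simp
    qed simp
    with i show ?thesis by simp
  qed
  have "U \<subseteq> (\<Union>i\<in>K. ball (fst i) (snd i))"
  proof
    fix x assume "x \<in> U"
    then obtain c r where cr: "x \<in> ball c r" "t < set_mean (ball c r) f" by (auto simp: U_def)
    then have "0 < r" using zero_le_dist[of c x] by (simp del: zero_le_dist)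
    then show "x \<in> (\<Union>i\<in>K. ball (fst i) (snd i))" using cr by (auto simp: K_def intro!: bexI[of _ "(c, r)"])
  qed
  from Vitali_covering_lemma_balls[OF this bd]
  obtain C where C: "countable C" "C \<subseteq> K"
    "pairwise (\<lambda>i j. disjnt (ball (fst i) (snd i)) (ball (fst j) (snd j))) C"
    "U \<subseteq> (\<Union>i\<in>C. ball (fst i) (5 * snd i))" by blast
  have disj: "disjoint_family_on (\<lambda>i. ball (fst i) (snd i)) C"
    using C(3) by (auto simp: disjoint_family_on_def pairwise_def disjnt_def)
  have op: "open (\<Union>i\<in>C. ball (fst i) (5 * snd i))" by auto
  have "t * emeasure lebesgue U \<le> t * emeasure lebesgue (\<Union>i\<in>C. ball (fst i) (5 * snd i))"
    using op by (intro mult_left_mono emeasure_mono C(4)) auto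
  also have "\<dots> \<le> t * (\<integral>\<^sup>+ i. emeasure lebesgue (ball (fst i) (5 * snd i)) \<partial>count_space C)"
  proof (rule mult_left_mono)
    have "emeasure lebesgue (\<Union>i\<in>C. ball (fst i) (5 * snd i))
        = (\<integral>\<^sup>+ x. indicator (\<Union>i\<in>C. ball (fst i) (5 * snd i)) x \<partial>lebesgue)"
      using op by (intro nn_integral_indicator [symmetric]) auto
    also have "\<dots> \<le> (\<integral>\<^sup>+ x. (\<integral>\<^sup>+ i. indicator (ball (fst i) (5 * snd i)) x \<partial>count_space C) \<partial>lebesgue)"
    proof (intro nn_integral_mono)
      fix x
      show "indicator (\<Union>i\<in>C. ball (fst i) (5 * snd i)) x
          \<le> (\<integral>\<^sup>+ i. indicator (ball (fst i) (5 * snd i)) x \<partial>count_space C)"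
      proof (cases "x \<in> (\<Union>i\<in>C. ball (fst i) (5 * snd i))")
        case True
        then obtain i where "i \<in> C" "x \<in> ball (fst i) (5 * snd i)" by blast
        then show ?thesis
          using nn_integral_ge_point[of i C "\<lambda>i. indicator (ball (fst i) (5 * snd i)) x"] True
          by (simp only: indicator_simps)
      qed simp
    qed
    also have "\<dots> = (\<integral>\<^sup>+ i. emeasure lebesgue (ball (fst i) (5 * snd i)) \<partial>count_space C)"
      using C(1) by (subst nn_integral_count_space_nn_integral) (auto intro!: borel_measurable_indicator)
    finally show "emeasure lebesgue (\<Union>i\<in>C. ball (fst i) (5 * snd i)) \<le> \<dots>" .
  qed simp
  also have "\<dots> = (\<integral>\<^sup>+ i. t * emeasure lebesgue (ball (fst i) (5 * snd i)) \<partial>count_space C)"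
    by (simp add: nn_integral_cmult)
  also have "\<dots> \<le> (\<integral>\<^sup>+ i. ennreal (5 ^ DIM('a)) * (\<integral>\<^sup>+ y \<in> ball (fst i) (snd i). f y \<partial>lebesgue) \<partial>count_space C)"
  proof (intro nn_integral_mono)
    fix i assume "i \<in> space (count_space C)"
    then have i: "(fst i, snd i) \<in> K" using C(2) by auto
    then have "emeasure lebesgue (ball (fst i) (5 * snd i)) =
                 ennreal (5 ^ DIM('a)) * emeasure lebesgue (ball (fst i) (snd i))"
      by (intro emeasure_lebesgue_ball_scale) (auto simp: K_def)
    then have "t * emeasure lebesgue (ball (fst i) (5 * snd i)) =
                 ennreal (5 ^ DIM('a)) * (t * emeasure lebesgue (ball (fst i) (snd i)))"
      by (simp add: mult_ac)
    also have "\<dots> \<le> ennreal (5 ^ DIM('a)) * (\<integral>\<^sup>+ y \<in> ball (fst i) (snd i). f y \<partial>lebesgue)"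
      by (intro mult_left_mono ballI i) auto
    finally show "t * emeasure lebesgue (ball (fst i) (5 * snd i)) \<le> \<dots>" .
  qed
  also have "\<dots> = ennreal (5 ^ DIM('a)) * (\<integral>\<^sup>+ i. (\<integral>\<^sup>+ y \<in> ball (fst i) (snd i). f y \<partial>lebesgue) \<partial>count_space C)"
    by (simp add: nn_integral_cmult)
  also have "(\<integral>\<^sup>+ i. (\<integral>\<^sup>+ y \<in> ball (fst i) (snd i). f y \<partial>lebesgue) \<partial>count_space C)
      = (\<integral>\<^sup>+ i. emeasure (density lebesgue f) (ball (fst i) (snd i)) \<partial>count_space C)"
    by (intro nn_integral_cong) (simp add: emeasure_density)
  also have "\<dots> = emeasure (density lebesgue f) (\<Union>i\<in>C. ball (fst i) (snd i))"
    using C(1) disj by (intro emeasure_UN_countable [symmetric]) auto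
  also have "\<dots> \<le> emeasure (density lebesgue f) (space (density lebesgue f))"
    by (intro emeasure_space)
  also have "\<dots> = (\<integral>\<^sup>+ x. f x \<partial>lebesgue)" by (simp add: emeasure_density)
  finally show ?thesis unfolding U_def by (simp add: mult_left_mono)
qed

theorem maximal_weak_type:
  fixes f :: "'a::euclidean_space \<Rightarrow> ennreal"
  assumes [measurable]: "f \<in> borel_measurable lebesgue"
  shows "t * emeasure lebesgue {x. t < maximal f x}
           \<le> ennreal (1 + 5 ^ DIM('a)) * (\<integral>\<^sup>+ x. f x \<partial>lebesgue)"
proof (cases "t = 0 \<or> t = top")
  case True
  then show ?thesis by auto
next
  case False
  then have t: "0 < t" "t < top" by (auto simp: less_top zero_less_iff_neq_zero)
  let ?U = "\<Union> {ball c r | c r. t < set_mean (ball c r) f}"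
  have op: "open ?U" by auto
  have m: "{x. t < f x} \<in> sets lebesgue"
    using measurable_sets_Collect[of "\<lambda>x. t < f x" lebesgue] by simp
  have "t * emeasure lebesgue {x. t < maximal f x}
          \<le> t * (emeasure lebesgue {x. t < f x} + emeasure lebesgue ?U)"
    unfolding maximal_superlevel
    by (intro mult_left_mono emeasure_subadditive m) (use op in auto)
  also have "\<dots> = (\<integral>\<^sup>+ x. t * indicator {x. t < f x} x \<partial>lebesgue) + t * emeasure lebesgue ?U"
    using m by (simp add: distrib_left nn_integral_cmult_indicator)
  also have "\<dots> \<le> (\<integral>\<^sup>+ x. f x \<partial>lebesgue) + ennreal (5 ^ DIM('a)) * (\<integral>\<^sup>+ x. f x \<partial>lebesgue)"
    by (intro add_mono weak_type_balls assms t nn_integral_mono) (auto split: split_indicator)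
  also have "\<dots> = ennreal (1 + 5 ^ DIM('a)) * (\<integral>\<^sup>+ x. f x \<partial>lebesgue)"
    by (simp add: distrib_right ennreal_plus)
  finally show ?thesis .
qed

section \<open>The strong type inequality\<close>

lemma sigma_finite_lebesgue: "sigma_finite_measure (lebesgue :: 'a::euclidean_space measure)"
proof
  let ?A = "range (\<lambda>n::nat. ball (0::'a) (real n))"
  have "\<exists>n. x \<in> ball (0::'a) (real n)" for x
    using reals_Archimedean2[of "norm x"] by auto
  then have "\<Union> ?A = UNIV" by auto
  moreover have "\<forall>a\<in>?A. emeasure lebesgue a \<noteq> \<infinity>"
    using emeasure_lebesgue_ball_finite by (auto simp: less_top [symmetric] simp del: emeasure_completion)
  ultimately show "\<exists>A. countable A \<and> A \<subseteq> sets (lebesgue :: 'a measure) \<and> \<Union> A = space lebesgue \<and>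
      (\<forall>a\<in>A. emeasure lebesgue a \<noteq> \<infinity>)"
    by (intro exI[of _ ?A]) auto
qed

lemma power_layer:
  assumes b: "0 < b"
  shows "(\<integral>\<^sup>+ t. ennreal (b * t powr (b - 1)) * indicator {t. 0 < t \<and> ennreal t < a} t \<partial>lborel)
           = ennpow a b"
proof -
  have fin: "(\<integral>\<^sup>+ t. ennreal (b * t powr (b - 1)) * indicator {0<..<c} t \<partial>lborel) = ennreal (c powr b)"
    if "0 \<le> c" for c
  proof -
    have "((\<lambda>t. t powr (b - 1)) has_integral c powr b / b) {0..c}"
      using has_integral_powr_from_0[of "b - 1" c] that b by simp
    from has_integral_mult_right[OF this, of b]
    have "((\<lambda>t. b * t powr (b - 1)) has_integral c powr b) {0..c}" using b by simp
    then have "((\<lambda>t. b * t powr (b - 1)) has_integral c powr b) {0<..<c}"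
      by (simp add: has_integral_Icc_iff_Ioo)
    then have "((\<lambda>t. if t \<in> {0<..<c} then b * t powr (b - 1) else 0) has_integral c powr b) UNIV"
      by (simp only: has_integral_restrict_UNIV)
    also have "(\<lambda>t. if t \<in> {0<..<c} then b * t powr (b - 1) else 0)
        = (\<lambda>t. b * t powr (b - 1) * indicator {0<..<c} t)"
      by (auto simp: indicator_def)
    finally have "(\<integral>\<^sup>+ t. ennreal (b * t powr (b - 1) * indicator {0<..<c} t) \<partial>lborel) = ennreal (c powr b)"
      using b by (intro nn_integral_has_integral_lborel) auto
    also have "(\<lambda>t. ennreal (b * t powr (b - 1) * indicator {0<..<c} t)) =
        (\<lambda>t. ennreal (b * t powr (b - 1)) * indicator {0<..<c} t)"
      by (auto simp: indicator_def)
    finally show ?thesis .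
  qed
  show ?thesis
  proof (cases a)
    case (real c)
    have "{t. 0 < t \<and> ennreal t < a} = {0<..<c}"
      using real by (auto simp: ennreal_less_iff)
    then show ?thesis using fin[of c] real by simp
  next
    case top
    let ?X = "\<integral>\<^sup>+ t. ennreal (b * t powr (b - 1)) * indicator {t. 0 < t \<and> ennreal t < a} t \<partial>lborel"
    have le: "ennreal (c powr b) \<le> ?X" if "0 \<le> c" for c
      unfolding fin[OF that, symmetric] using top
      by (intro nn_integral_mono) (auto split: split_indicator)
    have "?X = top"
    proof (rule ccontr)
      assume "?X \<noteq> top"
      then obtain y where y: "?X = ennreal y" "0 \<le> y" by (cases ?X) auto
      have "ennreal (y + 1) \<le> ?X"
        using le[of "(y + 1) powr (1 / b)"] b y(2) by (simp add: powr_powr)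
      with y show False by (simp add: ennreal_le_iff)
    qed
    with top show ?thesis by simp
  qed
qed

text \<open>The part of \<open>f\<close> below \<open>u\<close> contributes at most \<open>u\<close> to the maximal function.\<close>

lemma maximal_weak_type_truncated:
  fixes f :: "'a::euclidean_space \<Rightarrow> ennreal"
  assumes [measurable]: "f \<in> borel_measurable lebesgue"
  shows "u * emeasure lebesgue {x. 2 * u < maximal f x}
           \<le> ennreal (1 + 5 ^ DIM('a)) * (\<integral>\<^sup>+ x. f x * indicator {x. u < f x} x \<partial>lebesgue)"
proof -
  have [measurable]: "{x. u < f x} \<in> sets lebesgue"
    using measurable_sets_Collect[of "\<lambda>x. u < f x" lebesgue] by simp
  let ?g = "\<lambda>x. f x * indicator {x. u < f x} x"
  have [measurable]: "?g \<in> borel_measurable lebesgue" by measurable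
  have fg: "f x \<le> ?g x + u" for x
    by (auto split: split_indicator simp: not_less)
  have M: "maximal f x \<le> maximal ?g x + u" for x
  proof (rule maximal_least)
    show "f x \<le> maximal ?g x + u"
      using fg[of x] le_maximal[of ?g x] by (meson add_right_mono order_trans)
    fix c r assume x: "x \<in> ball c r"
    then have r: "0 < r" using zero_le_dist[of c x] by (simp del: zero_le_dist)
    have "set_mean (ball c r) f \<le> set_mean (ball c r) (\<lambda>x. ?g x + u)"
      by (intro set_mean_mono fg)
    also have "\<dots> = set_mean (ball c r) ?g + u"
      using r by (simp add: set_mean_add set_mean_const emeasure_lebesgue_ball_pos emeasure_lebesgue_ball_finite
          del: emeasure_completion)
    also have "\<dots> \<le> maximal ?g x + u" by (intro add_right_mono set_mean_le_maximal x)
    finally show "set_mean (ball c r) f \<le> maximal ?g x + u" .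
  qed
  have sub: "{x. 2 * u < maximal f x} \<subseteq> {x. u < maximal ?g x}"
  proof safe
    fix x assume "2 * u < maximal f x"
    then have "u + u < maximal ?g x + u" using M[of x] unfolding mult_2 by (rule less_le_trans)
    then show "u < maximal ?g x" by (meson add_right_mono not_le)
  qed
  have "u * emeasure lebesgue {x. 2 * u < maximal f x} \<le> u * emeasure lebesgue {x. u < maximal ?g x}"
    using sub measurable_sets_Collect[of "\<lambda>x. u < maximal ?g x" lebesgue]
    by (intro mult_left_mono emeasure_mono) auto
  also have "\<dots> \<le> ennreal (1 + 5 ^ DIM('a)) * (\<integral>\<^sup>+ x. ?g x \<partial>lebesgue)"
    by (rule maximal_weak_type) measurable
  finally show ?thesis .
qed

text \<open>Tonelli's theorem for the region under the graph of \<open>g\<close>. The factor \<open>h\<close> allows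
  both sides of the strong type inequality to be rewritten in this form.\<close>

lemma nn_integral_power_layer:
  fixes h g :: "'a::euclidean_space \<Rightarrow> ennreal"
  assumes hg: "h \<in> borel_measurable lebesgue" "g \<in> borel_measurable lebesgue" and b: "0 < b"
  shows "(\<integral>\<^sup>+ x. h x * ennpow (g x) b \<partial>lebesgue) =
      (\<integral>\<^sup>+ t. ennreal (b * t powr (b - 1)) *
         (\<integral>\<^sup>+ x. h x * indicator {x. 0 < t \<and> ennreal t < g x} x \<partial>lebesgue) \<partial>lborel)"
proof -
  note [measurable] = hg
  interpret lebesgue: sigma_finite_measure "lebesgue :: 'a measure" by (rule sigma_finite_lebesgue)
  interpret pair: pair_sigma_finite "lborel :: real measure" "lebesgue :: 'a measure" ..
  let ?w = "\<lambda>b t. ennreal (b * t powr (b - 1))"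
  let ?k = "\<lambda>t x. h x * (?w b t * indicator {t. 0 < t \<and> ennreal t < g x} t)"
  let ?P = "(lborel :: real measure) \<Otimes>\<^sub>M (lebesgue :: 'a measure)"
  have gs [measurable]: "(\<lambda>z. g (snd z)) \<in> borel_measurable ?P" "(\<lambda>z. h (snd z)) \<in> borel_measurable ?P"
    by (rule measurable_compose [OF measurable_snd], rule hg)+
  have fs [measurable]: "fst \<in> borel_measurable ?P"
    using measurable_fst[of "lborel :: real measure" "lebesgue :: 'a measure"] by simp
  have S: "{z \<in> space ?P. 0 < fst z \<and> ennreal (fst z) < g (snd z)} \<in> sets ?P"
    by (intro sets.sets_Collect_conj borel_measurable_less gs fs borel_measurable_const
          measurable_compose [OF fs measurable_ennreal])
  have w: "(\<lambda>z. ?w b (fst z)) \<in> borel_measurable ?P"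
    by (rule measurable_compose [OF fs]) measurable
  have "(\<lambda>z. h (snd z) * (?w b (fst z) * indicator {z \<in> space (lborel \<Otimes>\<^sub>M lebesgue). 0 < fst z \<and> ennreal (fst z) < g (snd z)} z))
      \<in> borel_measurable ((lborel :: real measure) \<Otimes>\<^sub>M (lebesgue :: 'a measure))"
    by (intro borel_measurable_times_ennreal gs w borel_measurable_indicator S)
  also have "(\<lambda>z. h (snd z) * (?w b (fst z) * indicator {z \<in> space (lborel \<Otimes>\<^sub>M lebesgue). 0 < fst z \<and> ennreal (fst z) < g (snd z)} z))
      = (\<lambda>(t, x). ?k t x)"
    by (auto simp: fun_eq_iff indicator_def space_pair_measure)
  finally have km: "(\<lambda>(t, x). ?k t x) \<in> borel_measurable ((lborel :: real measure) \<Otimes>\<^sub>M (lebesgue :: 'a measure))" .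
  have e1: "(\<integral>\<^sup>+ x. h x * ennpow (g x) b \<partial>lebesgue) = (\<integral>\<^sup>+ x. \<integral>\<^sup>+ t. ?k t x \<partial>lborel \<partial>lebesgue)"
    unfolding power_layer[OF b, symmetric]
  proof (rule nn_integral_cong)
    fix x
    have "{t. 0 < t \<and> ennreal t < g x} \<in> sets lborel"
      using measurable_sets_Collect[of "\<lambda>t. 0 < t \<and> ennreal t < g x" "lborel :: real measure"] by simp
    then have "(\<lambda>t. ?w b t * indicator {t. 0 < t \<and> ennreal t < g x} t) \<in> borel_measurable lborel"
      by measurable
    from nn_integral_cmult[OF this, of "h x"]
    show "h x * (\<integral>\<^sup>+ t. ?w b t * indicator {t. 0 < t \<and> ennreal t < g x} t \<partial>lborel)
        = (\<integral>\<^sup>+ t. ?k t x \<partial>lborel)" by (rule sym)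
  qed
  have e2: "(\<integral>\<^sup>+ x. \<integral>\<^sup>+ t. ?k t x \<partial>lborel \<partial>lebesgue) = (\<integral>\<^sup>+ t. \<integral>\<^sup>+ x. ?k t x \<partial>lebesgue \<partial>lborel)"
    by (rule pair.Fubini' [OF km])
  have e3: "(\<integral>\<^sup>+ t. \<integral>\<^sup>+ x. ?k t x \<partial>lebesgue \<partial>lborel) = (\<integral>\<^sup>+ t. ?w b t * (\<integral>\<^sup>+ x. h x * indicator {x. 0 < t \<and> ennreal t < g x} x \<partial>lebesgue) \<partial>lborel)"
  proof (rule nn_integral_cong)
    fix t :: real
    let ?A = "{x. 0 < t \<and> ennreal t < g x}"
    have "{x \<in> space lebesgue. 0 < t \<and> ennreal t < g x} \<in> sets lebesgue"
      by (intro sets.sets_Collect_conj sets.sets_Collect_const borel_measurable_less hg borel_measurable_const)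
    then have A: "?A \<in> sets lebesgue" by (simp only: space_completion space_lborel space_borel UNIV_I simp_thms)
    have "(\<lambda>x. h x * indicator ?A x) \<in> borel_measurable lebesgue"
      by (intro borel_measurable_times_ennreal hg borel_measurable_indicator A)
    from nn_integral_cmult[OF this, of "?w b t"]
    show "(\<integral>\<^sup>+ x. ?k t x \<partial>lebesgue) = ?w b t * (\<integral>\<^sup>+ x. h x * indicator ?A x \<partial>lebesgue)"
      by (simp only: mult.left_commute indicator_def mem_Collect_eq)
  qed
  show ?thesis by (rule trans [OF e1 trans [OF e2 e3]])
qed

text \<open>Integrate the truncated weak type inequality over all levels \<open>t = 2 * u\<close>: the truncation turns
  the factor \<open>t powr (r - 2)\<close>, which is integrable near zero because \<open>r > 1\<close>, into \<open>f powr (r - 1)\<close>.\<close>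

theorem maximal_strong_type:
  fixes f :: "'a::euclidean_space \<Rightarrow> ennreal"
  assumes f: "f \<in> borel_measurable lebesgue" and r: "1 < r"
  shows "(\<integral>\<^sup>+ x. ennpow (maximal f x) r \<partial>lebesgue)
           \<le> ennreal ((1 + 5 ^ DIM('a)) * (2 powr r * r / (r - 1))) * (\<integral>\<^sup>+ x. ennpow (f x) r \<partial>lebesgue)"
proof -
  note [measurable] = f
  let ?K = "1 + 5 ^ DIM('a) :: real"
  let ?w = "\<lambda>b t. ennreal (b * t powr (b - 1))"
  let ?c = "2 * ?K * r / (r - 1)"
  have "(\<integral>\<^sup>+ x. ennpow (maximal f x) r \<partial>lebesgue) = (\<integral>\<^sup>+ x. 1 * ennpow (maximal f x) r \<partial>lebesgue)"
    by simp
  also have "\<dots> = (\<integral>\<^sup>+ t. ?w r t *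
      (\<integral>\<^sup>+ x. 1 * indicator {x. 0 < t \<and> ennreal t < maximal f x} x \<partial>lebesgue) \<partial>lborel)"
    using r by (intro nn_integral_power_layer) auto
  also have "\<dots> \<le> (\<integral>\<^sup>+ t. ?w (r - 1) t *
      (\<integral>\<^sup>+ x. (ennreal ?c * f x) * indicator {x. 0 < t \<and> ennreal t < 2 * f x} x \<partial>lebesgue) \<partial>lborel)"
  proof (rule nn_integral_mono)
    fix t :: real
    show "?w r t * (\<integral>\<^sup>+ x. 1 * indicator {x. 0 < t \<and> ennreal t < maximal f x} x \<partial>lebesgue)
       \<le> ?w (r - 1) t * (\<integral>\<^sup>+ x. (ennreal ?c * f x) * indicator {x. 0 < t \<and> ennreal t < 2 * f x} x \<partial>lebesgue)"
    proof (cases "0 < t")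
      case True
      let ?A = "{x. ennreal t < maximal f x}" and ?B = "{x. ennreal t < 2 * f x}"
      have A: "?A \<in> sets lebesgue" and B: "?B \<in> sets lebesgue"
        using measurable_sets_Collect[of "\<lambda>x. ennreal t < maximal f x" lebesgue]
          measurable_sets_Collect[of "\<lambda>x. ennreal t < 2 * f x" lebesgue] by simp_all
      have t2: "2 * ennreal (t / 2) = ennreal t"
        using True ennreal_mult[of 2 "t / 2"] by simp
      have lt: "ennreal (t / 2) < f x \<longleftrightarrow> ennreal t < 2 * f x" for x
      proof (cases "f x")
        case (real v)
        then have "2 * f x = ennreal (2 * v)" using ennreal_mult[of 2 v] by simp
        with real True show ?thesis by (auto simp: ennreal_less_iff)
      qed (simp add: ennreal_mult_top)
      have w: "?w r t = ennreal (2 * r * t powr (r - 2)) * ennreal (t / 2)"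
      proof -
        have "r * t powr (r - 1) = (2 * r * t powr (r - 2)) * (t / 2)"
          using True powr_add[of t "r - 2" 1] by simp
        then show ?thesis
          using r True by (simp flip: ennreal_mult)
      qed
      have w': "ennreal (2 * r * t powr (r - 2)) * ennreal ?K = ?w (r - 1) t * ennreal ?c"
      proof -
        have "2 * r * t powr (r - 2) * ?K = ((r - 1) * t powr (r - 1 - 1)) * ?c"
          using r by (simp add: field_simps)
        then show ?thesis using r by (simp del: ennreal_plus flip: ennreal_mult)
      qed
      have "?w r t * (\<integral>\<^sup>+ x. 1 * indicator {x. 0 < t \<and> ennreal t < maximal f x} x \<partial>lebesgue)
         = ennreal (2 * r * t powr (r - 2)) * (ennreal (t / 2) * emeasure lebesgue ?A)"
        unfolding w using True A by (simp add: mult.assoc)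
      also have "\<dots> \<le> ennreal (2 * r * t powr (r - 2)) *
          (ennreal ?K * (\<integral>\<^sup>+ x. f x * indicator ?B x \<partial>lebesgue))"
        using maximal_weak_type_truncated[OF f, of "ennreal (t / 2)"]
        unfolding t2 lt by (rule mult_left_mono) simp
      also have "\<dots> = ?w (r - 1) t * (ennreal ?c * (\<integral>\<^sup>+ x. f x * indicator ?B x \<partial>lebesgue))"
        using w' by (simp only: mult.assoc [symmetric])
      also have "ennreal ?c * (\<integral>\<^sup>+ x. f x * indicator ?B x \<partial>lebesgue)
          = (\<integral>\<^sup>+ x. ennreal ?c * (f x * indicator ?B x) \<partial>lebesgue)"
        using B by (intro nn_integral_cmult [symmetric] borel_measurable_times_ennreal borel_measurable_indicator f)
      finally show ?thesis using True by (simp only: mult.assoc simp_thms)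
    qed simp
  qed
  also have "\<dots> = (\<integral>\<^sup>+ x. (ennreal ?c * f x) * ennpow (2 * f x) (r - 1) \<partial>lebesgue)"
    using r by (intro nn_integral_power_layer [symmetric]) auto
  also have "\<dots> = (\<integral>\<^sup>+ x. ennreal (?K * (2 powr r * r / (r - 1))) * ennpow (f x) r \<partial>lebesgue)"
  proof (rule nn_integral_cong)
    fix x
    have "(ennreal ?c * f x) * ennpow (2 * f x) (r - 1)
        = ennreal ?c * ennpow 2 (r - 1) * (ennpow (f x) 1 * ennpow (f x) (r - 1))"
      by (simp add: ennpow_mult mult_ac)
    also have "\<dots> = ennreal ?c * ennreal (2 powr (r - 1)) * ennpow (f x) r"
      unfolding ennpow_add[symmetric] using ennpow_ennreal[of 2] by simp
    also have "ennreal ?c * ennreal (2 powr (r - 1)) = ennreal (?K * (2 powr r * r / (r - 1)))"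
    proof -
      have "?c * 2 powr (r - 1) = ?K * (2 powr r * r / (r - 1))"
        using r by (simp add: powr_diff divide_simps) (simp add: algebra_simps)
      then show ?thesis using r by (simp del: ennreal_plus flip: ennreal_mult)
    qed
    finally show "(ennreal ?c * f x) * ennpow (2 * f x) (r - 1)
        = ennreal (?K * (2 powr r * r / (r - 1))) * ennpow (f x) r" .
  qed
  also have "\<dots> = ennreal (?K * (2 powr r * r / (r - 1))) * (\<integral>\<^sup>+ x. ennpow (f x) r \<partial>lebesgue)"
    by (rule nn_integral_cmult) measurable
  finally show ?thesis .
qed

section \<open>Powers of maximal functions as weights\<close>

text \<open>Split \<open>f\<close> at the ball of triple radius. For balls that are larger than the
  given one, the mean is at most a constant times \<open>maximal f x\<close>; the remaining part of \<open>f\<close> is controlled by the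
  weak type inequality, with total mass at most a multiple of \<open>lam * emeasure lebesgue S\<close>.\<close>

lemma maximal_large_on_half:
  fixes f :: "'a::euclidean_space \<Rightarrow> ennreal"
  assumes f: "f \<in> borel_measurable lebesgue" and S: "S \<in> sets lebesgue" "S \<subseteq> ball c R"
    and D: "1 \<le> D" "emeasure lebesgue (ball c R) \<le> ennreal D * emeasure lebesgue S"
    and x: "x \<in> S" and lam: "0 < lam" "maximal f x \<le> ennreal lam"
  defines "K \<equiv> 2 * (1 + 5 ^ DIM('a)) * 3 ^ DIM('a) * D"
  shows "2 * emeasure lebesgue {y \<in> S. ennreal (K * lam) < maximal f y} \<le> emeasure lebesgue S"
proof -
  note [measurable] = f S(1)
  let ?n = "DIM('a)"
  let ?g = "\<lambda>y. f y * indicator (ball c (3 * R)) y"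
  have R: "0 < R" using x S(2) zero_le_dist[of c x] by (auto simp del: zero_le_dist)
  have [measurable]: "ball c (3 * R) \<in> sets lebesgue" by simp
  have [measurable]: "?g \<in> borel_measurable lebesgue" by measurable
  have cx: "dist c x < R" using x S(2) by auto
  have K3: "3 ^ ?n \<le> K"
  proof -
    have "(3::real) ^ ?n * 1 \<le> 3 ^ ?n * (2 * (1 + 5 ^ ?n) * D)"
      using D(1) by (intro mult_left_mono mult_ge1_I) auto
    then show ?thesis unfolding K_def by (simp add: mult_ac)
  qed
  then have K: "0 < K" by (rule less_le_trans [rotated]) simp
  have dom: "maximal f y \<le> max (maximal ?g y) (ennreal (3 ^ ?n * lam))" if y: "y \<in> S" for y
  proof (rule maximal_least)
    have cy: "dist c y < R" using y S(2) by auto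
    have "f y = ?g y" using cy R by simp
    also have "\<dots> \<le> maximal ?g y" by (rule le_maximal)
    finally show "f y \<le> max (maximal ?g y) (ennreal (3 ^ ?n * lam))" by (simp add: le_max_iff_disj)
    fix d r assume yd: "y \<in> ball d r"
    then have r: "0 < r" using zero_le_dist[of d y] by (simp del: zero_le_dist)
    show "set_mean (ball d r) f \<le> max (maximal ?g y) (ennreal (3 ^ ?n * lam))"
    proof (cases "r \<le> R")
      case True
      have "z \<in> ball c (3 * R)" if "z \<in> ball d r" for z
        using that yd cy True dist_triangle[of c z y] dist_triangle[of y z d]
        by (auto simp: dist_commute)
      then have "set_mean (ball d r) f \<le> set_mean (ball d r) ?g"
        by (intro set_mean_mono) (auto simp: indicator_def)
      also have "\<dots> \<le> maximal ?g y" by (rule set_mean_le_maximal [OF yd])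
      finally show ?thesis by (simp add: le_max_iff_disj)
    next
      case False
      have xd: "x \<in> ball d (3 * r)"
        using yd cy cx False dist_triangle[of d x y] dist_triangle[of y x c]
        by (auto simp: dist_commute)
      have "(\<integral>\<^sup>+ z \<in> ball d r. f z \<partial>lebesgue) \<le> (\<integral>\<^sup>+ z \<in> ball d (3 * r). f z \<partial>lebesgue)"
        using r by (intro nn_set_integral_set_mono) auto
      also have "\<dots> = set_mean (ball d (3 * r)) f * emeasure lebesgue (ball d (3 * r))"
        using r by (intro set_mean_mult [symmetric] emeasure_lebesgue_ball_pos emeasure_lebesgue_ball_finite) auto
      also have "\<dots> \<le> ennreal lam * (ennreal (3 ^ ?n) * emeasure lebesgue (ball d r))"
        using r order_trans[OF set_mean_le_maximal[OF xd] lam(2)] emeasure_lebesgue_ball_scale[of 3 r d d]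
        by (intro mult_mono) (auto simp del: emeasure_completion)
      also have "\<dots> = ennreal (3 ^ ?n * lam) * emeasure lebesgue (ball d r)"
        using lam ennreal_mult[of "3 ^ ?n" lam] by (simp add: mult_ac)
      finally have "set_mean (ball d r) f \<le> ennreal (3 ^ ?n * lam)"
        using r by (subst set_mean_le_iff)
          (auto intro: emeasure_lebesgue_ball_pos emeasure_lebesgue_ball_finite simp del: emeasure_completion)
      then show ?thesis by (simp add: le_max_iff_disj)
    qed
  qed
  have sub: "{y \<in> S. ennreal (K * lam) < maximal f y} \<subseteq> {y. ennreal (K * lam) < maximal ?g y}"
  proof safe
    fix y assume y: "y \<in> S" "ennreal (K * lam) < maximal f y"
    have "ennreal (3 ^ ?n * lam) \<le> ennreal (K * lam)"
      using K3 lam by (intro ennreal_leI mult_right_mono) auto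
    with y(2) dom[OF y(1)] show "ennreal (K * lam) < maximal ?g y"
      by (auto simp: max_def split: if_splits)
  qed
  have xc: "x \<in> ball c (3 * R)" using cx R by simp
  have "ennreal (K * lam) * emeasure lebesgue {y \<in> S. ennreal (K * lam) < maximal f y}
      \<le> ennreal (K * lam) * emeasure lebesgue {y. ennreal (K * lam) < maximal ?g y}"
    using sub measurable_sets_Collect[of "\<lambda>y. ennreal (K * lam) < maximal ?g y" lebesgue]
    by (intro mult_left_mono emeasure_mono) auto
  also have "\<dots> \<le> ennreal (1 + 5 ^ ?n) * (\<integral>\<^sup>+ y. ?g y \<partial>lebesgue)"
    by (rule maximal_weak_type) measurable
  also have "(\<integral>\<^sup>+ y. ?g y \<partial>lebesgue) = set_mean (ball c (3 * R)) f * emeasure lebesgue (ball c (3 * R))"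
    using R by (intro set_mean_mult [symmetric] emeasure_lebesgue_ball_pos emeasure_lebesgue_ball_finite) auto
  also have "\<dots> \<le> ennreal lam * (ennreal (3 ^ ?n) * (ennreal D * emeasure lebesgue S))"
  proof (intro mult_mono)
    show "set_mean (ball c (3 * R)) f \<le> ennreal lam"
      using set_mean_le_maximal[OF xc] lam(2) by (rule order_trans)
    have "emeasure lebesgue (ball c (3 * R)) = ennreal (3 ^ ?n) * emeasure lebesgue (ball c R)"
      using R by (intro emeasure_lebesgue_ball_scale) auto
    also have "\<dots> \<le> ennreal (3 ^ ?n) * (ennreal D * emeasure lebesgue S)"
      by (intro mult_left_mono D(2)) auto
    finally show "emeasure lebesgue (ball c (3 * R)) \<le> ennreal (3 ^ ?n) * (ennreal D * emeasure lebesgue S)" .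
  qed auto
  finally have *: "ennreal (K * lam) * emeasure lebesgue {y \<in> S. ennreal (K * lam) < maximal f y}
      \<le> ennreal (1 + 5 ^ ?n) * (ennreal lam * (ennreal (3 ^ ?n) * (ennreal D * emeasure lebesgue S)))"
    by (simp add: mult_left_mono)
  have "ennreal (1 + 5 ^ ?n) * (ennreal lam * (ennreal (3 ^ ?n) * (ennreal D * emeasure lebesgue S)))
     = ennreal ((1 + 5 ^ ?n) * (lam * (3 ^ ?n * D))) * emeasure lebesgue S"
    using lam D by (simp del: ennreal_plus add: mult.assoc ennreal_mult)
  also have "(1 + 5 ^ ?n) * (lam * (3 ^ ?n * D)) = K * lam * (1 / 2)" by (simp add: K_def)
  also have "ennreal (K * lam * (1 / 2)) = ennreal (K * lam) * ennreal (1 / 2)"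
    using K lam by (intro ennreal_mult) auto
  finally have **: "ennreal (K * lam) * emeasure lebesgue {y \<in> S. ennreal (K * lam) < maximal f y}
     \<le> ennreal (K * lam) * (ennreal (1 / 2) * emeasure lebesgue S)"
    using * by (simp only: mult.assoc)
  have Kl: "0 < K * lam" using K lam by simp
  have "emeasure lebesgue {y \<in> S. ennreal (K * lam) < maximal f y} \<le> ennreal (1 / 2) * emeasure lebesgue S"
    using ** Kl by (subst (asm) ennreal_mult_le_mult_iff) (auto simp: ennreal_eq_0_iff)
  then have "2 * emeasure lebesgue {y \<in> S. ennreal (K * lam) < maximal f y}
     \<le> 2 * (ennreal (1 / 2) * emeasure lebesgue S)" by (rule mult_left_mono) simp
  also have "\<dots> = emeasure lebesgue S"
    using ennreal_mult[of 2 "1/2"] by (simp add: mult.assoc [symmetric])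
  finally show ?thesis .
qed

text \<open>On half of \<open>S\<close> the maximal function is at most a multiple of its value at \<open>x\<close>, so that half alone
  makes the mean of the reciprocal large enough. In the language of weights, the reciprocal of a power
  of a maximal function satisfies a reverse Hoelder inequality with infinite exponent.\<close>

lemma inverse_maximal_power_le_mean:
  fixes f :: "'a::euclidean_space \<Rightarrow> ennreal"
  assumes f: "f \<in> borel_measurable lebesgue" and S: "S \<in> sets lebesgue" "S \<subseteq> ball c R"
    and D: "1 \<le> D" "emeasure lebesgue (ball c R) \<le> ennreal D * emeasure lebesgue S"
    and x: "x \<in> S" and a: "0 < a"
  defines "K \<equiv> 2 * (1 + 5 ^ DIM('a)) * 3 ^ DIM('a) * D"
  shows "inverse (ennpow (maximal f x) a) * emeasure lebesgue S
           \<le> ennreal (2 * K powr a) * (\<integral>\<^sup>+ y \<in> S. inverse (ennpow (maximal f y) a) \<partial>lebesgue)"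
proof -
  note [measurable] = f S(1)
  let ?V = "\<lambda>y. inverse (ennpow (maximal f y) a)"
  let ?X = "ennreal (2 * K powr a) * (\<integral>\<^sup>+ y \<in> S. ?V y \<partial>lebesgue)"
  have R: "0 < R" using x S(2) zero_le_dist[of c x] by (auto simp del: zero_le_dist)
  have K: "0 < K" unfolding K_def using D(1) by (intro mult_pos_pos add_pos_pos) auto
  have Sfin: "emeasure lebesgue S < top"
    using emeasure_mono[OF S(2), of lebesgue] emeasure_lebesgue_ball_finite[of c R]
    by (simp add: le_less_trans del: emeasure_completion)
  have Spos: "0 < emeasure lebesgue S"
  proof (rule ccontr)
    assume "\<not> 0 < emeasure lebesgue S"
    then have "emeasure lebesgue S = 0" by simp
    with D(2) emeasure_lebesgue_ball_pos[OF R, of c] show False by (simp del: emeasure_completion)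
  qed
  have main: "ennreal (lam powr - a) * emeasure lebesgue S \<le> ?X"
    if lam: "0 < lam" "maximal f x \<le> ennreal lam" for lam
  proof -
    let ?B = "{y \<in> S. ennreal (K * lam) < maximal f y}"
    have B [measurable]: "?B \<in> sets lebesgue" by measurable
    have half: "2 * emeasure lebesgue ?B \<le> emeasure lebesgue S"
      unfolding K_def by (rule maximal_large_on_half [OF f S D x lam])
    have split: "emeasure lebesgue S = emeasure lebesgue ?B + emeasure lebesgue (S - ?B)"
    proof -
      have "emeasure lebesgue ?B + emeasure lebesgue (S - ?B) = emeasure lebesgue (?B \<union> (S - ?B))"
        by (intro plus_emeasure sets.Diff B S(1)) blast
      also have "?B \<union> (S - ?B) = S" by blast
      finally show ?thesis by (rule sym)
    qed
    have arith: "u + v \<le> 2 * v" if "2 * u \<le> u + v" "u + v < top" for u v :: ennreal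
    proof -
      have "u \<noteq> top" "u + u \<le> u + v" using that by (auto simp: mult_2)
      then have "u \<le> v" by (simp add: ennreal_add_left_cancel_le)
      then show ?thesis by (simp add: mult_2)
    qed
    have le: "emeasure lebesgue S \<le> 2 * emeasure lebesgue (S - ?B)"
      unfolding split by (rule arith) (use half Sfin in \<open>simp_all only: split [symmetric]\<close>)
    have "ennreal (lam powr - a) * emeasure lebesgue S
       \<le> ennreal (lam powr - a) * (2 * emeasure lebesgue (S - ?B))"
      by (rule mult_left_mono [OF le]) simp
    also have "\<dots> = ennreal (2 * K powr a) * (ennreal ((K * lam) powr - a) * emeasure lebesgue (S - ?B))"
    proof -
      have eq: "2 * K powr a * (K * lam) powr - a = lam powr - a * 2"
        using K lam by (simp add: powr_mult powr_minus)
      have "ennreal (2 * K powr a) * ennreal ((K * lam) powr - a) = ennreal (2 * K powr a * (K * lam) powr - a)"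
        by (rule ennreal_mult [symmetric]) auto
      also have "\<dots> = ennreal (lam powr - a) * 2"
        unfolding eq using ennreal_mult[of "lam powr - a" 2] by simp
      finally have "ennreal (2 * K powr a) * ennreal ((K * lam) powr - a) = ennreal (lam powr - a) * 2" .
      then show ?thesis by (simp only: mult.assoc [symmetric])
    qed
    also have "\<dots> \<le> ?X"
    proof (rule mult_left_mono)
      have "ennreal ((K * lam) powr - a) * emeasure lebesgue (S - ?B)
         = (\<integral>\<^sup>+ y. ennreal ((K * lam) powr - a) * indicator (S - ?B) y \<partial>lebesgue)"
        by (intro nn_integral_cmult_indicator [symmetric]) measurable
      also have "\<dots> \<le> (\<integral>\<^sup>+ y \<in> S. ?V y \<partial>lebesgue)"
      proof (intro nn_integral_mono)
        fix y
        show "ennreal ((K * lam) powr - a) * indicator (S - ?B) y \<le> ?V y * indicator S y"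
        proof (cases "y \<in> S - ?B")
          case True
          then have "maximal f y \<le> ennreal (K * lam)" by (auto simp: not_less)
          then have "ennpow (maximal f y) a \<le> ennreal ((K * lam) powr a)"
            using a K lam ennpow_mono[of "maximal f y" "ennreal (K * lam)" a] by simp
          then have "inverse (ennreal ((K * lam) powr a)) \<le> ?V y" by (rule ennreal_inverse_antimono)
          with True K lam show ?thesis by (simp add: powr_minus inverse_ennreal)
        qed simp
      qed
      finally show "ennreal ((K * lam) powr - a) * emeasure lebesgue (S - ?B) \<le> \<dots>" .
    qed simp
    finally show ?thesis .
  qed
  show ?thesis
  proof (cases "maximal f x")
    case (real m)
    show ?thesis
    proof (cases "m = 0")
      case False
      with real have "inverse (ennpow (maximal f x) a) = ennreal (m powr - a)"
        by (simp add: powr_minus inverse_ennreal)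
      with main[of m] real False show ?thesis by simp
    next
      case True
      obtain s where s: "emeasure lebesgue S = ennreal s" "0 < s"
        using Spos Sfin by (cases "emeasure lebesgue S") auto
      have "?X = top"
      proof (rule ccontr)
        assume "?X \<noteq> top"
        then obtain v where v: "?X = ennreal v" "0 \<le> v" by (cases ?X) auto
        \<comment> \<open>the level at which the left-hand side equals \<open>v + 1\<close>\<close>
        let ?lam = "((v + 1) / s) powr (- 1 / a)"
        have "?lam powr - a = (v + 1) / s" using a s v by (simp add: powr_powr)
        then have "ennreal ((v + 1) / s) * ennreal s \<le> ennreal v"
          using main[of ?lam] True real s v by simp
        then have "ennreal (v + 1) \<le> ennreal v" using s v by (simp flip: ennreal_mult)
        with v show False by (simp add: ennreal_le_iff)
      qed
      then show ?thesis by simp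
    qed
  qed simp
qed

section \<open>Consequences of log-Hoelder continuity\<close>

text \<open>Exponents that differ by \<open>L / ln (exp 1 + u)\<close> may be exchanged for bases in the unit interval: a
  base above \<open>(exp 1 + u) powr - m\<close> changes its power by a bounded factor only, and
  all smaller ones go into the error term.\<close>

lemma powr_exchange_exponent:
  fixes t a b L m u :: real
  assumes t: "0 \<le> t" "t \<le> 1" and ab: "1 \<le> a" "\<bar>a - b\<bar> \<le> L / ln (exp 1 + u)"
    and u: "0 \<le> u" and m: "0 \<le> m"
  shows "t powr a \<le> exp (m * L) * t powr b + (exp 1 + u) powr - m"
proof -
  have e: "1 < exp 1 + u" using u exp_gt_one[of 1] by linarith
  let ?l = "ln (exp 1 + u)"
  have l: "0 < ?l" using e by simp
  show ?thesis
  proof (cases "t \<le> (exp 1 + u) powr - m")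
    case True
    have "t powr a \<le> t powr 1" using t ab by (intro powr_mono') auto
    then show ?thesis using True t by (simp add: add_increasing)
  next
    case False
    then have t0: "0 < t" using powr_gt_zero[of "exp 1 + u" "- m"] e by linarith
    have lnt: "- ln t \<le> m * ?l" "0 \<le> - ln t"
    proof -
      have "ln ((exp 1 + u) powr - m) \<le> ln t" using False e t0 by (intro ln_mono) auto
      then show "- ln t \<le> m * ?l" using e by (simp add: ln_powr)
    qed (use t t0 in simp)
    have "(a - b) * ln t \<le> \<bar>(a - b) * ln t\<bar>" by simp
    also have "\<dots> = \<bar>a - b\<bar> * (- ln t)" using lnt by (simp add: abs_mult)
    also have "\<dots> \<le> (L / ?l) * (m * ?l)"
      using ab(2) lnt by (intro mult_mono) auto
    also have "\<dots> = m * L" using l by simp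
    finally have *: "(a - b) * ln t \<le> m * L" .
    have "t powr a = t powr (a - b) * t powr b" by (simp flip: powr_add)
    also have "\<dots> \<le> exp (m * L) * t powr b"
      using * t0 by (intro mult_right_mono) (auto simp: powr_def)
    finally show ?thesis by (simp add: add_increasing2)
  qed
qed

text \<open>On small balls the local condition bounds the oscillation of the exponent by a multiple of the
  reciprocal of the logarithm of the radius, which is exactly what keeps the power below bounded; on
  large balls the measure is bounded below.\<close>

lemma ball_measure_power_oscillation:
  fixes h :: "'a::euclidean_space \<Rightarrow> real" and B C0 :: real
  assumes h: "\<And>x. 1 \<le> h x" "\<And>x. h x \<le> B"
    and C0: "0 \<le> C0" "\<And>x y. norm (x - y) < 1 / 2 \<Longrightarrow> \<bar>h x - h y\<bar> \<le> C0 / (- ln (norm (x - y)))"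
  defines "w \<equiv> unit_ball_vol DIM('a)"
  defines "Z \<equiv> max 1 (4 ^ DIM('a) / w)"
  assumes x: "x \<in> ball c r"
  shows "max 1 (1 / (w * r ^ DIM('a))) powr (h x - (INF y\<in>ball c r. h y))
           \<le> Z powr B * exp (DIM('a) * C0)"
proof -
  let ?n = "DIM('a)"
  define a where "a = (INF y\<in>ball c r. h y)"
  have r: "0 < r" using x zero_le_dist[of c x] unfolding mem_ball by linarith
  have w: "0 < w" by (simp add: w_def)
  have bdd: "bdd_below (h ` ball c r)" using h(1) by (intro bdd_belowI2[where m=1]) auto
  have ax: "a \<le> h x" unfolding a_def using bdd x by (rule cINF_lower)
  have a1: "1 \<le> a" unfolding a_def using r h(1) by (intro cINF_greatest) auto
  have Z: "1 \<le> Z" by (simp add: Z_def)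
  have B: "0 \<le> B" using h[of x] by linarith
  have ZB: "Z powr (h x - a) \<le> Z powr B" using Z h(2)[of x] a1 by (intro powr_mono) auto
  have E1: "1 \<le> exp (?n * C0)" using C0 by simp
  show ?thesis
  proof (cases "1 / 4 \<le> r")
    case True
    have "1 / (w * r ^ ?n) \<le> 1 / (w * (1 / 4) ^ ?n)"
      using True w r by (intro divide_left_mono mult_left_mono power_mono mult_pos_pos) auto
    also have "\<dots> = 4 ^ ?n / w" by (simp add: power_divide)
    finally have "max 1 (1 / (w * r ^ ?n)) \<le> Z" by (auto simp: Z_def)
    then have "max 1 (1 / (w * r ^ ?n)) powr (h x - a) \<le> Z powr (h x - a)"
      using ax by (intro powr_mono2) auto
    also have "\<dots> \<le> Z powr B * 1" using ZB by simp
    also have "\<dots> \<le> Z powr B * exp (?n * C0)" using E1 by (intro mult_left_mono) auto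
    finally show ?thesis by (simp add: a_def)
  next
    case False
    let ?l = "- ln (2 * r)"
    have l: "0 < ?l" using False r by simp
    have osc: "h x - a \<le> C0 / ?l"
    proof -
      have "h x - C0 / ?l \<le> a" unfolding a_def
      proof (rule cINF_greatest)
        fix y assume y: "y \<in> ball c r"
        have d: "norm (x - y) < 2 * r"
          using x y dist_triangle[of x y c] by (auto simp: dist_norm norm_minus_commute)
        show "h x - C0 / ?l \<le> h y"
        proof (cases "x = y")
          case True
          have "0 \<le> C0 / ?l" using C0(1) l by (intro divide_nonneg_nonneg) auto
          then have "h x - C0 / ?l \<le> h x" by linarith
          with True show ?thesis by blast
        next
          case False
          then have "\<bar>h x - h y\<bar> \<le> C0 / (- ln (norm (x - y)))"
            using d \<open>\<not> 1 / 4 \<le> r\<close> by (intro C0(2)) auto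
          also have "\<dots> \<le> C0 / ?l"
          proof (rule divide_left_mono)
            have pos: "0 < norm (x - y)" using False by simp
            then have "ln (norm (x - y)) \<le> ln (2 * r)" using d by (intro ln_mono) auto
            then show "?l \<le> - ln (norm (x - y))" by simp
            then show "0 < (- ln (norm (x - y))) * ?l" using l by (intro mult_pos_pos) linarith+
          qed (rule C0(1))
          finally show ?thesis by linarith
        qed
      qed (use r in auto)
      then show ?thesis by linarith
    qed
    have W: "1 \<le> 1 / (2 * r)" using False r by simp
    have "1 / (w * r ^ ?n) = (2 ^ ?n / w) * (1 / (2 * r)) ^ ?n"
      using r w by (simp add: power_divide power_mult_distrib)
    also have "\<dots> \<le> Z * (1 / (2 * r)) ^ ?n"
    proof (rule mult_right_mono)
      have "(2::real) ^ ?n / w \<le> 4 ^ ?n / w" using w by (intro divide_right_mono power_mono) auto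
      then show "2 ^ ?n / w \<le> Z" by (simp add: Z_def)
    qed (use r in simp)
    finally have "max 1 (1 / (w * r ^ ?n)) \<le> Z * (1 / (2 * r)) ^ ?n"
      using Z W by (auto intro!: mult_ge1_I one_le_power)
    then have "max 1 (1 / (w * r ^ ?n)) powr (h x - a) \<le> (Z * (1 / (2 * r)) ^ ?n) powr (h x - a)"
      using ax by (intro powr_mono2) auto
    also have "\<dots> = Z powr (h x - a) * ((1 / (2 * r)) ^ ?n) powr (h x - a)"
      by (rule powr_mult)
    also have "\<dots> \<le> Z powr B * exp (?n * C0)"
    proof (rule mult_mono [OF ZB])
      have "ln ((1 / (2 * r)) ^ ?n) = ?n * ?l"
        using r by (simp add: ln_realpow ln_div)
      then have "((1 / (2 * r)) ^ ?n) powr (h x - a) = exp ((h x - a) * (?n * ?l))"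
        using r by (simp add: powr_def)
      also have "(h x - a) * (?n * ?l) \<le> C0 / ?l * (?n * ?l)"
        using osc by (rule mult_right_mono) (intro mult_nonneg_nonneg of_nat_0_le_iff less_imp_le [OF l])
      also have "C0 / ?l * (?n * ?l) = ?n * C0" using l by (simp add: field_simps)
      finally show "((1 / (2 * r)) ^ ?n) powr (h x - a) \<le> exp (?n * C0)" by simp
    qed auto
    finally show ?thesis by (simp add: a_def)
  qed
qed

text \<open>The power is chosen so that \<open>decay\<close> is integrable: the measure of the ball of radius \<open>k\<close> grows like
  \<open>k ^ DIM('a)\<close>, which leaves the summable terms \<open>1 / k\<^sup>2\<close>.\<close>

definition decay :: "'a::euclidean_space \<Rightarrow> real" where
  "decay x = (exp 1 + norm x) powr - (real DIM('a) + 2)"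

lemma decay_pos: "0 < decay x"
  using exp_gt_zero[of "1::real"] norm_ge_zero[of x] unfolding decay_def by (simp add: add_nonneg_eq_0_iff)

lemma decay_le_1: "decay x \<le> 1"
proof -
  have "1 \<le> exp 1 + norm x" using exp_gt_one[of "1::real"] norm_ge_zero[of x] by linarith
  then have "decay x \<le> (exp 1 + norm x) powr 0" unfolding decay_def by (intro powr_mono) auto
  with \<open>1 \<le> _\<close> show ?thesis by (simp split: if_splits)
qed

lemma borel_measurable_decay [measurable]: "decay \<in> borel_measurable (lebesgue :: 'a::euclidean_space measure)"
proof -
  have "decay \<in> borel_measurable (borel :: 'a measure)" unfolding decay_def by measurable
  then show ?thesis by (simp add: measurable_completion)
qed

lemma nn_integral_decay_finite: "(\<integral>\<^sup>+ x. ennreal (decay (x :: 'a::euclidean_space)) \<partial>lebesgue) < top"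
proof -
  let ?n = "DIM('a)" and ?w = "unit_ball_vol DIM('a)"
  let ?q = "\<lambda>k::nat. (real k + 1) powr - (real ?n + 2)"
  have "(\<integral>\<^sup>+ x. ennreal (decay (x :: 'a)) \<partial>lebesgue)
      \<le> (\<integral>\<^sup>+ x. (\<Sum>k. ennreal (?q k) * indicator (ball (0::'a) (real k + 1)) x) \<partial>lebesgue)"
  proof (rule nn_integral_mono)
    fix x :: 'a
    define k where "k = nat \<lfloor>norm x\<rfloor>"
    have k: "real k \<le> norm x" "norm x < real k + 1" unfolding k_def by (simp_all add: floor_correct)
    have e1: "1 \<le> exp (1::real)" by simp
    have "decay x \<le> ?q k"
      unfolding decay_def using k e1 by (intro powr_mono2') linarith+
    then have "ennreal (decay x) \<le> ennreal (?q k) * indicator (ball (0::'a) (real k + 1)) x"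
      using k by (simp add: ennreal_leI)
    also have "\<dots> = sum (\<lambda>j. ennreal (?q j) * indicator (ball (0::'a) (real j + 1)) x) {k}"
      by (simp only: sum.insert finite.emptyI empty_iff not_False_eq_True sum.empty add_0_right)
    also have "\<dots> \<le> (\<Sum>j. ennreal (?q j) * indicator (ball (0::'a) (real j + 1)) x)"
      by (rule sum_le_suminf) auto
    finally show "ennreal (decay x) \<le> \<dots>" .
  qed
  also have "\<dots> = (\<Sum>k. \<integral>\<^sup>+ x. ennreal (?q k) * indicator (ball (0::'a) (real k + 1)) x \<partial>lebesgue)"
    by (rule nn_integral_suminf) (intro borel_measurable_times_ennreal borel_measurable_indicator, auto)
  also have "\<dots> = (\<Sum>k. ennreal (?w * inverse (real (Suc k) ^ 2)))"
  proof (rule suminf_cong)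
    fix k
    have powr: "?q k * (real k + 1) ^ ?n = inverse (real (Suc k) ^ 2)"
    proof -
      have "?q k * (real k + 1) ^ ?n = (real k + 1) powr (- (real ?n + 2)) * (real k + 1) powr real ?n"
        by (subst powr_realpow) auto
      also have "\<dots> = (real k + 1) powr (- 2)" by (subst powr_add [symmetric]) simp
      also have "\<dots> = inverse (real (Suc k) ^ 2)"
        using powr_realpow[of "real k + 1" 2] by (simp add: powr_minus add.commute)
      finally show ?thesis .
    qed
    have "(\<integral>\<^sup>+ x. ennreal (?q k) * indicator (ball (0::'a) (real k + 1)) x \<partial>lebesgue)
        = ennreal (?q k) * emeasure lebesgue (ball (0::'a) (real k + 1))"
      by (rule nn_integral_cmult_indicator) simp
    also have "\<dots> = ennreal (?q k) * ennreal (?w * (real k + 1) ^ ?n)"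
      by (subst emeasure_lebesgue_ball) auto
    also have "\<dots> = ennreal (?q k * (?w * (real k + 1) ^ ?n))"
      by (rule ennreal_mult [symmetric]) auto
    also have "?q k * (?w * (real k + 1) ^ ?n) = ?w * inverse (real (Suc k) ^ 2)"
      unfolding powr [symmetric] by (simp only: mult.left_commute)
    finally show "(\<integral>\<^sup>+ x. ennreal (?q k) * indicator (ball (0::'a) (real k + 1)) x \<partial>lebesgue)
        = ennreal (?w * inverse (real (Suc k) ^ 2))" .
  qed
  also have "\<dots> < top"
  proof -
    have "summable (\<lambda>k. ?w * inverse (real (Suc k) ^ 2))"
      using inverse_power_summable[of 2, where 'a=real]
      by (intro summable_mult) (subst summable_Suc_iff [where f="\<lambda>k. inverse (real k ^ 2)"], simp)
    from ennreal_suminf_neq_top[OF this] show ?thesis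
      by (metis less_top mult_nonneg_nonneg inverse_nonnegative_iff_nonnegative unit_ball_vol_nonneg
          of_nat_0_le_iff zero_le_power)
  qed
  finally show ?thesis .
qed

section \<open>The maximal operator with a variable exponent\<close>

text \<open>Values of \<open>f\<close> below half its mean contribute at most half of the mean, and larger ones are at most a
  multiple of their power; this is Jensen's inequality up to a constant.\<close>

lemma set_mean_power_le:
  fixes f :: "'a::euclidean_space \<Rightarrow> ennreal"
  assumes f: "f \<in> borel_measurable lebesgue"
    and S: "S \<in> sets lebesgue" "0 < emeasure lebesgue S" "emeasure lebesgue S < top" and a: "1 \<le> a"
  shows "ennpow (set_mean S f) a \<le> ennreal (2 powr a) * set_mean S (\<lambda>y. ennpow (f y) a)"
proof -
  note [measurable] = f S(1)
  let ?A = "set_mean S f" and ?M = "set_mean S (\<lambda>y. ennpow (f y) a)"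
  have split: "?A \<le> ennreal T + ennreal (T powr (1 - a)) * ?M" if T: "0 < T" for T
  proof -
    have pt: "u \<le> ennreal T + ennreal (T powr (1 - a)) * ennpow u a" for u
    proof (cases u)
      case (real v)
      show ?thesis
      proof (cases "v \<le> T")
        case True
        with real show ?thesis by (simp add: add_increasing2)
      next
        case False
        have "T powr (1 - a) * v powr a \<ge> v powr (1 - a) * v powr a"
          using False T a by (intro mult_right_mono powr_mono2') auto
        also have "v powr (1 - a) * v powr a = v" using False T by (simp flip: powr_add)
        finally show ?thesis using real by (auto intro!: add_increasing ennreal_leI simp flip: ennreal_mult)
      qed
    qed (use T in \<open>simp add: ennreal_mult_top\<close>)
    have "?A \<le> set_mean S (\<lambda>y. ennreal T + ennreal (T powr (1 - a)) * ennpow (f y) a)"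
      by (rule set_mean_mono) (rule pt)
    also have "\<dots> = ennreal T + ennreal (T powr (1 - a)) * ?M"
      using S by (simp add: set_mean_add set_mean_const set_mean_cmult)
    finally show ?thesis .
  qed
  show ?thesis
  proof (cases ?A)
    case (real A)
    show ?thesis
    proof (cases "A = 0 \<or> ?M = top")
      case True
      with real show ?thesis by (auto simp: ennreal_mult_top)
    next
      case False
      then obtain M where M: "?M = ennreal M" "0 \<le> M" by (cases ?M) auto
      have A: "0 < A" using False real by auto
      have "A \<le> A / 2 + (A / 2) powr (1 - a) * M"
        using split[of "A / 2"] A M unfolding real M(1)
        by (simp add: ennreal_le_iff flip: ennreal_mult ennreal_plus)
      then have *: "(A / 2) powr 1 \<le> (A / 2) powr (1 - a) * M" using A by simp
      have "(A / 2) powr a = (A / 2) powr (a - 1) * (A / 2) powr 1"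
        by (simp only: powr_add [symmetric]) simp
      also have "\<dots> \<le> (A / 2) powr (a - 1) * ((A / 2) powr (1 - a) * M)"
        using * by (rule mult_left_mono) simp
      also have "\<dots> = ((A / 2) powr (a - 1) * (A / 2) powr (1 - a)) * M" by simp
      also have "\<dots> = M" using A by (simp flip: powr_add)
      finally have "(A / 2) powr a \<le> M" .
      then have "A powr a \<le> 2 powr a * M" using A by (simp add: powr_divide field_simps)
      with real M show ?thesis by (simp add: ennreal_leI flip: ennreal_mult)
    qed
  next
    case top
    with split[of 1] have "?M = top" by (simp add: top_unique)
    then show ?thesis by (simp add: ennreal_mult_top)
  qed
qed

text \<open>The variable exponent form of Jensen's inequality on a ball, with an error term. The part of \<open>f\<close>
  above 1 needs the local condition: there the exponent may be replaced by its infimum on the ball, and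
  the mean of the power is at most the reciprocal of the measure of the ball. The part below 1
  needs the decay condition: the exponent is exchanged for the constant \<open>b\<close> and back, at the price of
  the two decay terms.\<close>

lemma set_mean_variable_power_le:
  fixes h :: "'a::euclidean_space \<Rightarrow> real" and B C0 L b :: real
  assumes hm: "h \<in> borel_measurable lebesgue" and h: "\<And>x. 1 \<le> h x" "\<And>x. h x \<le> B"
    and C0: "0 \<le> C0" "\<And>x y. norm (x - y) < 1 / 2 \<Longrightarrow> \<bar>h x - h y\<bar> \<le> C0 / (- ln (norm (x - y)))"
    and b: "1 \<le> b" "\<And>x. \<bar>h x - b\<bar> \<le> L / ln (exp 1 + norm x)"
  obtains C where "0 < C"
    "\<And>f c r x. f \<in> borel_measurable lebesgue \<Longrightarrow> (\<integral>\<^sup>+ y. ennpow (f y) (h y) * indicator {y. 1 < f y} y \<partial>lebesgue) \<le> 1 \<Longrightarrow>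
       x \<in> ball c r \<Longrightarrow> ennpow (set_mean (ball c r) f) (h x) \<le>
         ennreal C * (maximal (\<lambda>y. ennpow (f y) (h y)) x + maximal (\<lambda>y. ennreal (decay y)) x)"
proof -
  note [measurable] = hm
  define w where "w = unit_ball_vol DIM('a)"
  define Cl where "Cl = max 1 (4 ^ DIM('a) / w) powr B * exp (DIM('a) * C0)"
  define E where "E = exp ((real DIM('a) + 2) * L)"
  \<comment> \<open>\<open>2 powr B\<close> separates large and small values, which contribute the next two terms; the last one is the decay at \<open>x\<close>.\<close>
  define C where "C = 2 powr B * (2 powr (B * B) * Cl + E * 2 powr b * (E + 1) + 1)"
  have w: "0 < w" by (simp add: w_def)
  have B: "1 \<le> B" using h(1)[of undefined] h(2)[of undefined] by linarith
  have Cl: "1 \<le> Cl"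
    unfolding Cl_def using B C0 by (intro mult_ge1_I ge_one_powr_ge_zero) auto
  have E: "0 < E" by (simp add: E_def)
  have C: "0 < C" unfolding C_def using Cl E by (intro mult_pos_pos add_nonneg_pos mult_nonneg_nonneg) auto
  show thesis
  proof (rule that [OF C])
    fix f :: "'a \<Rightarrow> ennreal" and c x :: 'a and r :: real
    assume f [measurable]: "f \<in> borel_measurable lebesgue"
      and f1le: "(\<integral>\<^sup>+ y. ennpow (f y) (h y) * indicator {y. 1 < f y} y \<partial>lebesgue) \<le> 1"
      and x: "x \<in> ball c r"
    have r: "0 < r" using x zero_le_dist[of c x] unfolding mem_ball by linarith
    let ?b = "ball c r"
    have ball: "?b \<in> sets lebesgue" "0 < emeasure lebesgue ?b" "emeasure lebesgue ?b < top"
      using emeasure_lebesgue_ball_pos[OF r, of c] emeasure_lebesgue_ball_finite[of c r]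
      by (simp_all del: emeasure_completion)
    let ?Mf = "maximal (\<lambda>y. ennpow (f y) (h y)) x" and ?MN = "maximal (\<lambda>y. ennreal (decay y)) x"
    define f1 where "f1 = (\<lambda>y. if 1 < f y then f y else 0)"
    define f2 where "f2 = (\<lambda>y. if 1 < f y then 0 else f y)"
    have m1 [measurable]: "f1 \<in> borel_measurable lebesgue" unfolding f1_def by measurable
    have m2 [measurable]: "f2 \<in> borel_measurable lebesgue" unfolding f2_def by measurable
    have f12: "f y = f1 y + f2 y" for y by (simp add: f1_def f2_def)
    have f2le: "f2 y \<le> 1" for y by (simp add: f2_def not_less)
    define A1 where "A1 = set_mean ?b f1"
    define A2 where "A2 = set_mean ?b f2"
    have A: "set_mean ?b f = A1 + A2"
      unfolding A1_def A2_def f12 by (rule set_mean_add [OF m1 m2 ball(1)])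
    have mean_le: "set_mean ?b g \<le> maximal g x" for g by (rule set_mean_le_maximal [OF x])
    define a where "a = (INF y\<in>?b. h y)"
    have bdd: "bdd_below (h ` ?b)" using h(1) by (intro bdd_belowI2[where m=1]) auto
    have al: "a \<le> h y" if "y \<in> ?b" for y unfolding a_def using bdd that by (rule cINF_lower)
    have a1: "1 \<le> a" unfolding a_def using r h(1) by (intro cINF_greatest) auto
    define D where "D = set_mean ?b (\<lambda>y. ennpow (f1 y) (h y))"
    have D_le: "D \<le> ?Mf"
      unfolding D_def by (rule order_trans [OF set_mean_mono mean_le]) (use h(1) in \<open>auto simp: f1_def\<close>)
    have D_bd: "D \<le> ennreal (1 / (w * r ^ DIM('a)))"
    proof -
      have "(\<integral>\<^sup>+ y \<in> ?b. ennpow (f1 y) (h y) \<partial>lebesgue)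
          \<le> (\<integral>\<^sup>+ y. ennpow (f y) (h y) * indicator {y. 1 < f y} y \<partial>lebesgue)"
        by (intro nn_integral_mono) (auto simp: f1_def split: split_indicator)
      also have "\<dots> \<le> ennreal (1 / (w * r ^ DIM('a))) * emeasure lebesgue ?b"
      proof -
        have "ennreal (1 / (w * r ^ DIM('a))) * emeasure lebesgue ?b
            = ennreal (1 / (w * r ^ DIM('a))) * ennreal (w * r ^ DIM('a))"
          using r unfolding w_def by (subst emeasure_lebesgue_ball) auto
        also have "\<dots> = ennreal (1 / (w * r ^ DIM('a)) * (w * r ^ DIM('a)))"
          using r w by (intro ennreal_mult [symmetric]) auto
        also have "\<dots> = 1" using r w by simp
        finally show ?thesis using f1le by simp
      qed
      finally show ?thesis unfolding D_def set_mean_le_iff[OF ball(2,3)] .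
    qed
    have D_pow: "ennpow D (h x / a) \<le> ennreal Cl * D"
    proof (cases "D \<le> 1")
      case True
      have "ennpow D (h x / a) \<le> ennpow D 1"
        using True al[OF x] a1 by (intro ennpow_exponent_mono_le1) auto
      also have "\<dots> \<le> ennreal Cl * D" using Cl mult_right_mono[of 1 "ennreal Cl" D] by simp
      finally show ?thesis .
    next
      case False
      obtain d where d: "D = ennreal d" "1 < d"
        using D_bd False by (cases D) (auto simp: top_unique simp flip: ennreal_1)
      have db: "d \<le> 1 / (w * r ^ DIM('a))" using D_bd d r w by (simp add: ennreal_le_iff)
      have "d powr (h x / a) = d powr 1 * d powr ((h x - a) / a)"
        using a1 by (simp only: powr_add [symmetric]) (simp add: field_simps)
      also have "d powr ((h x - a) / a) \<le> d powr (h x - a)"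
        using d a1 al[OF x] by (intro powr_mono) (auto simp: divide_le_eq mult_le_cancel_left1)
      also have "\<dots> \<le> max 1 (1 / (w * r ^ DIM('a))) powr (h x - a)"
        using d db al[OF x] by (intro powr_mono2) auto
      also have "\<dots> \<le> Cl" unfolding Cl_def w_def a_def
        by (rule ball_measure_power_oscillation [OF h C0 x])
      finally have "d powr (h x / a) \<le> Cl * d" using d by (simp add: mult_ac)
      then show ?thesis using d Cl by (simp add: ennreal_leI flip: ennreal_mult)
    qed
    have A1: "ennpow A1 (h x) \<le> ennreal (2 powr (B * B) * Cl) * ?Mf"
    proof -
      have "ennpow A1 a \<le> ennreal (2 powr a) * set_mean ?b (\<lambda>y. ennpow (f1 y) a)"
        unfolding A1_def by (rule set_mean_power_le [OF m1 ball a1])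
      also have "\<dots> \<le> ennreal (2 powr a) * D"
        unfolding D_def
      proof (intro mult_left_mono set_mean_mono)
        fix y assume "y \<in> ?b"
        then show "ennpow (f1 y) a \<le> ennpow (f1 y) (h y)"
          using ennpow_exponent_mono_ge1[of "f y" a "h y"] al by (auto simp: f1_def)
      qed simp
      finally have "ennpow (ennpow A1 a) (h x / a) \<le> ennpow (ennreal (2 powr a) * D) (h x / a)"
        using a1 h(1)[of x] by (intro ennpow_mono) auto
      then have "ennpow A1 (h x) \<le> ennreal (2 powr h x) * ennpow D (h x / a)"
        using a1 by (simp add: ennpow_ennpow ennpow_mult powr_powr)
      also have "\<dots> \<le> ennreal (2 powr (B * B)) * (ennreal Cl * ?Mf)"
      proof (intro mult_mono ennreal_leI powr_mono)
        show "h x \<le> B * B" using h(2)[of x] B mult_mono[of 1 B B B] by linarith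
        show "ennpow D (h x / a) \<le> ennreal Cl * ?Mf"
          using D_pow mult_left_mono[OF D_le, of "ennreal Cl"] by (rule order_trans) simp
      qed auto
      also have "\<dots> = ennreal (2 powr (B * B) * Cl) * ?Mf"
        using Cl by (simp add: ennreal_mult mult.assoc)
      finally show ?thesis .
    qed
    have exch: "ennpow u p \<le> ennreal E * ennpow u q + ennreal (decay y)"
      if u: "u \<le> 1" and pq: "1 \<le> p" "\<bar>p - q\<bar> \<le> L / ln (exp 1 + norm y)" for u p q and y :: 'a
    proof -
      obtain v where v: "u = ennreal v" "0 \<le> v" "v \<le> 1"
        using u by (cases u) (auto simp: top_unique)
      have "v powr p \<le> E * v powr q + decay y"
        unfolding E_def decay_def using powr_exchange_exponent[OF v(2,3) pq, of "real DIM('a) + 2"] by simp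
      then show ?thesis
        using v E decay_pos[of y] by (simp add: ennreal_leI less_imp_le flip: ennreal_mult ennreal_plus)
    qed
    have A2le: "A2 \<le> 1"
      unfolding A2_def set_mean_le_iff[OF ball(2,3)]
    proof -
      have "(\<integral>\<^sup>+ y \<in> ?b. f2 y \<partial>lebesgue) \<le> (\<integral>\<^sup>+ y. indicator ?b y \<partial>lebesgue)"
        using f2le by (intro nn_integral_mono) (auto split: split_indicator)
      then show "(\<integral>\<^sup>+ y \<in> ?b. f2 y \<partial>lebesgue) \<le> 1 * emeasure lebesgue ?b"
        using ball(1) by (simp only: nn_integral_indicator mult_1_left)
    qed
    have A2: "ennpow A2 (h x) \<le> ennreal (E * 2 powr b * (E + 1)) * (?Mf + ?MN) + ?MN"
    proof -
      have "ennpow A2 (h x) \<le> ennreal E * ennpow A2 b + ennreal (decay x)"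
        by (rule exch [OF A2le h(1) b(2)])
      also have "\<dots> \<le> ennreal E * (ennreal (2 powr b) * (ennreal (E + 1) * (?Mf + ?MN))) + ?MN"
      proof (intro add_mono mult_left_mono le_maximal)
        have "ennpow A2 b \<le> ennreal (2 powr b) * set_mean ?b (\<lambda>y. ennpow (f2 y) b)"
          unfolding A2_def by (rule set_mean_power_le [OF m2 ball b(1)])
        also have "set_mean ?b (\<lambda>y. ennpow (f2 y) b) \<le>
            set_mean ?b (\<lambda>y. ennreal E * ennpow (f2 y) (h y) + ennreal (decay y))"
          using b by (intro set_mean_mono exch f2le) (auto simp: abs_minus_commute)
        also have "\<dots> = ennreal E * set_mean ?b (\<lambda>y. ennpow (f2 y) (h y)) + set_mean ?b (\<lambda>y. ennreal (decay y))"
          using ball(1) by (simp add: set_mean_add set_mean_cmult)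
        also have "\<dots> \<le> ennreal (E + 1) * (?Mf + ?MN)"
        proof -
          have "set_mean ?b (\<lambda>y. ennpow (f2 y) (h y)) \<le> ?Mf"
            by (rule order_trans [OF set_mean_mono mean_le]) (auto simp: f2_def)
          then have "ennreal E * set_mean ?b (\<lambda>y. ennpow (f2 y) (h y)) + set_mean ?b (\<lambda>y. ennreal (decay y))
              \<le> ennreal E * (?Mf + ?MN) + 1 * (?Mf + ?MN)"
            using mean_le[of "\<lambda>y. ennreal (decay y)"]
            by (intro add_mono mult_left_mono) (auto intro: add_increasing add_increasing2)
          also have "\<dots> = ennreal (E + 1) * (?Mf + ?MN)"
            using E by (simp add: distrib_right ennreal_plus)
          finally show ?thesis .
        qed
        finally show "ennpow A2 b \<le> ennreal (2 powr b) * (ennreal (E + 1) * (?Mf + ?MN))"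
          by (simp add: mult_left_mono)
      qed auto
      also have "\<dots> = ennreal (E * 2 powr b * (E + 1)) * (?Mf + ?MN) + ?MN"
        using E by (simp add: ennreal_mult mult.assoc)
      finally show ?thesis .
    qed
    have "ennpow (A1 + A2) (h x) \<le> ennreal (2 powr h x) * (ennpow A1 (h x) + ennpow A2 (h x))"
      using h(1)[of x] by (intro ennpow_add_le) auto
    also have "\<dots> \<le> ennreal (2 powr B) * (ennreal (2 powr (B * B) * Cl) * (?Mf + ?MN) +
        (ennreal (E * 2 powr b * (E + 1)) * (?Mf + ?MN) + 1 * (?Mf + ?MN)))"
    proof (intro mult_mono ennreal_leI powr_mono h(2) add_mono)
      show "ennpow A1 (h x) \<le> ennreal (2 powr (B * B) * Cl) * (?Mf + ?MN)"
        by (rule order_trans [OF A1 mult_left_mono]) auto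
      show "ennpow A2 (h x) \<le> ennreal (E * 2 powr b * (E + 1)) * (?Mf + ?MN) + 1 * (?Mf + ?MN)"
        by (rule order_trans [OF A2 add_left_mono]) auto
    qed auto
    also have "\<dots> = ennreal C * (?Mf + ?MN)"
    proof -
      have "ennreal C = ennreal (2 powr B) * (ennreal (2 powr (B * B) * Cl) + (ennreal (E * 2 powr b * (E + 1)) + 1))"
        unfolding C_def using Cl E by (simp add: ennreal_mult ennreal_plus add.assoc)
      then show ?thesis by (simp only: distrib_right mult.assoc)
    qed
    finally show "ennpow (set_mean ?b f) (h x) \<le> ennreal C * (?Mf + ?MN)" unfolding A .
  qed
qed

text \<open>The pointwise estimate for the exponent \<open>p / r\<close> reduces the claim to the strong type inequality for the
  constant exponent \<open>r\<close>, applied to \<open>f powr (p / r)\<close> and to the error term.\<close>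

theorem maximal_modular_bounded:
  fixes p :: "real ^ 'n \<Rightarrow> real"
  assumes pm: "p \<in> borel_measurable lebesgue" and LH: "log_Hoelder p"
    and r: "1 < r" and p: "\<And>x. r \<le> p x" "\<And>x. p x \<le> B"
  obtains C where "0 < C"
    "\<And>f. f \<in> borel_measurable lebesgue \<Longrightarrow> (\<integral>\<^sup>+ x. ennpow (f x) (p x) \<partial>lebesgue) \<le> 1 \<Longrightarrow>
       (\<integral>\<^sup>+ x. ennpow (maximal f x) (p x) \<partial>lebesgue) \<le> ennreal C"
proof -
  note [measurable] = pm
  define h where "h = (\<lambda>x. p x / r)"
  have hm [measurable]: "h \<in> borel_measurable lebesgue" unfolding h_def by measurable
  have h: "1 \<le> h x" "h x \<le> B / r" for x
    unfolding h_def using r p[of x] by (auto intro: divide_right_mono)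
  have ph: "p x = h x * r" for x using r by (simp add: h_def)
  obtain C0 L q where LH': "\<And>x y. norm (x - y) < 1 / 2 \<Longrightarrow> \<bar>p x - p y\<bar> \<le> C0 / (- ln (norm (x - y)))"
    "\<And>x. \<bar>p x - q\<bar> \<le> L / ln (exp 1 + norm x)"
    using LH unfolding log_Hoelder_def by blast
  have scale: "\<bar>u / r - v / r\<bar> \<le> \<bar>u - v\<bar>" for u v
    using r mult_right_mono[of 1 r "\<bar>u - v\<bar>"] by (simp add: abs_divide divide_le_eq mult.commute flip: diff_divide_distrib)
  define C0' where "C0' = max 0 C0"
  have C0': "0 \<le> C0'" by (simp add: C0'_def)
  have loc: "\<bar>h x - h y\<bar> \<le> C0' / (- ln (norm (x - y)))" if "norm (x - y) < 1 / 2" for x y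
  proof -
    have "0 \<le> - ln (norm (x - y))" using that by (cases "x = y") auto
    then have "C0 / (- ln (norm (x - y))) \<le> C0' / (- ln (norm (x - y)))"
      unfolding C0'_def by (intro divide_right_mono) auto
    with LH'(1)[OF that] scale[of "p x" "p y"] show ?thesis unfolding h_def by linarith
  qed
  define b where "b = max 1 (q / r)"
  have b: "1 \<le> b" by (simp add: b_def)
  have inf: "\<bar>h x - b\<bar> \<le> L / ln (exp 1 + norm x)" for x
  proof -
    have "\<bar>h x - b\<bar> \<le> \<bar>h x - q / r\<bar>" using h(1)[of x] by (auto simp: b_def)
    then show ?thesis using LH'(2)[of x] scale[of "p x" q] unfolding h_def by linarith
  qed
  from set_mean_variable_power_le[OF hm h C0' loc b inf]
  obtain K where K: "0 < K"
    "\<And>f c r x. f \<in> borel_measurable lebesgue \<Longrightarrow> (\<integral>\<^sup>+ y. ennpow (f y) (h y) * indicator {y. 1 < f y} y \<partial>lebesgue) \<le> 1 \<Longrightarrow>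
       x \<in> ball c r \<Longrightarrow> ennpow (set_mean (ball c r) f) (h x) \<le>
         ennreal K * (maximal (\<lambda>y. ennpow (f y) (h y)) x + maximal (\<lambda>y. ennreal (decay y)) x)" by blast
  define K1 where "K1 = max 1 K"
  define S where "S = (1 + 5 ^ DIM(real ^ 'n)) * (2 powr r * r / (r - 1))"
  have S: "0 \<le> S" unfolding S_def using r by simp
  obtain N where N: "(\<integral>\<^sup>+ x. ennreal (decay (x :: real ^ 'n)) \<partial>lebesgue) = ennreal N" "0 \<le> N"
    using nn_integral_decay_finite[where 'a="real ^ 'n"]
    by (cases "\<integral>\<^sup>+ x. ennreal (decay (x :: real ^ 'n)) \<partial>lebesgue") auto
  define C where "C = K1 powr r * 2 powr r * (S * (1 + N)) + 1"
  have C: "0 < C" unfolding C_def using S N(2) by (intro add_nonneg_pos mult_nonneg_nonneg) auto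
  show thesis
  proof (rule that [OF C])
    fix f :: "real ^ 'n \<Rightarrow> ennreal"
    assume f [measurable]: "f \<in> borel_measurable lebesgue" and int: "(\<integral>\<^sup>+ x. ennpow (f x) (p x) \<partial>lebesgue) \<le> 1"
    let ?g = "\<lambda>y. ennpow (f y) (h y)" and ?N = "\<lambda>y :: real ^ 'n. ennreal (decay y)"
    have gm: "?g \<in> borel_measurable lebesgue" by measurable
    have Nm: "?N \<in> borel_measurable lebesgue" by measurable
    have f1: "(\<integral>\<^sup>+ y. ?g y * indicator {y. 1 < f y} y \<partial>lebesgue) \<le> 1"
    proof (rule order_trans [OF nn_integral_mono int])
      fix x
      have "h x \<le> p x" using h(1)[of x] r mult_left_mono[of 1 r "h x"] by (simp add: ph)
      then show "?g x * indicator {y. 1 < f y} x \<le> ennpow (f x) (p x)"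
        by (auto split: split_indicator intro!: ennpow_exponent_mono_ge1)
    qed
    have pt: "ennpow (maximal f x) (p x) \<le>
        ennreal (K1 powr r * 2 powr r) * (ennpow (maximal ?g x) r + ennpow (maximal ?N x) r)" for x
    proof -
      let ?Y = "ennreal K1 * (maximal ?g x + maximal ?N x)"
      have hx: "0 < h x" using h(1)[of x] by linarith
      have K1: "1 \<le> ennreal K1" "ennreal K \<le> ennreal K1" unfolding K1_def by (auto intro: ennreal_leI)
      have "maximal f x \<le> ennpow ?Y (1 / h x)"
      proof (rule maximal_least)
        have "?g x \<le> 1 * (maximal ?g x + maximal ?N x)" using le_maximal[of ?g x] by (simp add: add_increasing2)
        also have "\<dots> \<le> ?Y" by (rule mult_right_mono [OF K1(1)]) simp
        finally show "f x \<le> ennpow ?Y (1 / h x)" using hx by (simp add: ennpow_le_swap)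
        fix c s assume xs: "x \<in> ball c s"
        have "ennpow (set_mean (ball c s) f) (h x) \<le> ennreal K * (maximal ?g x + maximal ?N x)"
          by (rule K(2) [OF f f1 xs])
        also have "\<dots> \<le> ?Y" by (rule mult_right_mono [OF K1(2)]) simp
        finally show "set_mean (ball c s) f \<le> ennpow ?Y (1 / h x)" using hx by (simp add: ennpow_le_swap)
      qed
      then have "ennpow (maximal f x) (h x) \<le> ?Y" using hx by (simp add: ennpow_le_swap)
      then have "ennpow (ennpow (maximal f x) (h x)) r \<le> ennpow ?Y r"
        using r by (intro ennpow_mono) auto
      then have "ennpow (maximal f x) (p x) \<le> ennpow ?Y r" by (simp add: ennpow_ennpow ph)
      also have "\<dots> = ennreal (K1 powr r) * ennpow (maximal ?g x + maximal ?N x) r"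
        by (simp add: ennpow_mult K1_def)
      also have "\<dots> \<le> ennreal (K1 powr r) * (ennreal (2 powr r) * (ennpow (maximal ?g x) r + ennpow (maximal ?N x) r))"
        using r by (intro mult_left_mono ennpow_add_le) auto
      also have "\<dots> = ennreal (K1 powr r * 2 powr r) * (ennpow (maximal ?g x) r + ennpow (maximal ?N x) r)"
        by (simp add: ennreal_mult mult.assoc)
      finally show ?thesis .
    qed
    have "(\<integral>\<^sup>+ x. ennpow (maximal f x) (p x) \<partial>lebesgue) \<le>
       (\<integral>\<^sup>+ x. ennreal (K1 powr r * 2 powr r) * (ennpow (maximal ?g x) r + ennpow (maximal ?N x) r) \<partial>lebesgue)"
      by (rule nn_integral_mono) (rule pt)
    also have "\<dots> = ennreal (K1 powr r * 2 powr r) * ((\<integral>\<^sup>+ x. ennpow (maximal ?g x) r \<partial>lebesgue)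
        + (\<integral>\<^sup>+ x. ennpow (maximal ?N x) r \<partial>lebesgue))"
      using gm Nm by (subst nn_integral_cmult) (auto simp: nn_integral_add)
    also have "\<dots> \<le> ennreal (K1 powr r * 2 powr r) * (ennreal S * 1 + ennreal S * ennreal N)"
    proof (intro mult_left_mono add_mono)
      have "(\<integral>\<^sup>+ x. ennpow (maximal ?g x) r \<partial>lebesgue) \<le> ennreal S * (\<integral>\<^sup>+ x. ennpow (?g x) r \<partial>lebesgue)"
        unfolding S_def by (rule maximal_strong_type [OF gm r])
      also have "(\<integral>\<^sup>+ x. ennpow (?g x) r \<partial>lebesgue) = (\<integral>\<^sup>+ x. ennpow (f x) (p x) \<partial>lebesgue)"
        by (simp add: ennpow_ennpow ph)
      also have "ennreal S * \<dots> \<le> ennreal S * 1" by (rule mult_left_mono [OF int]) simp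
      finally show "(\<integral>\<^sup>+ x. ennpow (maximal ?g x) r \<partial>lebesgue) \<le> ennreal S * 1" .
      have "(\<integral>\<^sup>+ x. ennpow (maximal ?N x) r \<partial>lebesgue) \<le> ennreal S * (\<integral>\<^sup>+ x. ennpow (?N x) r \<partial>lebesgue)"
        unfolding S_def by (rule maximal_strong_type [OF Nm r])
      also have "\<dots> \<le> ennreal S * (\<integral>\<^sup>+ x. ?N x \<partial>lebesgue)"
      proof (intro mult_left_mono nn_integral_mono)
        fix x :: "real ^ 'n"
        have "ennpow (?N x) r \<le> ennpow (?N x) 1"
          using decay_le_1[of x] r by (intro ennpow_exponent_mono_le1) auto
        then show "ennpow (?N x) r \<le> ?N x" by (simp only: ennpow_one)
      qed simp
      finally show "(\<integral>\<^sup>+ x. ennpow (maximal ?N x) r \<partial>lebesgue) \<le> ennreal S * ennreal N" unfolding N(1) .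
    qed simp
    also have "\<dots> = ennreal (K1 powr r * 2 powr r * (S * (1 + N)))"
    proof -
      have "ennreal S * 1 + ennreal S * ennreal N = ennreal (S * (1 + N))"
        using S N(2) by (simp add: distrib_left ennreal_plus ennreal_mult)
      then show ?thesis using S N(2) by (simp add: ennreal_mult)
    qed
    also have "\<dots> \<le> ennreal C" unfolding C_def by (rule ennreal_leI) simp
    finally show "(\<integral>\<^sup>+ x. ennpow (maximal f x) (p x) \<partial>lebesgue) \<le> ennreal C" .
  qed
qed

section \<open>Log-Hoelder continuous exponents\<close>

lemma log_Hoelder_compose:
  assumes LH: "log_Hoelder p" and p: "\<And>x. l \<le> p x"
    and lip: "\<And>u v. l \<le> u \<Longrightarrow> l \<le> v \<Longrightarrow> \<bar>\<psi> u - \<psi> v\<bar> \<le> M * \<bar>u - v\<bar>" and M: "0 \<le> M"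
  shows "log_Hoelder (\<lambda>x. \<psi> (p x))"
proof -
  obtain C0 L q where LH': "\<And>x y. norm (x - y) < 1 / 2 \<Longrightarrow> \<bar>p x - p y\<bar> \<le> C0 / (- ln (norm (x - y)))"
    "\<And>x. \<bar>p x - q\<bar> \<le> L / ln (exp 1 + norm x)"
    using LH unfolding log_Hoelder_def by blast
  show ?thesis
    unfolding log_Hoelder_def
  proof (intro exI conjI allI impI)
    fix x y :: "real ^ 'a" assume "norm (x - y) < 1 / 2"
    then have "M * \<bar>p x - p y\<bar> \<le> M * (C0 / (- ln (norm (x - y))))"
      by (intro mult_left_mono LH' M)
    then show "\<bar>\<psi> (p x) - \<psi> (p y)\<bar> \<le> (M * C0) / (- ln (norm (x - y)))"
      using lip[OF p[of x] p[of y]] by simp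
  next
    fix x :: "real ^ 'a"
    \<comment> \<open>the limit at infinity is projected to the range on which \<open>\<psi>\<close> is Lipschitz\<close>
    have "\<bar>\<psi> (p x) - \<psi> (max l q)\<bar> \<le> M * \<bar>p x - max l q\<bar>" by (rule lip) (use p in auto)
    also have "\<dots> \<le> M * \<bar>p x - q\<bar>" using p[of x] M by (intro mult_left_mono) auto
    also have "\<dots> \<le> M * (L / ln (exp 1 + norm x))" by (intro mult_left_mono LH' M)
    finally show "\<bar>\<psi> (p x) - \<psi> (max l q)\<bar> \<le> (M * L) / ln (exp 1 + norm x)" by simp
  qed
qed

lemma log_Hoelder_reciprocal:
  assumes "log_Hoelder p" "0 < l" "\<And>x. l \<le> p x"
  shows "log_Hoelder (\<lambda>x. 1 / p x)"
proof (rule log_Hoelder_compose [OF assms(1,3)])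
  fix u v :: real assume uv: "l \<le> u" "l \<le> v"
  then have "0 < u" "0 < v" using assms(2) by auto
  then have "\<bar>1 / u - 1 / v\<bar> = \<bar>u - v\<bar> / (u * v)"
    by (simp add: field_simps abs_divide abs_mult abs_minus_commute)
  also have "\<dots> \<le> \<bar>u - v\<bar> / (l * l)"
    using uv assms(2) \<open>0 < u\<close> \<open>0 < v\<close> by (intro divide_left_mono mult_mono) auto
  finally show "\<bar>1 / u - 1 / v\<bar> \<le> 1 / (l * l) * \<bar>u - v\<bar>" by simp
qed (use assms(2) in auto)

lemma log_Hoelder_continuous:
  assumes "log_Hoelder p" "0 < d"
  obtains e where "0 < e" "\<And>y. norm (x - y) < e \<Longrightarrow> \<bar>p x - p y\<bar> < d"
proof -
  obtain C0 where C0: "\<And>x y. norm (x - y) < 1 / 2 \<Longrightarrow> \<bar>p x - p y\<bar> \<le> C0 / (- ln (norm (x - y)))"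
    using assms unfolding log_Hoelder_def by blast
  define C where "C = \<bar>C0\<bar> + 1"
  have C: "0 < C" "C0 < C" by (auto simp: C_def)
  define e where "e = min (1 / 2) (exp (- (C / d)))"
  show thesis
  proof (rule that [of e])
    fix y assume y: "norm (x - y) < e"
    show "\<bar>p x - p y\<bar> < d"
    proof (cases "x = y")
      case False
      then have pos: "0 < norm (x - y)" by simp
      have "ln (norm (x - y)) < ln (exp (- (C / d)))"
        using y pos by (subst ln_less_cancel_iff) (auto simp: e_def)
      then have l: "C / d < - ln (norm (x - y))" by simp
      have l0: "0 < - ln (norm (x - y))" using l C assms(2) by (meson divide_pos_pos less_trans)
      have "\<bar>p x - p y\<bar> \<le> C0 / (- ln (norm (x - y)))" using y by (intro C0) (auto simp: e_def)
      also have "\<dots> < C / (- ln (norm (x - y)))" by (rule divide_strict_right_mono [OF C(2) l0])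
      also have "\<dots> < d" using l l0 assms(2) C by (simp only: divide_less_eq) (simp add: mult.commute)
      finally show ?thesis .
    qed (use assms in simp)
  qed (simp add: e_def)
qed

text \<open>Log-Hoelder continuous exponents are continuous, so that essential bounds hold at every point.\<close>

lemma log_Hoelder_AE_imp:
  fixes p :: "real ^ 'n \<Rightarrow> real"
  assumes LH: "log_Hoelder p" and S: "closed S" and ae: "AE x in lebesgue. p x \<in> S"
  shows "p x \<in> S"
proof (rule ccontr)
  assume "p x \<notin> S"
  then obtain d where d: "0 < d" "ball (p x) d \<subseteq> - S"
    using S open_contains_ball[of "- S"] by (auto simp: open_Compl)
  obtain e where e: "0 < e" "\<And>y. norm (x - y) < e \<Longrightarrow> \<bar>p x - p y\<bar> < d"
    using log_Hoelder_continuous[OF LH d(1)] by blast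
  obtain N where N: "{x \<in> space lebesgue. p x \<notin> S} \<subseteq> N" "emeasure lebesgue N = 0" "N \<in> sets lebesgue"
    using AE_E[OF ae] by blast
  have "ball x e \<subseteq> N"
  proof
    fix y assume "y \<in> ball x e"
    then have "\<bar>p x - p y\<bar> < d" by (intro e) (simp add: dist_norm)
    then have "p y \<in> ball (p x) d" by (simp add: dist_real_def)
    then show "y \<in> N" using d N(1) by auto
  qed
  then have "emeasure lebesgue (ball x e) \<le> emeasure lebesgue N" by (rule emeasure_mono [OF _ N(3)])
  with N(2) emeasure_lebesgue_ball_pos[OF e(1), of x] show False by (simp del: emeasure_completion)
qed

section \<open>Majorants whose reciprocals are controlled by their means on cubes\<close>

lemma emeasure_cube:
  fixes a :: "real ^ 'n"
  assumes "0 < l"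
  shows "emeasure lebesgue (box a (a + vec l)) = ennreal (l ^ CARD('n))"
proof -
  have *: "(a + vec l - a) \<bullet> b = l" if "b \<in> Basis" for b :: "real ^ 'n"
    using that by (auto simp: Basis_vec_def inner_axis)
  have "emeasure lborel (box a (a + vec l)) = ennreal (\<Prod>b\<in>Basis. (a + vec l - a) \<bullet> b)"
  proof (rule emeasure_lborel_box)
    fix b :: "real ^ 'n" assume "b \<in> Basis"
    from *[OF this] assms show "a \<bullet> b \<le> (a + vec l) \<bullet> b" by (simp add: inner_diff_left inner_add_left)
  qed
  also have "(\<Prod>b\<in>Basis. (a + vec l - a) \<bullet> b) = (\<Prod>b\<in>(Basis :: (real ^ 'n) set). l)"
    by (rule prod.cong [OF refl]) (rule *)
  also have "\<dots> = l ^ CARD('n)" by simp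
  finally show ?thesis by simp
qed

definition cube_constant :: "'n::finite itself \<Rightarrow> real" where
  "cube_constant _ = max 1 (unit_ball_vol DIM(real ^ 'n) * (CARD('n) + 1) ^ CARD('n))"

lemma cube_in_ball:
  fixes Q :: "(real ^ 'n) set"
  assumes "is_cube Q"
  obtains c R where "Q \<in> sets lebesgue" "0 < emeasure lebesgue Q" "emeasure lebesgue Q < top"
    "0 < R" "Q \<subseteq> ball c R" "emeasure lebesgue (ball c R) \<le> ennreal (cube_constant TYPE('n)) * emeasure lebesgue Q"
proof -
  obtain a l where Q: "is_interval Q" "0 < l" "box a (a + vec l) \<subseteq> Q" "Q \<subseteq> cbox a (a + vec l)"
    using assms unfolding is_cube_def by blast
  let ?n = "CARD('n)"
  define R where "R = (real ?n + 1) * l"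
  have R: "0 < R" unfolding R_def using Q by (intro mult_pos_pos) auto
  have "bounded Q" using Q(4) bounded_cbox bounded_subset by blast
  then have meas: "Q \<in> lmeasurable" using Q(1) by (intro measurable_convex is_interval_convex)
  have box: "box a (a + vec l) \<in> sets lebesgue" by simp
  have Ql: "ennreal (l ^ ?n) \<le> emeasure lebesgue Q"
    using emeasure_mono[OF Q(3), of lebesgue] meas emeasure_cube[OF Q(2), of a] by (simp add: fmeasurableD)
  have sub: "Q \<subseteq> ball a R"
  proof
    fix y assume "y \<in> Q"
    then have y: "\<bar>(y - a) $ i\<bar> \<le> l" for i using Q(4) by (auto simp: mem_box_cart dest!: subsetD spec[of _ i])
    have "norm (y - a) \<le> (\<Sum>i\<in>UNIV. \<bar>(y - a) $ i\<bar>)" by (rule norm_le_l1_cart)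
    also have "\<dots> \<le> (\<Sum>i\<in>(UNIV :: 'n set). l)" by (intro sum_mono y)
    also have "\<dots> < R" using Q(2) by (simp add: R_def algebra_simps)
    finally show "y \<in> ball a R" by (simp add: dist_norm norm_minus_commute)
  qed
  have "emeasure lebesgue (ball a R) = ennreal (unit_ball_vol DIM(real ^ 'n) * R ^ ?n)"
    using R by (subst emeasure_lebesgue_ball) auto
  also have "\<dots> \<le> ennreal (cube_constant TYPE('n) * l ^ ?n)"
    unfolding R_def cube_constant_def power_mult_distrib mult.assoc [symmetric]
    using Q(2) by (intro ennreal_leI mult_right_mono) (auto simp: add.commute)
  also have "\<dots> \<le> ennreal (cube_constant TYPE('n)) * emeasure lebesgue Q"
    using Ql Q(2) by (subst ennreal_mult) (auto simp: cube_constant_def intro: mult_left_mono)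
  finally have ball: "emeasure lebesgue (ball a R) \<le> ennreal (cube_constant TYPE('n)) * emeasure lebesgue Q" .
  show thesis
  proof (rule that [OF _ _ _ R sub ball])
    show "Q \<in> sets lebesgue" using meas by (rule fmeasurableD)
    have "0 < ennreal (l ^ ?n)" using Q(2) by simp
    then show "0 < emeasure lebesgue Q" using Ql by (rule less_le_trans)
    show "emeasure lebesgue Q < top" using meas by (simp add: fmeasurable_def del: emeasure_completion)
  qed
qed

lemma cube_constant_ge_1: "1 \<le> cube_constant TYPE('n::finite)"
  by (simp add: cube_constant_def)

text \<open>The majorant is the power \<open>2 / l\<close> of the maximal function of \<open>h powr (l / 2)\<close>. The inner power lies in the
  space with exponent \<open>p / (l / 2)\<close>, which is at least 2, so the maximal operator is bounded there.\<close>

lemma reciprocal_controlled_majorant: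
  fixes p :: "real ^ 'n \<Rightarrow> real"
  assumes pm: "p \<in> borel_measurable lebesgue" and LH: "log_Hoelder p"
    and l: "0 < l" and p: "\<And>x. l \<le> p x" "\<And>x. p x \<le> B"
  obtains C where "0 < C"
    "\<And>h. h \<in> borel_measurable lebesgue \<Longrightarrow> (\<integral>\<^sup>+ x. ennpow (h x) (p x) \<partial>lebesgue) \<le> 1 \<Longrightarrow>
       \<exists>V. V \<in> borel_measurable lebesgue \<and> (\<forall>x. h x \<le> V x) \<and>
         (\<forall>Q x. is_cube Q \<longrightarrow> x \<in> Q \<longrightarrow> inverse (V x) * emeasure lebesgue Q
            \<le> ennreal C * (\<integral>\<^sup>+ y \<in> Q. inverse (V y) \<partial>lebesgue)) \<and>
         (\<integral>\<^sup>+ x. ennpow (V x) (p x) \<partial>lebesgue) \<le> ennreal C"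
proof -
  note [measurable] = pm
  define e where "e = l / 2"
  have e: "0 < e" using l by (simp add: e_def)
  have pe: "2 \<le> p x / e" "p x / e \<le> B / e" for x
    using e p[of x] by (auto simp: e_def field_simps)
  have LHe: "log_Hoelder (\<lambda>x. p x / e)"
    by (rule log_Hoelder_compose [OF LH p(1), where M = "1 / e"])
      (use e in \<open>auto simp: abs_divide simp flip: diff_divide_distrib\<close>)
  have pem: "(\<lambda>x. p x / e) \<in> borel_measurable lebesgue" by measurable
  have "1 < (2::real)" by simp
  from maximal_modular_bounded[OF pem LHe this pe]
  obtain C1 where C1: "0 < C1" "\<And>f. f \<in> borel_measurable lebesgue \<Longrightarrow> (\<integral>\<^sup>+ x. ennpow (f x) (p x / e) \<partial>lebesgue) \<le> 1 \<Longrightarrow>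
       (\<integral>\<^sup>+ x. ennpow (maximal f x) (p x / e) \<partial>lebesgue) \<le> ennreal C1" by blast
  define K where "K = 2 * (1 + 5 ^ DIM(real ^ 'n)) * 3 ^ DIM(real ^ 'n) * cube_constant TYPE('n)"
  define C2 where "C2 = 2 * K powr (1 / e)"
  define C where "C = max C1 C2"
  have C: "0 < C" using C1(1) by (simp add: C_def)
  show thesis
  proof (rule that [OF C])
    fix h :: "real ^ 'n \<Rightarrow> ennreal"
    assume h [measurable]: "h \<in> borel_measurable lebesgue" and int: "(\<integral>\<^sup>+ x. ennpow (h x) (p x) \<partial>lebesgue) \<le> 1"
    let ?f = "\<lambda>x. ennpow (h x) e"
    let ?V = "\<lambda>x. ennpow (maximal ?f x) (1 / e)"
    have f: "?f \<in> borel_measurable lebesgue" by measurable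
    have "(\<integral>\<^sup>+ x. ennpow (?f x) (p x / e) \<partial>lebesgue) \<le> 1" using int e by (simp add: ennpow_ennpow)
    then have M: "(\<integral>\<^sup>+ x. ennpow (maximal ?f x) (p x / e) \<partial>lebesgue) \<le> ennreal C1" by (rule C1(2) [OF f])
    show "\<exists>V. V \<in> borel_measurable lebesgue \<and> (\<forall>x. h x \<le> V x) \<and>
         (\<forall>Q x. is_cube Q \<longrightarrow> x \<in> Q \<longrightarrow> inverse (V x) * emeasure lebesgue Q
            \<le> ennreal C * (\<integral>\<^sup>+ y \<in> Q. inverse (V y) \<partial>lebesgue)) \<and>
         (\<integral>\<^sup>+ x. ennpow (V x) (p x) \<partial>lebesgue) \<le> ennreal C"
    proof (intro exI[of _ ?V] conjI allI impI)
      show "?V \<in> borel_measurable lebesgue"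
        by (intro borel_measurable_ennpow borel_measurable_maximal f borel_measurable_const)
      show "h x \<le> ?V x" for x
        using le_maximal[of ?f x] e by (simp add: ennpow_le_swap)
      show "inverse (?V x) * emeasure lebesgue Q \<le> ennreal C * (\<integral>\<^sup>+ y \<in> Q. inverse (?V y) \<partial>lebesgue)"
        if Q: "is_cube Q" and x: "x \<in> Q" for Q x
      proof -
        from cube_in_ball[OF Q] obtain c R where R: "Q \<in> sets lebesgue" "Q \<subseteq> ball c R"
          "emeasure lebesgue (ball c R) \<le> ennreal (cube_constant TYPE('n)) * emeasure lebesgue Q" by metis
        have "inverse (?V x) * emeasure lebesgue Q \<le> ennreal C2 * (\<integral>\<^sup>+ y \<in> Q. inverse (?V y) \<partial>lebesgue)"
          unfolding C2_def K_def
          by (rule inverse_maximal_power_le_mean [OF f R(1,2) cube_constant_ge_1 R(3) x]) (use e in simp)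
        also have "\<dots> \<le> ennreal C * (\<integral>\<^sup>+ y \<in> Q. inverse (?V y) \<partial>lebesgue)"
          by (intro mult_right_mono ennreal_leI) (auto simp: C_def)
        finally show ?thesis .
      qed
      have "(\<integral>\<^sup>+ x. ennpow (?V x) (p x) \<partial>lebesgue) \<le> ennreal C1" using M by (simp add: ennpow_ennpow)
      also have "\<dots> \<le> ennreal C" by (intro ennreal_leI) (simp add: C_def)
      finally show "(\<integral>\<^sup>+ x. ennpow (?V x) (p x) \<partial>lebesgue) \<le> ennreal C" .
    qed
  qed
qed

section \<open>Sums of functions supported in cubes\<close>

lemma fraction_le_power:
  assumes s: "0 < s" "s < 1" and v: "ennpow u (1 - s) \<le> v"
  shows "u * inverse v \<le> ennpow u s"
proof (cases "u = 0 \<or> u = top")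
  case True
  with v s show ?thesis by (auto simp: top_unique)
next
  case False
  then obtain w where w: "u = ennreal w" "0 < w" by (cases u) (auto simp: less_le)
  have "inverse v \<le> inverse (ennpow u (1 - s))" by (rule ennreal_inverse_antimono [OF v])
  also have "\<dots> = ennreal (w powr (s - 1))"
    using w by (simp add: inverse_ennreal powr_minus [symmetric])
  finally have "u * inverse v \<le> ennreal w * ennreal (w powr (s - 1))"
    unfolding w(1) by (rule mult_left_mono) simp
  also have "\<dots> = ennreal (w powr 1 * w powr (s - 1))" using w by (simp add: ennreal_mult)
  also have "w powr 1 * w powr (s - 1) = w powr s" by (simp only: powr_add [symmetric]) simp
  finally show ?thesis using w by simp
qed

text \<open>The variable exponent \<open>s\<close> stays below 1, so \<open>G powr s\<close> splits into the linear term
  \<open>G / V\<close> and a term without \<open>G\<close>. In the linear term the sum may be integrated term by term,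
  and on each set the weight \<open>1 / V\<close> is replaced by its mean; this turns \<open>g k\<close> into its
  average \<open>a k\<close>.\<close>

lemma weighted_sum_bound:
  fixes Q :: "nat \<Rightarrow> 'a::euclidean_space set" and g :: "nat \<Rightarrow> 'a \<Rightarrow> ennreal" and a :: "nat \<Rightarrow> ennreal"
  defines "F \<equiv> \<lambda>x. \<Sum>k. a k * indicator (Q k) x" and "G \<equiv> \<lambda>x. \<Sum>k. g k x"
  assumes Q: "\<And>k. Q k \<in> sets lebesgue" "\<And>k. 0 < emeasure lebesgue (Q k)" "\<And>k. emeasure lebesgue (Q k) < top"
    and gm: "\<And>k. g k \<in> borel_measurable lebesgue" and gQ: "\<And>k x. x \<notin> Q k \<Longrightarrow> g k x = 0"
    and sm: "s \<in> borel_measurable lebesgue" and s: "\<And>x. 0 < s x" "\<And>x. s x < 1"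
    and Vm: "V \<in> borel_measurable lebesgue" and VF: "\<And>x. ennpow (F x) (1 - s x) \<le> V x"
    and V: "\<And>k x. x \<in> Q k \<Longrightarrow> inverse (V x) * emeasure lebesgue (Q k)
              \<le> ennreal C * (\<integral>\<^sup>+ y \<in> Q k. inverse (V y) \<partial>lebesgue)"
    and fm: "\<phi> \<in> borel_measurable lebesgue" and Fm: "\<Phi> \<in> borel_measurable lebesgue"
    and avg: "\<And>k x. x \<in> Q k \<Longrightarrow> (\<integral>\<^sup>+ y. g k y * \<phi> y \<partial>lebesgue) \<le> c * a k * emeasure lebesgue (Q k) * \<Phi> x"
  shows "(\<integral>\<^sup>+ x. ennpow (G x) (s x) * \<phi> x \<partial>lebesgue)
     \<le> ennreal C * c * (\<integral>\<^sup>+ x. ennpow (F x) (s x) * \<Phi> x \<partial>lebesgue)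
       + (\<integral>\<^sup>+ x. ennpow (V x) (s x / (1 - s x)) * \<phi> x \<partial>lebesgue)"
proof -
  note [measurable] = Q(1) gm sm Vm fm Fm
  have Im: "(\<lambda>x. inverse (V x)) \<in> borel_measurable lebesgue" by measurable
  have Gm [measurable]: "G \<in> borel_measurable lebesgue" unfolding G_def by measurable
  have Fm' [measurable]: "F \<in> borel_measurable lebesgue" unfolding F_def by measurable
  have piece: "(\<integral>\<^sup>+ x. g k x * (inverse (V x) * \<phi> x) \<partial>lebesgue)
      \<le> (\<integral>\<^sup>+ x. ennreal C * c * (a k * indicator (Q k) x * (inverse (V x) * \<Phi> x)) \<partial>lebesgue)" for k
  proof -
    let ?m = "emeasure lebesgue (Q k)"
    let ?X = "\<integral>\<^sup>+ y. g k y * \<phi> y \<partial>lebesgue" and ?Y = "\<integral>\<^sup>+ y \<in> Q k. inverse (V y) \<partial>lebesgue"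
    have m: "?m \<noteq> 0" "?m \<noteq> top" using Q(2,3)[of k] by auto
    have VY: "inverse (V x) \<le> ennreal C * ?Y / ?m" if "x \<in> Q k" for x
    proof -
      have "inverse (V x) = inverse (V x) * ?m / ?m" using m by (simp add: mult_divide_eq_ennreal)
      also have "\<dots> \<le> ennreal C * ?Y / ?m" by (intro divide_right_mono_ennreal V that)
      finally show ?thesis .
    qed
    have XP: "?X / ?m \<le> c * a k * \<Phi> x" if "x \<in> Q k" for x
    proof -
      have "?X / ?m \<le> c * a k * ?m * \<Phi> x / ?m" by (intro divide_right_mono_ennreal avg that)
      also have "\<dots> = c * a k * \<Phi> x * ?m / ?m" by (simp only: mult_ac)
      also have "\<dots> = c * a k * \<Phi> x" using m by (simp add: mult_divide_eq_ennreal)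
      finally show ?thesis .
    qed
    have "(\<integral>\<^sup>+ x. g k x * (inverse (V x) * \<phi> x) \<partial>lebesgue)
        \<le> (\<integral>\<^sup>+ x. (ennreal C * ?Y / ?m) * (g k x * \<phi> x) \<partial>lebesgue)"
    proof (rule nn_integral_mono)
      fix x
      show "g k x * (inverse (V x) * \<phi> x) \<le> (ennreal C * ?Y / ?m) * (g k x * \<phi> x)"
      proof (cases "x \<in> Q k")
        case True
        then have "inverse (V x) * (g k x * \<phi> x) \<le> (ennreal C * ?Y / ?m) * (g k x * \<phi> x)"
          by (intro mult_right_mono VY) auto
        then show ?thesis by (simp only: mult_ac)
      qed (simp add: gQ)
    qed
    also have "\<dots> = (ennreal C * ?Y / ?m) * ?X" by (rule nn_integral_cmult) measurable
    also have "\<dots> = (ennreal C * (?X / ?m)) * ?Y" by (simp only: divide_ennreal_def mult_ac)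
    also have "\<dots> = (\<integral>\<^sup>+ x. (ennreal C * (?X / ?m)) * (inverse (V x) * indicator (Q k) x) \<partial>lebesgue)"
      using Q(1) Im by (intro nn_integral_cmult [symmetric] borel_measurable_times_ennreal borel_measurable_indicator) auto
    also have "\<dots> \<le> (\<integral>\<^sup>+ x. ennreal C * c * (a k * indicator (Q k) x * (inverse (V x) * \<Phi> x)) \<partial>lebesgue)"
    proof (rule nn_integral_mono)
      fix x
      show "ennreal C * (?X / ?m) * (inverse (V x) * indicator (Q k) x)
         \<le> ennreal C * c * (a k * indicator (Q k) x * (inverse (V x) * \<Phi> x))"
      proof (cases "x \<in> Q k")
        case True
        have "ennreal C * (?X / ?m) * inverse (V x) \<le> ennreal C * (c * a k * \<Phi> x) * inverse (V x)"
          by (intro mult_right_mono mult_left_mono XP True) auto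
        then show ?thesis using True by (simp add: mult_ac)
      qed simp
    qed
    finally show ?thesis .
  qed
  have "(\<integral>\<^sup>+ x. ennpow (G x) (s x) * \<phi> x \<partial>lebesgue)
     \<le> (\<integral>\<^sup>+ x. (\<Sum>k. g k x * (inverse (V x) * \<phi> x)) + ennpow (V x) (s x / (1 - s x)) * \<phi> x \<partial>lebesgue)"
  proof (rule nn_integral_mono)
    fix x
    have "ennpow (G x) (s x) * \<phi> x \<le> (G x * inverse (V x) + ennpow (V x) (s x / (1 - s x))) * \<phi> x"
      by (intro mult_right_mono young_concave_ennreal s) simp
    also have "\<dots> = G x * (inverse (V x) * \<phi> x) + ennpow (V x) (s x / (1 - s x)) * \<phi> x"
      by (simp add: distrib_right mult.assoc)
    also have "G x * (inverse (V x) * \<phi> x) = (\<Sum>k. g k x * (inverse (V x) * \<phi> x))"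
      by (simp add: G_def ennreal_suminf_multc)
    finally show "ennpow (G x) (s x) * \<phi> x \<le> \<dots> + ennpow (V x) (s x / (1 - s x)) * \<phi> x" .
  qed
  also have "\<dots> = (\<integral>\<^sup>+ x. (\<Sum>k. g k x * (inverse (V x) * \<phi> x)) \<partial>lebesgue)
      + (\<integral>\<^sup>+ x. ennpow (V x) (s x / (1 - s x)) * \<phi> x \<partial>lebesgue)"
    by (rule nn_integral_add) measurable
  also have "(\<integral>\<^sup>+ x. (\<Sum>k. g k x * (inverse (V x) * \<phi> x)) \<partial>lebesgue)
      \<le> ennreal C * c * (\<integral>\<^sup>+ x. ennpow (F x) (s x) * \<Phi> x \<partial>lebesgue)"
  proof -
    have "(\<integral>\<^sup>+ x. (\<Sum>k. g k x * (inverse (V x) * \<phi> x)) \<partial>lebesgue)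
        = (\<Sum>k. \<integral>\<^sup>+ x. g k x * (inverse (V x) * \<phi> x) \<partial>lebesgue)"
      by (rule nn_integral_suminf) measurable
    also have "\<dots> \<le> (\<Sum>k. \<integral>\<^sup>+ x. ennreal C * c * (a k * indicator (Q k) x * (inverse (V x) * \<Phi> x)) \<partial>lebesgue)"
      by (intro suminf_le piece) auto
    also have "\<dots> = (\<integral>\<^sup>+ x. (\<Sum>k. ennreal C * c * (a k * indicator (Q k) x * (inverse (V x) * \<Phi> x))) \<partial>lebesgue)"
      by (rule nn_integral_suminf [symmetric]) measurable
    also have "\<dots> \<le> (\<integral>\<^sup>+ x. ennreal C * c * (ennpow (F x) (s x) * \<Phi> x) \<partial>lebesgue)"
    proof (rule nn_integral_mono)
      fix x
      have "(\<Sum>k. ennreal C * c * (a k * indicator (Q k) x * (inverse (V x) * \<Phi> x)))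
          = ennreal C * c * (F x * (inverse (V x) * \<Phi> x))"
        by (simp only: ennreal_suminf_cmult ennreal_suminf_multc F_def)
      also have "\<dots> = ennreal C * c * ((F x * inverse (V x)) * \<Phi> x)" by (simp only: mult.assoc)
      also have "\<dots> \<le> ennreal C * c * (ennpow (F x) (s x) * \<Phi> x)"
        by (intro mult_left_mono mult_right_mono fraction_le_power s VF) auto
      finally show "(\<Sum>k. ennreal C * c * (a k * indicator (Q k) x * (inverse (V x) * \<Phi> x)))
          \<le> ennreal C * c * (ennpow (F x) (s x) * \<Phi> x)" .
    qed
    also have "\<dots> = ennreal C * c * (\<integral>\<^sup>+ x. ennpow (F x) (s x) * \<Phi> x \<partial>lebesgue)"
      by (rule nn_integral_cmult) measurable
    finally show ?thesis .
  qed
  finally show ?thesis by (simp add: add_right_mono)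
qed

text \<open>With both means normalised to 1, Young's inequality bounds the integrand pointwise; its two terms account
  for the factor 2 in this form of Hoelder's inequality.\<close>

lemma nn_integral_mult_le_means:
  fixes S :: "'a::euclidean_space set"
  assumes S: "S \<in> sets lebesgue" "0 < emeasure lebesgue S" "emeasure lebesgue S < top"
    and um: "u \<in> borel_measurable lebesgue" and vm: "v \<in> borel_measurable lebesgue"
    and q: "1 < q" "1 / q + 1 / q' = 1"
  shows "(\<integral>\<^sup>+ y \<in> S. u y * v y \<partial>lebesgue) \<le>
     2 * emeasure lebesgue S * (ennpow (set_mean S (\<lambda>y. ennpow (u y) q)) (1 / q)
        * ennpow (set_mean S (\<lambda>y. ennpow (v y) q')) (1 / q'))"
proof -
  note [measurable] = S(1) um vm
  have q': "0 < q'"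
  proof -
    have "1 / q < 1" using q(1) by simp
    then have "0 < 1 / q'" using q(2) by linarith
    then show ?thesis by simp
  qed
  let ?A = "set_mean S (\<lambda>y. ennpow (u y) q)" and ?B = "set_mean S (\<lambda>y. ennpow (v y) q')"
  have zero: "(\<integral>\<^sup>+ y \<in> S. u y * v y \<partial>lebesgue) = 0"
    if "set_mean S w = 0" "w \<in> borel_measurable lebesgue" "\<And>y. w y = 0 \<Longrightarrow> u y * v y = 0" for w
  proof -
    have "(\<integral>\<^sup>+ y \<in> S. w y \<partial>lebesgue) = 0" using set_mean_mult[OF S(2,3), of w] that(1) by simp
    then have "AE y in lebesgue. w y * indicator S y = 0"
      using that(2) S(1) by (subst (asm) nn_integral_0_iff_AE) auto
    then have "AE y in lebesgue. u y * v y * indicator S y = 0"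
      by eventually_elim (use that(3) in \<open>auto simp: indicator_def split: if_splits\<close>)
    then show ?thesis by (subst nn_integral_0_iff_AE) auto
  qed
  consider "?A = 0" | "?B = 0" | "?A \<noteq> 0" "?B \<noteq> 0" "?A = top \<or> ?B = top"
    | "?A \<noteq> 0" "?B \<noteq> 0" "?A \<noteq> top" "?B \<noteq> top" by blast
  then show ?thesis
  proof cases
    case 1
    then show ?thesis by (subst zero [of "\<lambda>y. ennpow (u y) q"]) auto
  next
    case 2
    then show ?thesis by (subst zero [of "\<lambda>y. ennpow (v y) q'"]) auto
  next
    case 3
    then have "ennpow ?A (1 / q) * ennpow ?B (1 / q') = top"
      by (auto simp: ennreal_top_mult ennreal_mult_top)
    then show ?thesis using S(2) by (simp add: ennreal_mult_top)
  next
    case 4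
    obtain A where A: "?A = ennreal A" "0 < A" using 4 by (cases ?A) (auto simp: less_le)
    obtain B where B: "?B = ennreal B" "0 < B" using 4 by (cases ?B) (auto simp: less_le)
    let ?\<alpha> = "A powr (1 / q)" and ?\<beta> = "B powr (1 / q')"
    let ?u = "\<lambda>y. ennreal (1 / A) * ennpow (u y) q" and ?v = "\<lambda>y. ennreal (1 / B) * ennpow (v y) q'"
    have pt: "u y * v y \<le> ennreal (?\<alpha> * ?\<beta>) * (?u y + ?v y)" for y
    proof -
      have "(ennreal (1 / ?\<alpha>) * u y) * (ennreal (1 / ?\<beta>) * v y)
          \<le> ennpow (ennreal (1 / ?\<alpha>) * u y) q + ennpow (ennreal (1 / ?\<beta>) * v y) q'"
        by (rule young_ennreal [OF q])
      also have "\<dots> = ?u y + ?v y"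
        using A B q q' by (simp add: ennpow_mult powr_divide powr_powr)
      finally have "ennreal (?\<alpha> * ?\<beta>) * ((ennreal (1 / ?\<alpha>) * u y) * (ennreal (1 / ?\<beta>) * v y))
          \<le> ennreal (?\<alpha> * ?\<beta>) * (?u y + ?v y)" by (rule mult_left_mono) simp
      moreover have "ennreal (?\<alpha> * ?\<beta>) * ((ennreal (1 / ?\<alpha>) * u y) * (ennreal (1 / ?\<beta>) * v y)) = u y * v y"
      proof -
        have "ennreal (?\<alpha> * ?\<beta>) * (ennreal (1 / ?\<alpha>) * ennreal (1 / ?\<beta>)) = ennreal (?\<alpha> * ?\<beta> * (1 / ?\<alpha> * (1 / ?\<beta>)))"
          by (simp only: ennreal_mult [symmetric] mult_nonneg_nonneg powr_ge_zero zero_le_divide_1_iff)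
        also have "\<dots> = 1" using A B by simp
        finally have "ennreal (?\<alpha> * ?\<beta>) * (ennreal (1 / ?\<alpha>) * ennreal (1 / ?\<beta>)) * (u y * v y) = u y * v y" by simp
        then show ?thesis by (simp only: mult_ac)
      qed
      ultimately show ?thesis by simp
    qed
    have inv: "ennreal (1 / A) * ennreal A = 1" "ennreal (1 / B) * ennreal B = 1"
      using A B by (simp_all flip: ennreal_mult)
    have "set_mean S (\<lambda>y. u y * v y) \<le> set_mean S (\<lambda>y. ennreal (?\<alpha> * ?\<beta>) * (?u y + ?v y))"
      by (rule set_mean_mono) (rule pt)
    also have "\<dots> = ennreal (?\<alpha> * ?\<beta>) * (ennreal (1 / A) * ?A + ennreal (1 / B) * ?B)"
      using S(1) by (simp add: set_mean_cmult set_mean_add)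
    also have "\<dots> = ennreal (?\<alpha> * ?\<beta>) * 2" unfolding A(1) B(1) inv by simp
    finally have le: "set_mean S (\<lambda>y. u y * v y) \<le> ennreal (?\<alpha> * ?\<beta>) * 2" .
    have "(\<integral>\<^sup>+ y \<in> S. u y * v y \<partial>lebesgue) = set_mean S (\<lambda>y. u y * v y) * emeasure lebesgue S"
      by (rule set_mean_mult [symmetric, OF S(2,3)])
    also have "\<dots> \<le> ennreal (?\<alpha> * ?\<beta>) * 2 * emeasure lebesgue S" by (rule mult_right_mono [OF le]) simp
    also have "\<dots> = 2 * emeasure lebesgue S * (ennpow ?A (1 / q) * ennpow ?B (1 / q'))"
      using A B by (simp add: ennreal_mult mult_ac)
    finally show ?thesis .
  qed
qed

text \<open>The converse of Hoelder's inequality. Test against a multiple of \<open>G powr (p - s)\<close>; truncating \<open>G\<close>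
  first makes its modular \<open>I\<close> finite, so that the resulting bound for a power of \<open>I\<close> with
  positive exponent is one for \<open>I\<close>.\<close>

lemma modular_bound_by_duality:
  fixes G :: "'a::euclidean_space \<Rightarrow> ennreal"
  assumes Gm: "G \<in> borel_measurable lebesgue"
    and m: "p \<in> borel_measurable lebesgue" "s \<in> borel_measurable lebesgue" "t \<in> borel_measurable lebesgue"
    and p: "\<And>x. 0 < p x" "\<And>x. p x \<le> u" and s: "\<And>x. 0 < s x" and t: "\<And>x. p x - s x = p x / t x"
    and \<sigma>: "1 < \<sigma>" "\<And>x. \<sigma> \<le> t x" and C: "1 \<le> C"
    and test: "\<And>\<phi>. \<phi> \<in> borel_measurable lebesgue \<Longrightarrow> (\<integral>\<^sup>+ x. ennpow (\<phi> x) (t x) \<partial>lebesgue) \<le> 1 \<Longrightarrow>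
       (\<integral>\<^sup>+ x. ennpow (G x) (s x) * \<phi> x \<partial>lebesgue) \<le> ennreal C"
  shows "(\<integral>\<^sup>+ x. ennpow (G x) (p x) \<partial>lebesgue) \<le> ennreal (C powr (\<sigma> / (\<sigma> - 1)))"
proof -
  note [measurable] = Gm m
  define H where "H = (\<lambda>(m::nat) x. min (G x) (of_nat m) * indicator (ball 0 (real m)) x)"
  have ball: "ball 0 (real m) \<in> sets (lebesgue :: 'a measure)" for m by simp
  have Hm [measurable]: "H m \<in> borel_measurable lebesgue" for m
    unfolding H_def by (intro borel_measurable_times_ennreal borel_measurable_indicator ball) measurable
  have HG: "H m x \<le> G x" for m x by (auto simp: H_def split: split_indicator)
  have u: "0 \<le> u" using p[of 0] by linarith
  have bound: "(\<integral>\<^sup>+ x. ennpow (H m x) (p x) \<partial>lebesgue) \<le> ennreal (C powr (\<sigma> / (\<sigma> - 1)))" for m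
  proof -
    let ?I = "\<integral>\<^sup>+ x. ennpow (H m x) (p x) \<partial>lebesgue"
    have "?I \<le> (\<integral>\<^sup>+ x. ennreal (max 1 (real m) powr u) * indicator (ball (0::'a) (real m)) x \<partial>lebesgue)"
    proof (rule nn_integral_mono)
      fix x :: 'a
      show "ennpow (H m x) (p x) \<le> ennreal (max 1 (real m) powr u) * indicator (ball 0 (real m)) x"
      proof (cases "x \<in> ball 0 (real m)")
        case True
        then have "H m x \<le> ennreal (max 1 (real m))"
          by (auto simp: H_def ennreal_of_nat_eq_real_of_nat intro!: min.coboundedI2 ennreal_leI)
        then have "ennpow (H m x) (p x) \<le> ennpow (ennreal (max 1 (real m))) (p x)"
          using p(1)[of x] by (intro ennpow_mono) auto
        also have "\<dots> \<le> ennreal (max 1 (real m) powr u)"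
          using p(2)[of x] by (auto intro!: ennreal_leI powr_mono)
        finally show ?thesis using True by simp
      qed (simp add: H_def)
    qed
    also have "\<dots> = ennreal (max 1 (real m) powr u) * emeasure lebesgue (ball (0::'a) (real m))"
      by (rule nn_integral_cmult_indicator [OF ball])
    also have "\<dots> < top"
      using emeasure_lebesgue_ball_finite[of "0::'a" "real m"] by (simp add: ennreal_mult_less_top del: emeasure_completion)
    finally obtain I where I: "?I = ennreal I" "0 \<le> I" by (cases ?I) auto
    show ?thesis
    proof (cases "I \<le> 1")
      case True
      have "1 \<le> C powr (\<sigma> / (\<sigma> - 1))" using C \<sigma> by (intro ge_one_powr_ge_zero) auto
      then show ?thesis unfolding I(1) using True by (intro ennreal_leI) linarith
    next
      case False
      \<comment> \<open>As \<open>c \<le> 1\<close> and \<open>\<sigma> \<le> t\<close>, this factor makes the modular of the test function at most \<open>c powr \<sigma> * I = 1\<close>.\<close>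
      define c where "c = I powr (- 1 / \<sigma>)"
      have c: "0 < c" "c \<le> 1"
        unfolding c_def using False \<sigma> powr_mono[of "- 1 / \<sigma>" 0 I] by (auto split: if_splits)
      let ?\<phi> = "\<lambda>x. ennreal c * ennpow (H m x) (p x - s x)"
      have fm: "?\<phi> \<in> borel_measurable lebesgue" by measurable
      have "(\<integral>\<^sup>+ x. ennpow (?\<phi> x) (t x) \<partial>lebesgue) \<le> (\<integral>\<^sup>+ x. ennreal (c powr \<sigma>) * ennpow (H m x) (p x) \<partial>lebesgue)"
      proof (rule nn_integral_mono)
        fix x
        have "ennpow (?\<phi> x) (t x) = ennreal (c powr t x) * ennpow (H m x) (p x)"
          using c \<sigma>(1) \<sigma>(2)[of x] by (simp add: ennpow_mult ennpow_ennpow t)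
        also have "\<dots> \<le> ennreal (c powr \<sigma>) * ennpow (H m x) (p x)"
          using c \<sigma>(1) \<sigma>(2)[of x] by (intro mult_right_mono ennreal_leI powr_mono') auto
        finally show "ennpow (?\<phi> x) (t x) \<le> \<dots>" .
      qed
      also have "\<dots> = ennreal (c powr \<sigma>) * ennreal I"
        unfolding I(1) [symmetric] by (rule nn_integral_cmult) measurable
      also have "\<dots> = 1"
      proof -
        have "c powr \<sigma> = I powr (- 1 / \<sigma> * \<sigma>)" unfolding c_def by (rule powr_powr)
        also have "\<dots> = 1 / I" using False \<sigma>(1) by (simp add: powr_minus_divide)
        finally have "c powr \<sigma> * I = 1" using False by simp
        then show ?thesis using I(2) by (simp flip: ennreal_mult)
      qed
      finally have "(\<integral>\<^sup>+ x. ennpow (G x) (s x) * ?\<phi> x \<partial>lebesgue) \<le> ennreal C" by (rule test [OF fm])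
      moreover have "ennreal c * ennreal I \<le> (\<integral>\<^sup>+ x. ennpow (G x) (s x) * ?\<phi> x \<partial>lebesgue)"
      proof -
        have "ennreal c * ennreal I = (\<integral>\<^sup>+ x. ennreal c * ennpow (H m x) (p x) \<partial>lebesgue)"
          unfolding I(1) [symmetric] by (rule nn_integral_cmult [symmetric]) measurable
        also have "\<dots> \<le> (\<integral>\<^sup>+ x. ennpow (G x) (s x) * ?\<phi> x \<partial>lebesgue)"
        proof (rule nn_integral_mono)
          fix x
          have "ennpow (H m x) (s x + (p x - s x)) \<le> ennpow (G x) (s x) * ennpow (H m x) (p x - s x)"
            unfolding ennpow_add using s[of x] by (intro mult_right_mono ennpow_mono HG) auto
          then have "ennreal c * ennpow (H m x) (p x) \<le> ennreal c * (ennpow (G x) (s x) * ennpow (H m x) (p x - s x))"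
            by (intro mult_left_mono) auto
          then show "ennreal c * ennpow (H m x) (p x) \<le> ennpow (G x) (s x) * ?\<phi> x"
            by (simp only: mult.left_commute)
        qed
        finally show ?thesis .
      qed
      ultimately have "ennreal c * ennreal I \<le> ennreal C" by (rule order_trans [rotated])
      then have cI: "c * I \<le> C" using c C I by (simp add: ennreal_le_iff flip: ennreal_mult)
      have "c * I = I powr (- 1 / \<sigma>) * I powr 1" using False by (simp add: c_def)
      also have "\<dots> = I powr ((\<sigma> - 1) / \<sigma>)"
        using \<sigma>(1) by (simp only: powr_add [symmetric]) (simp add: field_simps)
      finally have "I powr ((\<sigma> - 1) / \<sigma>) \<le> C" using cI by simp
      then have "(I powr ((\<sigma> - 1) / \<sigma>)) powr (\<sigma> / (\<sigma> - 1)) \<le> C powr (\<sigma> / (\<sigma> - 1))"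
        using \<sigma>(1) by (intro powr_mono2) auto
      then have "I \<le> C powr (\<sigma> / (\<sigma> - 1))" using \<sigma>(1) False by (simp add: powr_powr)
      then show ?thesis unfolding I(1) by (rule ennreal_leI)
    qed
  qed
  have pt: "ennpow (G x) (p x) \<le> (SUP m. ennpow (H m x) (p x))" for x
  proof -
    have "\<exists>m. y < ennpow (H m x) (p x)" if y: "y < ennpow (G x) (p x)" for y
    proof (cases "G x")
      case (real v)
      obtain m :: nat where m: "max (norm x) v < real m" using reals_Archimedean2 by blast
      then have "G x \<le> of_nat m" using real by (simp add: ennreal_of_nat_eq_real_of_nat ennreal_leI)
      then have "H m x = G x" using m by (simp add: H_def min_absorb1)
      from y show ?thesis unfolding \<open>H m x = G x\<close> [symmetric] by (rule exI)
    next
      case top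
      with y obtain v where v: "y = ennreal v" "0 \<le> v" by (cases y) auto
      obtain m :: nat where m: "max (norm x) ((v + 1) powr (1 / p x)) < real m" using reals_Archimedean2 by blast
      have "H m x = ennreal (real m)" using m top by (simp add: H_def ennreal_of_nat_eq_real_of_nat)
      moreover have "v + 1 \<le> real m powr p x"
      proof -
        have "((v + 1) powr (1 / p x)) powr p x \<le> real m powr p x"
          using m p(1)[of x] by (intro powr_mono2) auto
        then show ?thesis using p(1)[of x] v by (simp add: powr_powr)
      qed
      ultimately have "y < ennpow (H m x) (p x)" using v by (simp add: ennreal_less_iff)
      then show ?thesis by blast
    qed
    then show ?thesis by (subst le_SUP_iff) auto
  qed
  have "(\<integral>\<^sup>+ x. ennpow (G x) (p x) \<partial>lebesgue) \<le> (\<integral>\<^sup>+ x. (SUP m. ennpow (H m x) (p x)) \<partial>lebesgue)"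
    by (rule nn_integral_mono) (rule pt)
  also have "\<dots> = (SUP m. \<integral>\<^sup>+ x. ennpow (H m x) (p x) \<partial>lebesgue)"
  proof (rule nn_integral_monotone_convergence_SUP)
    show "incseq (\<lambda>m x. ennpow (H m x) (p x))"
    proof (intro incseq_SucI le_funI)
      fix m x
      have "H m x \<le> H (Suc m) x"
        unfolding H_def by (intro mult_mono min.mono indicator_leI) auto
      then show "ennpow (H m x) (p x) \<le> ennpow (H (Suc m) x) (p x)"
        using p(1)[of x] by (intro ennpow_mono) auto
    qed
  qed measurable
  also have "\<dots> \<le> ennreal (C powr (\<sigma> / (\<sigma> - 1)))" by (intro SUP_least bound)
  finally show ?thesis .
qed

section \<open>The modular inequalities\<close>

lemma borel_measurable_sum_cubes:
  assumes "\<And>k. is_cube (Q k)"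
  shows "(\<lambda>x :: real ^ 'n. \<Sum>k. a k * indicator (Q k) x :: ennreal) \<in> borel_measurable lebesgue"
proof -
  have [measurable]: "Q k \<in> sets lebesgue" for k using cube_in_ball[OF assms, of k] by metis
  show ?thesis by measurable
qed

text \<open>The choice \<open>s = p\<close> in \<open>weighted_sum_bound\<close> leaves no power of \<open>G\<close> to be tested, so the test function is constant. All exponents that
  occur are functions of \<open>1 / p\<close>, which makes their log-Hoelder continuity easy to see.\<close>

lemma modular_bound_exponent_below_1:
  fixes p :: "real ^ 'n \<Rightarrow> real"
  assumes pm: "p \<in> borel_measurable lebesgue" and LH: "log_Hoelder p"
    and l: "0 < l" and p: "\<And>x. l \<le> p x" "\<And>x. p x \<le> u" and u: "u < 1"
  obtains K where "1 \<le> K"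
    "\<And>Q g. admissible Q g \<Longrightarrow>
       (\<integral>\<^sup>+ x. ennpow (\<Sum>k. cube_avg (Q k) (g k) * indicator (Q k) x) (p x) \<partial>lebesgue) \<le> 1 \<Longrightarrow>
       (\<integral>\<^sup>+ x. ennpow (\<Sum>k. ennreal (g k x)) (p x) \<partial>lebesgue) \<le> ennreal K"
proof -
  note [measurable] = pm
  have p01: "0 < p x" "p x < 1" for x using l u p[of x] by auto
  have u0: "0 < u" using l p[of 0] by linarith
  define w where "w = (\<lambda>x. p x / (1 - p x))"
  have wm: "w \<in> borel_measurable lebesgue" unfolding w_def by measurable
  have w: "l \<le> w x" "w x \<le> u / (1 - u)" for x
  proof -
    have "p x \<le> p x / (1 - p x)" using p01[of x] by (simp add: le_divide_eq mult_le_cancel_left1)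
    then show "l \<le> w x" unfolding w_def using p(1)[of x] by linarith
    show "w x \<le> u / (1 - u)" unfolding w_def using p01[of x] p(2)[of x] u u0 by (intro frac_le) auto
  qed
  have LHw: "log_Hoelder w"
  proof -
    have "log_Hoelder (\<lambda>x. 1 / p x - 1)"
      by (rule log_Hoelder_compose [OF log_Hoelder_reciprocal [OF LH l p(1)], where l = 0 and M = 1])
        (use p01 in \<open>auto simp: less_imp_le\<close>)
    then have "log_Hoelder (\<lambda>x. 1 / (1 / p x - 1))"
    proof (rule log_Hoelder_reciprocal)
      show "0 < 1 / u - 1" using u u0 by simp
      show "1 / u - 1 \<le> 1 / p x - 1" for x using p01[of x] p(2)[of x] by (simp add: frac_le)
    qed
    moreover have "1 / (1 / p x - 1) = w x" for x
      unfolding w_def using p01[of x] by (simp add: field_simps)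
    ultimately show ?thesis by simp
  qed
  from reciprocal_controlled_majorant[OF wm LHw l w]
  obtain C where C: "0 < C"
    "\<And>h. h \<in> borel_measurable lebesgue \<Longrightarrow> (\<integral>\<^sup>+ x. ennpow (h x) (w x) \<partial>lebesgue) \<le> 1 \<Longrightarrow>
       \<exists>V. V \<in> borel_measurable lebesgue \<and> (\<forall>x. h x \<le> V x) \<and>
         (\<forall>Q x. is_cube Q \<longrightarrow> x \<in> Q \<longrightarrow> inverse (V x) * emeasure lebesgue Q
            \<le> ennreal C * (\<integral>\<^sup>+ y \<in> Q. inverse (V y) \<partial>lebesgue)) \<and>
         (\<integral>\<^sup>+ x. ennpow (V x) (w x) \<partial>lebesgue) \<le> ennreal C" by blast
  show thesis
  proof (rule that [of "max 1 (C + C)"])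
    fix Q and g :: "nat \<Rightarrow> real ^ 'n \<Rightarrow> real"
    assume adm: "admissible Q g"
    define a where "a = (\<lambda>k. cube_avg (Q k) (g k))"
    define F where "F = (\<lambda>x. \<Sum>k. a k * indicator (Q k) x)"
    assume "(\<integral>\<^sup>+ x. ennpow (\<Sum>k. cube_avg (Q k) (g k) * indicator (Q k) x) (p x) \<partial>lebesgue) \<le> 1"
    then have F1: "(\<integral>\<^sup>+ x. ennpow (F x) (p x) \<partial>lebesgue) \<le> 1" by (simp add: F_def a_def)
    have cube: "is_cube (Q k)" for k using adm by (simp add: admissible_def)
    have gm [measurable]: "g k \<in> borel_measurable lebesgue" for k using adm by (simp add: admissible_def)
    have gQ: "ennreal (g k x) = 0" if "x \<notin> Q k" for k x using adm that by (auto simp: admissible_def)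
    have Q: "Q k \<in> sets lebesgue" "0 < emeasure lebesgue (Q k)" "emeasure lebesgue (Q k) < top" for k
      using cube_in_ball[OF cube, of k] by metis+
    have Fm [measurable]: "F \<in> borel_measurable lebesgue"
      unfolding F_def by (rule borel_measurable_sum_cubes [OF cube])
    have hm: "(\<lambda>x. ennpow (F x) (1 - p x)) \<in> borel_measurable lebesgue" by measurable
    have "(\<integral>\<^sup>+ x. ennpow (ennpow (F x) (1 - p x)) (w x) \<partial>lebesgue) \<le> 1"
    proof -
      have "(1 - p x) * w x = p x" for x using p01[of x] by (simp add: w_def)
      with F1 show ?thesis by (simp add: ennpow_ennpow)
    qed
    from C(2)[OF hm this] obtain V where V: "V \<in> borel_measurable lebesgue"
      "\<And>x. ennpow (F x) (1 - p x) \<le> V x"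
      "\<And>Q x. is_cube Q \<Longrightarrow> x \<in> Q \<Longrightarrow> inverse (V x) * emeasure lebesgue Q
            \<le> ennreal C * (\<integral>\<^sup>+ y \<in> Q. inverse (V y) \<partial>lebesgue)"
      "(\<integral>\<^sup>+ x. ennpow (V x) (w x) \<partial>lebesgue) \<le> ennreal C" by blast
    have "(\<integral>\<^sup>+ x. ennpow (\<Sum>k. ennreal (g k x)) (p x) * 1 \<partial>lebesgue)
       \<le> ennreal C * 1 * (\<integral>\<^sup>+ x. ennpow (\<Sum>k. a k * indicator (Q k) x) (p x) * 1 \<partial>lebesgue)
         + (\<integral>\<^sup>+ x. ennpow (V x) (p x / (1 - p x)) * 1 \<partial>lebesgue)"
    proof (rule weighted_sum_bound [OF Q _ _ pm p01 V(1) _ V(3) borel_measurable_const borel_measurable_const])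
      show "(\<lambda>x. ennreal (g k x)) \<in> borel_measurable lebesgue" for k by measurable
      show "x \<notin> Q k \<Longrightarrow> ennreal (g k x) = 0" for k x by (rule gQ)
      show "ennpow (\<Sum>k. a k * indicator (Q k) x) (1 - p x) \<le> V x" for x using V(2)[of x] by (simp add: F_def)
      fix k x
      have "(\<integral>\<^sup>+ y. ennreal (g k y) * 1 \<partial>lebesgue) = (\<integral>\<^sup>+ y \<in> Q k. ennreal (g k y) \<partial>lebesgue)"
        by (rule nn_integral_cong) (auto simp: gQ split: split_indicator)
      also have "\<dots> = a k * emeasure lebesgue (Q k)"
        using set_mean_mult[OF Q(2,3), of k "\<lambda>y. ennreal (g k y)"] by (simp add: a_def cube_avg_def set_mean_def)
      finally show "(\<integral>\<^sup>+ y. ennreal (g k y) * 1 \<partial>lebesgue) \<le> 1 * a k * emeasure lebesgue (Q k) * 1" by simp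
    qed (simp_all add: cube)
    then have "(\<integral>\<^sup>+ x. ennpow (\<Sum>k. ennreal (g k x)) (p x) \<partial>lebesgue)
       \<le> ennreal C * (\<integral>\<^sup>+ x. ennpow (F x) (p x) \<partial>lebesgue) + (\<integral>\<^sup>+ x. ennpow (V x) (w x) \<partial>lebesgue)"
      by (simp add: F_def w_def)
    also have "\<dots> \<le> ennreal C * 1 + ennreal C"
      by (intro add_mono mult_left_mono F1 V(4)) simp
    also have "\<dots> \<le> ennreal (max 1 (C + C))"
      using C(1) by (simp flip: ennreal_plus add: ennreal_leI)
    finally show "(\<integral>\<^sup>+ x. ennpow (\<Sum>k. ennreal (g k x)) (p x) \<partial>lebesgue) \<le> ennreal (max 1 (C + C))" .
  qed simp
qed

text \<open>Two exponents balance the requirements: \<open>s\<close> has to stay below 1, and the quotient \<open>p / s\<close> has to lie strictly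
  between 1 and \<open>q\<close>, so that the maximal operator can be applied to \<open>q'\<close>-th powers of test
  functions in the space with exponent \<open>t\<close>, the conjugate of \<open>p / s\<close>. A constant
  \<open>s\<close> would have to be smaller than the infimum of \<open>p\<close>; the variable choice below
  makes \<open>p / s\<close> equal to \<open>\<kappa> * max (p x) 1\<close> with \<open>\<kappa>\<close> close to 1.\<close>

lemma modular_bound_power_means:
  fixes p :: "real ^ 'n \<Rightarrow> real"
  assumes pm: "p \<in> borel_measurable lebesgue" and LH: "log_Hoelder p"
    and l: "0 < l" and p: "\<And>x. l \<le> p x" "\<And>x. p x \<le> u" and q: "1 < q" "u < q"
  obtains K where "1 \<le> K"
    "\<And>Q g. admissible Q g \<Longrightarrow>
       (\<integral>\<^sup>+ x. ennpow (\<Sum>k. ennpow (cube_avg (Q k) (\<lambda>y. g k y powr q)) (1 / q) * indicator (Q k) x) (p x) \<partial>lebesgue) \<le> 1 \<Longrightarrow>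
       (\<integral>\<^sup>+ x. ennpow (\<Sum>k. ennreal (g k x)) (p x) \<partial>lebesgue) \<le> ennreal K"
proof -
  note [measurable] = pm
  have p0: "0 < p x" for x using l p(1)[of x] by linarith
  have u0: "0 < u" using p0[of 0] p(2)[of 0] by linarith
  define m where "m = max u 1"
  have m: "1 \<le> m" "m < q" "u \<le> m" using q by (auto simp: m_def)
  then have "1 < q / m" by simp
  then obtain \<kappa> where \<kappa>: "1 < \<kappa>" "\<kappa> < q / m" using dense by blast
  have \<kappa>m: "1 < \<kappa> * m" "\<kappa> * m < q"
    using \<kappa> m mult_less_le_imp_less[of 1 \<kappa> 1 m] by (auto simp: less_divide_eq)
  define q' where "q' = q / (q - 1)"
  have q': "1 < q'" "1 / q + 1 / q' = 1" using q(1) by (auto simp: q'_def field_simps)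
  define \<sigma> where "\<sigma> = \<kappa> * m / (\<kappa> * m - 1)"
  have \<sigma>: "1 < \<sigma>" using \<kappa>m by (simp add: \<sigma>_def)
  have q\<sigma>: "q' < \<sigma>"
    unfolding q'_def \<sigma>_def using \<kappa>m q(1) by (simp add: divide_less_eq less_divide_eq algebra_simps)
  define \<rho> where "\<rho> = (\<lambda>x. \<kappa> * max (p x) 1)"
  have \<rho>: "\<kappa> \<le> \<rho> x" "1 < \<rho> x" "\<rho> x \<le> \<kappa> * m" for x
  proof -
    show "\<kappa> \<le> \<rho> x" using \<kappa> by (simp add: \<rho>_def mult_le_cancel_left1)
    then show "1 < \<rho> x" using \<kappa> by linarith
    show "\<rho> x \<le> \<kappa> * m" unfolding \<rho>_def m_def using \<kappa> p(2)[of x] by (intro mult_left_mono) auto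
  qed
  define s where "s = (\<lambda>x. p x / \<rho> x)"
  define t where "t = (\<lambda>x. \<rho> x / (\<rho> x - 1))"
  define w where "w = (\<lambda>x. p x / (1 - s x))"
  have \<rho>m [measurable]: "\<rho> \<in> borel_measurable lebesgue" unfolding \<rho>_def by measurable
  have sm [measurable]: "s \<in> borel_measurable lebesgue" unfolding s_def by measurable
  have tm [measurable]: "t \<in> borel_measurable lebesgue" unfolding t_def by measurable
  have wm [measurable]: "w \<in> borel_measurable lebesgue" unfolding w_def by measurable
  have s: "0 < s x" "s x < 1" "s x \<le> 1 / \<kappa>" for x
  proof -
    show "0 < s x" unfolding s_def using p0[of x] \<rho>(2)[of x] by simp
    have "p x \<le> \<rho> x / \<kappa>" using \<kappa> by (simp add: \<rho>_def)
    then show "s x \<le> 1 / \<kappa>" unfolding s_def using \<rho>(2)[of x] \<kappa> by (simp add: field_simps)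
    moreover have "1 / \<kappa> < 1" using \<kappa> by simp
    ultimately show "s x < 1" by linarith
  qed
  have t\<rho>: "1 / \<rho> x + 1 / t x = 1" for x using \<rho>(2)[of x] by (simp add: t_def field_simps)
  have t: "\<sigma> \<le> t x" "t x \<le> \<kappa> / (\<kappa> - 1)" for x
  proof -
    have conj: "v / (v - 1) = 1 + 1 / (v - 1)" if "1 < v" for v :: real using that by (simp add: field_simps)
    show "\<sigma> \<le> t x" unfolding \<sigma>_def t_def conj[OF \<kappa>m(1)] conj[OF \<rho>(2)]
      using \<rho>(2,3)[of x] by (intro add_left_mono divide_left_mono) auto
    show "t x \<le> \<kappa> / (\<kappa> - 1)" unfolding t_def conj[OF \<kappa>(1)] conj[OF \<rho>(2)]
      using \<rho>(1)[of x] \<kappa> by (intro add_left_mono divide_left_mono) auto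
  qed
  have s\<rho>: "s x * \<rho> x = p x" for x using \<rho>(2)[of x] by (simp add: s_def)
  have pst: "p x - s x = p x / t x" for x
  proof -
    have "p x / t x = p x * (1 - 1 / \<rho> x)" using t\<rho>[of x] by (simp add: eq_diff_eq[symmetric] flip: times_divide_eq_right) (simp add: divide_inverse)
    then show ?thesis by (simp add: s_def algebra_simps)
  qed
  \<comment> \<open>The reciprocals of all exponents are Lipschitz functions of \<open>1 / p\<close>.\<close>
  have LHr: "log_Hoelder (\<lambda>x. 1 / p x)" by (rule log_Hoelder_reciprocal [OF LH l p(1)])
  have rp: "0 \<le> 1 / p x" for x using p0[of x] by simp
  have \<rho>r: "1 / \<rho> x = min (1 / p x) 1 / \<kappa>" for x
    using p0[of x] \<kappa> by (auto simp: \<rho>_def min_def max_def field_simps)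
  have min_lip: "\<bar>min a 1 / \<kappa> - min b 1 / \<kappa>\<bar> \<le> \<bar>a - b\<bar>" for a b
  proof -
    have "\<bar>min a 1 / \<kappa> - min b 1 / \<kappa>\<bar> = \<bar>min a 1 - min b 1\<bar> / \<kappa>"
      using \<kappa> by (simp add: abs_divide flip: diff_divide_distrib)
    also have "\<dots> \<le> \<bar>min a 1 - min b 1\<bar>" using \<kappa> by (simp add: divide_le_eq mult_le_cancel_left1)
    also have "\<dots> \<le> \<bar>a - b\<bar>" by auto
    finally show ?thesis .
  qed
  have LHt: "log_Hoelder t"
  proof -
    have "log_Hoelder (\<lambda>x. 1 - min (1 / p x) 1 / \<kappa>)"
      by (rule log_Hoelder_compose [OF LHr rp, where M = 1])
        (use min_lip in \<open>auto simp: abs_minus_commute\<close>)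
    then have "log_Hoelder (\<lambda>x. 1 / (1 - min (1 / p x) 1 / \<kappa>))"
    proof (rule log_Hoelder_reciprocal)
      show "0 < 1 - 1 / \<kappa>" using \<kappa> by simp
      show "1 - 1 / \<kappa> \<le> 1 - min (1 / p x) 1 / \<kappa>" for x using \<kappa> by (simp add: divide_right_mono)
    qed
    moreover have "1 / (1 - min (1 / p x) 1 / \<kappa>) = t x" for x
      unfolding \<rho>r[symmetric] t_def using \<rho>(2)[of x] by (simp add: field_simps)
    ultimately show ?thesis by simp
  qed
  have w: "l \<le> w x" "w x \<le> u / (1 - 1 / \<kappa>)" for x
  proof -
    have "p x \<le> p x / (1 - s x)" using p0[of x] s[of x] by (simp add: le_divide_eq mult_le_cancel_left1)
    then show "l \<le> w x" unfolding w_def using p(1)[of x] by linarith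
    show "w x \<le> u / (1 - 1 / \<kappa>)" unfolding w_def using p(2)[of x] u0 s(3)[of x] \<kappa> by (intro frac_le) auto
  qed
  have LHw: "log_Hoelder w"
  proof -
    have "log_Hoelder (\<lambda>x. 1 / p x - min (1 / p x) 1 / \<kappa>)"
    proof (rule log_Hoelder_compose [OF LHr rp, where M = 2])
      show "\<bar>(a - min a 1 / \<kappa>) - (b - min b 1 / \<kappa>)\<bar> \<le> 2 * \<bar>a - b\<bar>" for a b
      proof -
        have "\<bar>(a - v) - (b - w)\<bar> \<le> 2 * \<bar>a - b\<bar>" if "\<bar>v - w\<bar> \<le> \<bar>a - b\<bar>" for v w :: real
        proof -
          have "\<bar>(a - v) - (b - w)\<bar> = \<bar>(a - b) - (v - w)\<bar>"
            by (rule arg_cong [where f = abs]) simp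
          also have "\<dots> \<le> \<bar>a - b\<bar> + \<bar>v - w\<bar>" by (rule abs_triangle_ineq4)
          also have "\<dots> \<le> 2 * \<bar>a - b\<bar>" using add_left_mono[OF that, of "\<bar>a - b\<bar>"] by simp
          finally show ?thesis .
        qed
        from this[OF min_lip] show ?thesis .
      qed
    qed simp
    moreover have eq: "1 / p x - min (1 / p x) 1 / \<kappa> = 1 / w x" for x
      unfolding \<rho>r[symmetric] w_def s_def using p0[of x] by (simp add: diff_divide_distrib)
    ultimately have "log_Hoelder (\<lambda>x. 1 / w x)" by simp
    then have "log_Hoelder (\<lambda>x. 1 / (1 / w x))"
    proof (rule log_Hoelder_reciprocal)
      show "0 < 1 / (u / (1 - 1 / \<kappa>))" using u0 \<kappa> by simp
      show "1 / (u / (1 - 1 / \<kappa>)) \<le> 1 / w x" for x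
      proof -
        have "0 < w x" "0 < u / (1 - 1 / \<kappa>)" using w(1)[of x] l u0 \<kappa> by auto
        then show ?thesis using w(2)[of x] by (intro divide_left_mono mult_pos_pos) auto
      qed
    qed
    then show ?thesis by simp
  qed
  from reciprocal_controlled_majorant[OF wm LHw l w]
  obtain C where C: "0 < C"
    "\<And>h. h \<in> borel_measurable lebesgue \<Longrightarrow> (\<integral>\<^sup>+ x. ennpow (h x) (w x) \<partial>lebesgue) \<le> 1 \<Longrightarrow>
       \<exists>V. V \<in> borel_measurable lebesgue \<and> (\<forall>x. h x \<le> V x) \<and>
         (\<forall>Q x. is_cube Q \<longrightarrow> x \<in> Q \<longrightarrow> inverse (V x) * emeasure lebesgue Q
            \<le> ennreal C * (\<integral>\<^sup>+ y \<in> Q. inverse (V y) \<partial>lebesgue)) \<and>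
         (\<integral>\<^sup>+ x. ennpow (V x) (w x) \<partial>lebesgue) \<le> ennreal C" by blast
  have tq: "\<sigma> / q' \<le> t x / q'" "t x / q' \<le> \<kappa> / (\<kappa> - 1) / q'" for x
    using q'(1) by (intro divide_right_mono t; simp)+
  have LHtq: "log_Hoelder (\<lambda>x. t x / q')"
    by (rule log_Hoelder_compose [OF LHt t(1), where M = "1 / q'"])
      (use q'(1) in \<open>auto simp: abs_divide simp flip: diff_divide_distrib\<close>)
  have tqm: "(\<lambda>x. t x / q') \<in> borel_measurable lebesgue" by measurable
  have "1 < \<sigma> / q'" using q\<sigma> q'(1) by simp
  from maximal_modular_bounded[OF tqm LHtq this tq]
  obtain M where M: "0 < M"
    "\<And>f. f \<in> borel_measurable lebesgue \<Longrightarrow> (\<integral>\<^sup>+ x. ennpow (f x) (t x / q') \<partial>lebesgue) \<le> 1 \<Longrightarrow>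
       (\<integral>\<^sup>+ x. ennpow (maximal f x) (t x / q') \<partial>lebesgue) \<le> ennreal M" by blast
  define D where "D = cube_constant TYPE('n)"
  have D: "1 \<le> D" unfolding D_def by (rule cube_constant_ge_1)
  define c where "c = 2 * D powr (1 / q')"
  have c: "0 < c" using D by (simp add: c_def)
  define N where "N = max 1 (C * c * (1 + M) + (C + 1))"
  show thesis
  proof (rule that [of "N powr (\<sigma> / (\<sigma> - 1))"])
    show "1 \<le> N powr (\<sigma> / (\<sigma> - 1))" using \<sigma> by (intro ge_one_powr_ge_zero) (auto simp: N_def)
    fix Q and g :: "nat \<Rightarrow> real ^ 'n \<Rightarrow> real"
    assume adm: "admissible Q g"
    define a where "a = (\<lambda>k. ennpow (cube_avg (Q k) (\<lambda>y. g k y powr q)) (1 / q))"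
    define F where "F = (\<lambda>x. \<Sum>k. a k * indicator (Q k) x)"
    assume "(\<integral>\<^sup>+ x. ennpow (\<Sum>k. ennpow (cube_avg (Q k) (\<lambda>y. g k y powr q)) (1 / q) * indicator (Q k) x) (p x) \<partial>lebesgue) \<le> 1"
    then have F1: "(\<integral>\<^sup>+ x. ennpow (F x) (p x) \<partial>lebesgue) \<le> 1" by (simp add: F_def a_def)
    have cube: "is_cube (Q k)" for k using adm by (simp add: admissible_def)
    have gm [measurable]: "g k \<in> borel_measurable lebesgue" for k using adm by (simp add: admissible_def)
    have g0: "0 \<le> g k x" for k x using adm by (simp add: admissible_def)
    have gQ: "ennreal (g k x) = 0" if "x \<notin> Q k" for k x using adm that by (auto simp: admissible_def)
    have Q: "Q k \<in> sets lebesgue" "0 < emeasure lebesgue (Q k)" "emeasure lebesgue (Q k) < top" for k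
      using cube_in_ball[OF cube, of k] by metis+
    have gm': "(\<lambda>x. ennreal (g k x)) \<in> borel_measurable lebesgue" for k by measurable
    have Fm [measurable]: "F \<in> borel_measurable lebesgue"
      unfolding F_def by (rule borel_measurable_sum_cubes [OF cube])
    have hm: "(\<lambda>x. ennpow (F x) (1 - s x)) \<in> borel_measurable lebesgue" by measurable
    have "(\<integral>\<^sup>+ x. ennpow (ennpow (F x) (1 - s x)) (w x) \<partial>lebesgue) \<le> 1"
    proof -
      have "(1 - s x) * w x = p x" for x using s(2)[of x] by (simp add: w_def)
      with F1 show ?thesis by (simp add: ennpow_ennpow)
    qed
    from C(2)[OF hm this] obtain V where V: "V \<in> borel_measurable lebesgue"
      "\<And>x. ennpow (F x) (1 - s x) \<le> V x"
      "\<And>Q x. is_cube Q \<Longrightarrow> x \<in> Q \<Longrightarrow> inverse (V x) * emeasure lebesgue Q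
            \<le> ennreal C * (\<integral>\<^sup>+ y \<in> Q. inverse (V y) \<partial>lebesgue)"
      "(\<integral>\<^sup>+ x. ennpow (V x) (w x) \<partial>lebesgue) \<le> ennreal C" by blast
    note [measurable] = V(1)
    show "(\<integral>\<^sup>+ x. ennpow (\<Sum>k. ennreal (g k x)) (p x) \<partial>lebesgue) \<le> ennreal (N powr (\<sigma> / (\<sigma> - 1)))"
    proof (rule modular_bound_by_duality [OF _ pm sm tm p0 p(2) s(1) pst \<sigma> t(1)])
      show "(\<lambda>x. \<Sum>k. ennreal (g k x)) \<in> borel_measurable lebesgue" by measurable
      show "1 \<le> N" by (simp add: N_def)
      fix \<phi> :: "real ^ 'n \<Rightarrow> ennreal"
      assume fm [measurable]: "\<phi> \<in> borel_measurable lebesgue"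
        and f1: "(\<integral>\<^sup>+ x. ennpow (\<phi> x) (t x) \<partial>lebesgue) \<le> 1"
      let ?f = "\<lambda>x. ennpow (\<phi> x) q'"
      let ?\<Phi> = "\<lambda>x. ennpow (maximal ?f x) (1 / q')"
      have ffm: "?f \<in> borel_measurable lebesgue" by measurable
      have \<Phi>m [measurable]: "?\<Phi> \<in> borel_measurable lebesgue"
        by (intro borel_measurable_ennpow borel_measurable_maximal ffm borel_measurable_const)
      have "(\<integral>\<^sup>+ x. ennpow (?f x) (t x / q') \<partial>lebesgue) \<le> 1" using f1 q'(1) by (simp add: ennpow_ennpow)
      from M(2)[OF ffm this] have \<Phi>1: "(\<integral>\<^sup>+ x. ennpow (?\<Phi> x) (t x) \<partial>lebesgue) \<le> ennreal M"
        by (simp add: ennpow_ennpow)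
      have avg: "(\<integral>\<^sup>+ y. ennreal (g k y) * \<phi> y \<partial>lebesgue) \<le> ennreal c * a k * emeasure lebesgue (Q k) * ?\<Phi> x"
        if x: "x \<in> Q k" for k x
      proof -
        from cube_in_ball[OF cube, of k] obtain b R where R: "0 < R" "Q k \<subseteq> ball b R"
          "emeasure lebesgue (ball b R) \<le> ennreal D * emeasure lebesgue (Q k)" unfolding D_def by metis
        have "(\<integral>\<^sup>+ y \<in> Q k. ?f y \<partial>lebesgue) \<le> (\<integral>\<^sup>+ y \<in> ball b R. ?f y \<partial>lebesgue)"
          by (rule nn_set_integral_set_mono [OF R(2)])
        also have "\<dots> = set_mean (ball b R) ?f * emeasure lebesgue (ball b R)"
          by (rule set_mean_mult [symmetric, OF emeasure_lebesgue_ball_pos [OF R(1)] emeasure_lebesgue_ball_finite])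
        also have "\<dots> \<le> maximal ?f x * (ennreal D * emeasure lebesgue (Q k))"
          using x R by (intro mult_mono set_mean_le_maximal) auto
        finally have "set_mean (Q k) ?f \<le> ennreal D * maximal ?f x"
          unfolding set_mean_le_iff[OF Q(2,3)] by (simp only: mult_ac)
        then have "ennpow (set_mean (Q k) ?f) (1 / q') \<le> ennpow (ennreal D * maximal ?f x) (1 / q')"
          using q'(1) by (intro ennpow_mono) auto
        also have "\<dots> = ennreal (D powr (1 / q')) * ?\<Phi> x" using D by (simp add: ennpow_mult)
        finally have mean: "ennpow (set_mean (Q k) ?f) (1 / q') \<le> ennreal (D powr (1 / q')) * ?\<Phi> x" .
        have ak: "ennpow (set_mean (Q k) (\<lambda>y. ennpow (ennreal (g k y)) q)) (1 / q) = a k"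
          using g0 by (simp add: a_def cube_avg_def set_mean_def)
        have "(\<integral>\<^sup>+ y. ennreal (g k y) * \<phi> y \<partial>lebesgue) = (\<integral>\<^sup>+ y \<in> Q k. ennreal (g k y) * \<phi> y \<partial>lebesgue)"
          by (rule nn_integral_cong) (auto simp: gQ split: split_indicator)
        also have "\<dots> \<le> 2 * emeasure lebesgue (Q k) * (a k * ennpow (set_mean (Q k) ?f) (1 / q'))"
          using nn_integral_mult_le_means[OF Q gm' fm q(1) q'(2), of k k] unfolding ak .
        also have "\<dots> \<le> 2 * emeasure lebesgue (Q k) * (a k * (ennreal (D powr (1 / q')) * ?\<Phi> x))"
          by (intro mult_left_mono mean) auto
        also have "\<dots> = (2 * ennreal (D powr (1 / q'))) * a k * emeasure lebesgue (Q k) * ?\<Phi> x"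
          by (simp only: mult_ac)
        also have "2 * ennreal (D powr (1 / q')) = ennreal c" using ennreal_mult[of 2 "D powr (1 / q')"] by (simp add: c_def)
        finally show ?thesis .
      qed
      have "(\<integral>\<^sup>+ x. ennpow (\<Sum>k. ennreal (g k x)) (s x) * \<phi> x \<partial>lebesgue)
         \<le> ennreal C * ennreal c * (\<integral>\<^sup>+ x. ennpow (\<Sum>k. a k * indicator (Q k) x) (s x) * ?\<Phi> x \<partial>lebesgue)
           + (\<integral>\<^sup>+ x. ennpow (V x) (s x / (1 - s x)) * \<phi> x \<partial>lebesgue)"
        by (rule weighted_sum_bound [OF Q gm' gQ sm s(1,2) V(1) V(2)[unfolded F_def] V(3)[OF cube] fm \<Phi>m avg])
      also have "\<dots> = ennreal (C * c) * (\<integral>\<^sup>+ x. ennpow (F x) (s x) * ?\<Phi> x \<partial>lebesgue)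
           + (\<integral>\<^sup>+ x. ennpow (V x) (s x / (1 - s x)) * \<phi> x \<partial>lebesgue)"
        using C(1) c by (simp add: F_def ennreal_mult)
      also have "\<dots> \<le> ennreal (C * c) * (1 + ennreal M) + (ennreal C + 1)"
      proof (intro add_mono mult_left_mono)
        have "(\<integral>\<^sup>+ x. ennpow (F x) (s x) * ?\<Phi> x \<partial>lebesgue)
            \<le> (\<integral>\<^sup>+ x. ennpow (F x) (p x) + ennpow (?\<Phi> x) (t x) \<partial>lebesgue)"
        proof (rule nn_integral_mono)
          fix x
          show "ennpow (F x) (s x) * ?\<Phi> x \<le> ennpow (F x) (p x) + ennpow (?\<Phi> x) (t x)"
            using young_ennreal[OF \<rho>(2)[of x] t\<rho>[of x], of "ennpow (F x) (s x)" "?\<Phi> x"] by (simp only: ennpow_ennpow s\<rho>)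
        qed
        also have "\<dots> = (\<integral>\<^sup>+ x. ennpow (F x) (p x) \<partial>lebesgue) + (\<integral>\<^sup>+ x. ennpow (?\<Phi> x) (t x) \<partial>lebesgue)"
          by (rule nn_integral_add) measurable
        also have "\<dots> \<le> 1 + ennreal M" by (intro add_mono F1 \<Phi>1)
        finally show "(\<integral>\<^sup>+ x. ennpow (F x) (s x) * ?\<Phi> x \<partial>lebesgue) \<le> 1 + ennreal M" .
        have "(\<integral>\<^sup>+ x. ennpow (V x) (s x / (1 - s x)) * \<phi> x \<partial>lebesgue)
            \<le> (\<integral>\<^sup>+ x. ennpow (V x) (w x) + ennpow (\<phi> x) (t x) \<partial>lebesgue)"
        proof (rule nn_integral_mono)
          fix x
          have "s x / (1 - s x) * \<rho> x = w x" using s\<rho>[of x] by (simp add: w_def)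
          then show "ennpow (V x) (s x / (1 - s x)) * \<phi> x \<le> ennpow (V x) (w x) + ennpow (\<phi> x) (t x)"
            using young_ennreal[OF \<rho>(2)[of x] t\<rho>[of x], of "ennpow (V x) (s x / (1 - s x))" "\<phi> x"] by (simp only: ennpow_ennpow)
        qed
        also have "\<dots> = (\<integral>\<^sup>+ x. ennpow (V x) (w x) \<partial>lebesgue) + (\<integral>\<^sup>+ x. ennpow (\<phi> x) (t x) \<partial>lebesgue)"
          by (rule nn_integral_add) measurable
        also have "\<dots> \<le> ennreal C + 1" by (intro add_mono V(4) f1)
        finally show "(\<integral>\<^sup>+ x. ennpow (V x) (s x / (1 - s x)) * \<phi> x \<partial>lebesgue) \<le> ennreal C + 1" .
      qed simp
      also have "\<dots> = ennreal (C * c * (1 + M) + (C + 1))"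
        using C(1) c M(1) by (simp add: ennreal_mult ennreal_plus)
      also have "\<dots> \<le> ennreal N" unfolding N_def by (intro ennreal_leI) simp
      finally show "(\<integral>\<^sup>+ x. ennpow (\<Sum>k. ennreal (g k x)) (s x) * \<phi> x \<partial>lebesgue) \<le> ennreal N" .
    qed
  qed
qed

section \<open>From modulars to norms\<close>

text \<open>Since \<open>p\<close> is at least \<open>l\<close>, division of a function by \<open>K powr (1 / l)\<close> divides its modular by \<open>K\<close>
  at least.\<close>

lemma Lp_var_norm_le_of_modular:
  assumes l: "0 < l" and p: "\<And>x. l \<le> p x" and pm: "p \<in> borel_measurable lebesgue" and K: "1 \<le> K"
    and Gm: "G \<in> borel_measurable lebesgue"
    and mod: "\<And>lam. 0 < lam \<Longrightarrow> (\<integral>\<^sup>+ x. ennpow (F x / ennreal lam) (p x) \<partial>lebesgue) \<le> 1 \<Longrightarrow>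
       (\<integral>\<^sup>+ x. ennpow (G x / ennreal lam) (p x) \<partial>lebesgue) \<le> ennreal K"
  shows "Lp_var_norm p G \<le> ennreal (K powr (1 / l)) * Lp_var_norm p F"
proof -
  note [measurable] = pm Gm
  define C where "C = K powr (1 / l)"
  have C: "1 \<le> C" unfolding C_def using K l by (intro ge_one_powr_ge_zero) auto
  have step: "Lp_var_norm p G \<le> ennreal C * ennreal lam"
    if lam: "0 < lam" and int: "(\<integral>\<^sup>+ x. ennpow (F x / ennreal lam) (p x) \<partial>lebesgue) \<le> 1" for lam
  proof -
    have "(\<integral>\<^sup>+ x. ennpow (G x / ennreal (C * lam)) (p x) \<partial>lebesgue)
        \<le> (\<integral>\<^sup>+ x. ennreal (1 / K) * ennpow (G x / ennreal lam) (p x) \<partial>lebesgue)"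
    proof (rule nn_integral_mono)
      fix x
      have "inverse (ennreal (C * lam)) = ennreal (1 / C) * inverse (ennreal lam)"
        using C lam by (simp add: inverse_ennreal field_simps flip: ennreal_mult)
      then have "G x / ennreal (C * lam) = ennreal (1 / C) * (G x / ennreal lam)"
        by (simp only: divide_ennreal_def mult_ac)
      then have "ennpow (G x / ennreal (C * lam)) (p x) = ennreal ((1 / C) powr p x) * ennpow (G x / ennreal lam) (p x)"
        using C by (simp add: ennpow_mult)
      also have "(1 / C) powr p x \<le> (1 / C) powr l" using C p[of x] l by (intro powr_mono') auto
      also have "(1 / C) powr l = 1 / K" using K l by (simp add: C_def powr_divide powr_powr)
      finally show "ennpow (G x / ennreal (C * lam)) (p x) \<le> ennreal (1 / K) * ennpow (G x / ennreal lam) (p x)"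
        by (simp add: ennreal_leI mult_right_mono)
    qed
    also have "\<dots> = ennreal (1 / K) * (\<integral>\<^sup>+ x. ennpow (G x / ennreal lam) (p x) \<partial>lebesgue)"
      by (rule nn_integral_cmult) measurable
    also have "\<dots> \<le> ennreal (1 / K) * ennreal K" by (intro mult_left_mono mod lam int) auto
    also have "\<dots> = 1" using K by (simp flip: ennreal_mult)
    finally have "(\<integral>\<^sup>+ x. ennpow (G x / ennreal (C * lam)) (p x) \<partial>lebesgue) \<le> 1" .
    then have "Lp_var_norm p G \<le> ennreal (C * lam)"
      unfolding Lp_var_norm_def using C lam by (intro Inf_lower) auto
    also have "\<dots> = ennreal C * ennreal lam" using C lam by (intro ennreal_mult) auto
    finally show ?thesis .
  qed
  have C0: "ennreal C \<noteq> 0" "ennreal C \<noteq> top" using C by (auto simp: ennreal_eq_0_iff)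
  have "Lp_var_norm p G / ennreal C \<le> Lp_var_norm p F"
    unfolding Lp_var_norm_def[of p F]
  proof (rule Inf_greatest)
    fix y assume "y \<in> {ennreal lam |lam. 0 < lam \<and> (\<integral>\<^sup>+ x. ennpow (F x / ennreal lam) (p x) \<partial>lebesgue) \<le> 1}"
    then obtain lam where "y = ennreal lam" "Lp_var_norm p G \<le> ennreal C * ennreal lam" using step by blast
    then show "Lp_var_norm p G / ennreal C \<le> y"
      using C by (intro divide_le_posI_ennreal) auto
  qed
  then have "ennreal C * (Lp_var_norm p G / ennreal C) \<le> ennreal C * Lp_var_norm p F" by (rule mult_left_mono) simp
  also have "ennreal C * (Lp_var_norm p G / ennreal C) = Lp_var_norm p G"
    unfolding ennreal_times_divide mult.commute[of "ennreal C"] by (rule mult_divide_eq_ennreal [OF C0])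
  finally show ?thesis by (simp add: C_def)
qed

lemma admissible_scale: "admissible Q g \<Longrightarrow> 0 < lam \<Longrightarrow> admissible Q (\<lambda>k x. g k x / lam)"
  unfolding admissible_def by (auto intro!: borel_measurable_divide)

lemma suminf_scale:
  assumes "\<And>k. 0 \<le> g k" "0 < lam"
  shows "(\<Sum>k. ennreal (g k / lam)) = (\<Sum>k. ennreal (g k)) / ennreal lam"
  unfolding divide_ennreal_def ennreal_suminf_multc [symmetric]
  using assms by (simp add: inverse_ennreal divide_inverse ennreal_mult)

lemma cube_avg_scale:
  assumes "f \<in> borel_measurable lebesgue" "Q \<in> sets lebesgue" "\<And>x. 0 \<le> f x" "0 < lam"
  shows "cube_avg Q (\<lambda>x. f x / lam) = cube_avg Q f / ennreal lam"
proof -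
  have "cube_avg Q (\<lambda>x. f x / lam) = set_mean Q (\<lambda>x. inverse (ennreal lam) * ennreal (f x))"
    unfolding cube_avg_def set_mean_def using assms(3,4)
    by (simp add: inverse_ennreal divide_inverse ennreal_mult mult.commute)
  also have "\<dots> = inverse (ennreal lam) * set_mean Q (\<lambda>x. ennreal (f x))"
    using assms by (intro set_mean_cmult) auto
  finally show ?thesis by (simp add: cube_avg_def set_mean_def divide_ennreal_def mult.commute)
qed

lemma suminf_cube_avg_scale:
  assumes adm: "admissible Q g" and lam: "0 < lam" and q: "0 < q"
  shows "(\<Sum>k. ennpow (cube_avg (Q k) (\<lambda>y. (g k y / lam) powr q)) (1 / q) * indicator (Q k) x)
    = (\<Sum>k. ennpow (cube_avg (Q k) (\<lambda>y. g k y powr q)) (1 / q) * indicator (Q k) x) / ennreal lam"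
proof -
  have "ennpow (cube_avg (Q k) (\<lambda>y. (g k y / lam) powr q)) (1 / q)
     = ennpow (cube_avg (Q k) (\<lambda>y. g k y powr q)) (1 / q) * inverse (ennreal lam)" for k
  proof -
    have "is_cube (Q k)" and [measurable]: "g k \<in> borel_measurable lebesgue" and g: "\<And>x. 0 \<le> g k x"
      using adm by (auto simp: admissible_def)
    then have Q: "Q k \<in> sets lebesgue" using cube_in_ball by metis
    have "cube_avg (Q k) (\<lambda>y. (g k y / lam) powr q) = cube_avg (Q k) (\<lambda>y. g k y powr q / lam powr q)"
      using g lam by (simp add: powr_divide)
    also have "\<dots> = cube_avg (Q k) (\<lambda>y. g k y powr q) / ennreal (lam powr q)"
      using Q lam by (intro cube_avg_scale) auto
    also have "\<dots> = cube_avg (Q k) (\<lambda>y. g k y powr q) * ennpow (inverse (ennreal lam)) q"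
      using lam q by (simp add: divide_ennreal_def flip: ennpow_inverse_base)
    finally show ?thesis using q by (simp add: ennpow_mult ennpow_ennpow)
  qed
  then show ?thesis
    unfolding divide_ennreal_def ennreal_suminf_multc [symmetric] by (simp add: mult_ac)
qed

theorem lemma4p8:
  fixes p :: "real ^ 'n \<Rightarrow> real"
  assumes "p \<in> exponents" and "0 < p_minus p" and "log_Hoelder p"
  shows "(p_plus p < 1 \<longrightarrow>
           (\<exists>C > 0. \<forall>Q g. admissible Q g \<longrightarrow>
             Lp_var_norm p (\<lambda>x. \<Sum>k. ennreal (g k x))
               \<le> ennreal C * Lp_var_norm p (\<lambda>x. \<Sum>k. cube_avg (Q k) (g k) * indicator (Q k) x)))
       \<and> (p_plus p < \<infinity> \<longrightarrow>
           (\<forall>q :: real. 1 \<le> q \<and> p_plus p < ereal q \<longrightarrow>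
             (\<exists>C > 0. \<forall>Q g. admissible Q g \<longrightarrow>
               Lp_var_norm p (\<lambda>x. \<Sum>k. ennreal (g k x))
                 \<le> ennreal C * Lp_var_norm p (\<lambda>x. \<Sum>k.
                      ennpow (cube_avg (Q k) (\<lambda>y. g k y powr q)) (1 / q) * indicator (Q k) x))))"
proof -
  have pm: "p \<in> borel_measurable lebesgue" and LH: "log_Hoelder p"
    using assms by (auto simp: exponents_def)
  obtain l where l: "0 < l" "\<And>x. l \<le> p x"
  proof -
    obtain z where z: "0 < z" "AE x in lebesgue. z \<le> ereal (p x)"
      using assms(2) unfolding p_minus_def less_Sup_iff by blast
    obtain l where l: "0 < ereal l" "ereal l < z" using ereal_dense2[OF z(1)] by blast
    have "AE x in lebesgue. p x \<in> {l..}"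
      using z(2) by eventually_elim (use l in \<open>auto dest: less_le_trans\<close>)
    from log_Hoelder_AE_imp[OF LH _ this] have "\<And>x. l \<le> p x" by auto
    with l that show thesis by auto
  qed
  have upper: "\<exists>u < b. \<forall>x. p x \<le> u" if b: "p_plus p < ereal b" for b
  proof -
    obtain u where u: "p_plus p < ereal u" "ereal u < ereal b" using ereal_dense2[OF b] by blast
    have "AE x in lebesgue. ereal (p x) \<le> p_plus p" unfolding p_plus_def by (rule esssup_AE)
    then have "AE x in lebesgue. p x \<in> {..u}"
      by eventually_elim (use u in \<open>auto dest: le_less_trans\<close>)
    from log_Hoelder_AE_imp[OF LH _ this] have "\<And>x. p x \<le> u" by auto
    with u(2) show ?thesis by auto
  qed
  have norm_bound: "Lp_var_norm p (\<lambda>x. \<Sum>k. ennreal (g k x)) \<le> ennreal (K powr (1 / l)) *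
      Lp_var_norm p (\<lambda>x. \<Sum>k. ennpow (cube_avg (Q k) (\<lambda>y. g k y powr q)) (1 / q) * indicator (Q k) x)"
    if K: "1 \<le> K" and q: "0 < q" and adm: "admissible Q g"
      and mod: "\<And>Q g. admissible Q g \<Longrightarrow>
       (\<integral>\<^sup>+ x. ennpow (\<Sum>k. ennpow (cube_avg (Q k) (\<lambda>y. g k y powr q)) (1 / q) * indicator (Q k) x) (p x) \<partial>lebesgue) \<le> 1 \<Longrightarrow>
       (\<integral>\<^sup>+ x. ennpow (\<Sum>k. ennreal (g k x)) (p x) \<partial>lebesgue) \<le> ennreal K" for K q Q g
  proof (rule Lp_var_norm_le_of_modular [OF l pm K])
    have [measurable]: "g k \<in> borel_measurable lebesgue" for k using adm by (simp add: admissible_def)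
    show "(\<lambda>x. \<Sum>k. ennreal (g k x)) \<in> borel_measurable lebesgue" by measurable
    have g0: "0 \<le> g k x" for k x using adm by (simp add: admissible_def)
    fix lam :: real assume lam: "0 < lam"
      and int: "(\<integral>\<^sup>+ x. ennpow ((\<Sum>k. ennpow (cube_avg (Q k) (\<lambda>y. g k y powr q)) (1 / q) * indicator (Q k) x)
                  / ennreal lam) (p x) \<partial>lebesgue) \<le> 1"
    show "(\<integral>\<^sup>+ x. ennpow ((\<Sum>k. ennreal (g k x)) / ennreal lam) (p x) \<partial>lebesgue) \<le> ennreal K"
      using mod[OF admissible_scale[OF adm lam]] int
      unfolding suminf_cube_avg_scale[OF adm lam q] suminf_scale[OF g0 lam] by blast
  qed
  have avg1: "ennpow (cube_avg (Q k) (\<lambda>y. g k y powr 1)) (1 / 1) = cube_avg (Q k) (g k)"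
    if "admissible Q g" for Q and g :: "nat \<Rightarrow> real ^ 'n \<Rightarrow> real" and k
    using that by (simp add: admissible_def)
  have below1: "\<exists>C > 0. \<forall>Q g. admissible Q g \<longrightarrow>
             Lp_var_norm p (\<lambda>x. \<Sum>k. ennreal (g k x))
               \<le> ennreal C * Lp_var_norm p (\<lambda>x. \<Sum>k. cube_avg (Q k) (g k) * indicator (Q k) x)"
    if lt1: "p_plus p < 1"
  proof -
    obtain u where u: "u < 1" "\<And>x. p x \<le> u" using upper[OF lt1 [unfolded one_ereal_def]] by blast
    from modular_bound_exponent_below_1[OF pm LH l u(2,1)]
    obtain K where K: "1 \<le> K"
      "\<And>Q g. admissible Q g \<Longrightarrow>
       (\<integral>\<^sup>+ x. ennpow (\<Sum>k. cube_avg (Q k) (g k) * indicator (Q k) x) (p x) \<partial>lebesgue) \<le> 1 \<Longrightarrow>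
       (\<integral>\<^sup>+ x. ennpow (\<Sum>k. ennreal (g k x)) (p x) \<partial>lebesgue) \<le> ennreal K" by blast
    show ?thesis
    proof (intro exI[of _ "K powr (1 / l)"] conjI allI impI)
      show "0 < K powr (1 / l)" using K(1) by simp
      fix Q and g :: "nat \<Rightarrow> real ^ 'n \<Rightarrow> real" assume adm: "admissible Q g"
      show "Lp_var_norm p (\<lambda>x. \<Sum>k. ennreal (g k x))
          \<le> ennreal (K powr (1 / l)) * Lp_var_norm p (\<lambda>x. \<Sum>k. cube_avg (Q k) (g k) * indicator (Q k) x)"
        using norm_bound[OF K(1) _ adm, of 1] K(2) by (simp only: avg1 adm zero_less_one)
    qed
  qed
  show ?thesis
  proof (intro conjI impI allI below1)
    fix q :: real assume q: "1 \<le> q \<and> p_plus p < ereal q"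
    show "\<exists>C > 0. \<forall>Q g. admissible Q g \<longrightarrow>
               Lp_var_norm p (\<lambda>x. \<Sum>k. ennreal (g k x))
                 \<le> ennreal C * Lp_var_norm p (\<lambda>x. \<Sum>k.
                      ennpow (cube_avg (Q k) (\<lambda>y. g k y powr q)) (1 / q) * indicator (Q k) x)"
    proof (cases "q = 1")
      case True
      with q have "p_plus p < 1" by (simp add: one_ereal_def)
      from below1[OF this] show ?thesis unfolding True by (simp only: avg1 cong: imp_cong)
    next
      case False
      with q have q1: "1 < q" by simp
      obtain u where u: "u < q" "\<And>x. p x \<le> u" using upper[of q] q by auto
      from modular_bound_power_means[OF pm LH l u(2) q1 u(1)]
      obtain K where K: "1 \<le> K"
        "\<And>Q g. admissible Q g \<Longrightarrow>
       (\<integral>\<^sup>+ x. ennpow (\<Sum>k. ennpow (cube_avg (Q k) (\<lambda>y. g k y powr q)) (1 / q) * indicator (Q k) x) (p x) \<partial>lebesgue) \<le> 1 \<Longrightarrow>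
       (\<integral>\<^sup>+ x. ennpow (\<Sum>k. ennreal (g k x)) (p x) \<partial>lebesgue) \<le> ennreal K" by blast
      show ?thesis
      proof (intro exI[of _ "K powr (1 / l)"] conjI allI impI)
        show "0 < K powr (1 / l)" using K(1) by simp
      qed (rule norm_bound [OF K(1) _ _ K(2)], use q1 in simp_all)
    qed
  qed
qed

end
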